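(* Let $\Gamma$ be a finitely generated group. Let $A$ be a finitely generated abelian group, decomposed as $A = A_0 \oplus \bigoplus_p A_p$, where $A_0$ is free abelian, $p$ ranges over all primes, and $A_p$ is a finite abelian $p$-group for each prime $p$. Decompose further $A_p \cong (\mathbb{Z}/p\mathbb{Z})^{d^p_1} \oplus \cdots \oplus (\mathbb{Z}/p^m\mathbb{Z})^{d^p_m}$, where $d^p_i \in \mathbb{N}$ (and $m$ may depend on $p$). Then the following are equivalent: 1. $A \wr \Gamma$ is Hopfian. 2. $\Gamma$ is Hopfian, and for each prime $p$ the matrix ring $\mathbb{M}_{\max_i(d^p_i)}(\mathbb{F}_p[\Gamma])$ is directly finite.
   Context: The (standard, restricted) wreath product is $A \wr \Gamma := \left(\bigoplus_\Gamma A\right) \rtimes \Gamma$, where $\bigoplus_\Gamma A$ is the group of finitely supported functions $f\colon\Gamma \to A$ and $\Gamma$ acts by $({}_\gamma f)(x) = f(\gamma^{-1}x)$. A group is Hopfian if every surjective endomorphism of it is an automorphism. $\mathbb{N}$ contains $0$. $\mathbb{M}_d(R)$ is the ring of $d\times d$ matrices over $R$; $\mathbb{F}_p[\Gamma]$ is the group ring over the field with $p$ elements. A ring $R$ with identity is directly finite if for all $x,y\in R$, $xy=1$ implies $yx=1$. If $A_p$ is trivial (so all $d^p_i=0$), then $\mathbb{M}_0$ is the zero ring and the condition at $p$ is vacuously satisfied. *)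

theory Defs
  imports
    "HOL-Algebra.Product_Groups"
    "HOL-Algebra.Free_Abelian_Groups"
    "HOL-Number_Theory.Residues"
begin

definition finitely_generated_group :: "('a, 'm) monoid_scheme \<Rightarrow> bool" where
  "finitely_generated_group G \<longleftrightarrow>
     group G \<and> (\<exists>S. finite S \<and> S \<subseteq> carrier G \<and> generate G S = carrier G)"

definition p_group :: "nat \<Rightarrow> ('a, 'm) monoid_scheme \<Rightarrow> bool" where
  "p_group p G \<longleftrightarrow> group G \<and> (\<forall>x\<in>carrier G. \<exists>k. group.ord G x = p ^ k)"

definition hopfian :: "('a, 'm) monoid_scheme \<Rightarrow> bool" where
  "hopfian G \<longleftrightarrow>
     group G \<and> (\<forall>\<phi>\<in>hom G G. \<phi> ` carrier G = carrier G \<longrightarrow> \<phi> \<in> iso G G)"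

definition semidirect_product ::
  "('n, 'k) monoid_scheme \<Rightarrow> ('h, 'm) monoid_scheme \<Rightarrow> ('h \<Rightarrow> 'n \<Rightarrow> 'n) \<Rightarrow> ('n \<times> 'h) monoid" where
  "semidirect_product N H act =
     \<lparr>carrier = carrier N \<times> carrier H,
      monoid.mult = (\<lambda>(a, g) (b, h). (a \<otimes>\<^bsub>N\<^esub> act g b, g \<otimes>\<^bsub>H\<^esub> h)),
      one = (\<one>\<^bsub>N\<^esub>, \<one>\<^bsub>H\<^esub>)\<rparr>"

(* The restricted (standard) wreath product: sum_group consists of the finitely supported
   functions on carrier G, which are undefined outside carrier G. *)
definition wreath_product ::
  "('a, 'k) monoid_scheme \<Rightarrow> ('g, 'm) monoid_scheme \<Rightarrow> (('g \<Rightarrow> 'a) \<times> 'g) monoid" where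
  "wreath_product A G =
     semidirect_product (sum_group (carrier G) (\<lambda>_. A)) G
       (\<lambda>g f. \<lambda>x\<in>carrier G. f (inv\<^bsub>G\<^esub> g \<otimes>\<^bsub>G\<^esub> x))"

definition group_ring ::
  "('r, 'k) ring_scheme \<Rightarrow> ('g, 'm) monoid_scheme \<Rightarrow> ('g \<Rightarrow> 'r) ring" where
  "group_ring R G =
     \<lparr>carrier = {f \<in> carrier G \<rightarrow>\<^sub>E carrier R. finite {x \<in> carrier G. f x \<noteq> \<zero>\<^bsub>R\<^esub>}},
      monoid.mult = (\<lambda>f h. \<lambda>x\<in>carrier G.
        \<Oplus>\<^bsub>R\<^esub>y\<in>{y \<in> carrier G. f y \<noteq> \<zero>\<^bsub>R\<^esub>}. f y \<otimes>\<^bsub>R\<^esub> h (inv\<^bsub>G\<^esub> y \<otimes>\<^bsub>G\<^esub> x)),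
      one = (\<lambda>x\<in>carrier G. if x = \<one>\<^bsub>G\<^esub> then \<one>\<^bsub>R\<^esub> else \<zero>\<^bsub>R\<^esub>),
      ring.zero = (\<lambda>x\<in>carrier G. \<zero>\<^bsub>R\<^esub>),
      ring.add = (\<lambda>f h. \<lambda>x\<in>carrier G. f x \<oplus>\<^bsub>R\<^esub> h x)\<rparr>"

(* For n = 0 this is the zero ring: its only element is the empty matrix. *)
definition matrix_ring :: "nat \<Rightarrow> ('r, 'k) ring_scheme \<Rightarrow> (nat \<times> nat \<Rightarrow> 'r) ring" where
  "matrix_ring n R =
     \<lparr>carrier = {..<n} \<times> {..<n} \<rightarrow>\<^sub>E carrier R,
      monoid.mult = (\<lambda>M N. \<lambda>(i, j)\<in>{..<n} \<times> {..<n}.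
        \<Oplus>\<^bsub>R\<^esub>k\<in>{..<n}. M (i, k) \<otimes>\<^bsub>R\<^esub> N (k, j)),
      one = (\<lambda>(i, j)\<in>{..<n} \<times> {..<n}. if i = j then \<one>\<^bsub>R\<^esub> else \<zero>\<^bsub>R\<^esub>),
      ring.zero = (\<lambda>(i, j)\<in>{..<n} \<times> {..<n}. \<zero>\<^bsub>R\<^esub>),
      ring.add = (\<lambda>M N. \<lambda>(i, j)\<in>{..<n} \<times> {..<n}. M (i, j) \<oplus>\<^bsub>R\<^esub> N (i, j))\<rparr>"

definition directly_finite :: "('r, 'k) ring_scheme \<Rightarrow> bool" where
  "directly_finite R \<longleftrightarrow>
     (\<forall>x\<in>carrier R. \<forall>y\<in>carrier R. x \<otimes>\<^bsub>R\<^esub> y = \<one>\<^bsub>R\<^esub> \<longrightarrow> y \<otimes>\<^bsub>R\<^esub> x = \<one>\<^bsub>R\<^esub>)"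

end

theory Submission
  imports Defs "HOL-Library.Function_Algebras"
begin

text \<open>
  Let \<open>W = A \<wr> \<Gamma>\<close> and let \<open>N\<close> be its base group, the finitely supported functions from
  \<open>\<Gamma>\<close> to \<open>A\<close>. Being abelian, \<open>N\<close> is a module over the integral group ring of \<open>\<Gamma>\<close>, and the
  proof turns the Hopf property of \<open>W\<close> into a question about this module.

  \<^bold>\<open>Reduction to the base.\<close> Let \<open>\<phi>\<close> be a surjective endomorphism of \<open>W\<close>, and let \<open>\<Gamma>\<close> be Hopfian.
  If \<open>\<phi>\<close> maps \<open>N\<close> into \<open>N\<close>, it induces a surjective endomorphism of \<open>\<Gamma>\<close>, hence an automorphism
  \<open>\<alpha>\<close>; then \<open>\<phi>\<close> maps \<open>N\<close> onto \<open>N\<close>, and after twisting by \<open>\<alpha>\<close> this restriction is a surjective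
  module endomorphism of \<open>N\<close>, which is injective if and only if \<open>\<phi>\<close> is. The image of \<open>N\<close> is an
  abelian normal subgroup, and commutators with \<open>N\<close> show that it can leave \<open>N\<close> only if \<open>A\<close> has
  exponent two and \<open>\<phi> N\<close> meets just two cosets of \<open>N\<close>. In that case \<open>\<phi> \<circ> \<phi>\<close> kills \<open>N\<close> when \<open>\<Gamma>\<close>
  is infinite, so that \<open>\<Gamma>\<close> maps onto \<open>W\<close> and then onto itself with a nontrivial kernel, which is
  impossible; when \<open>\<Gamma>\<close> is finite, so is \<open>W\<close>. In the other direction, surjective endomorphisms of
  \<open>\<Gamma>\<close> and of the module \<open>N\<close> both extend to \<open>W\<close>. Hence \<open>W\<close> is Hopfian if and only if \<open>\<Gamma>\<close> is
  Hopfian and every surjective module endomorphism of \<open>N\<close> is injective (\<open>hopfian_wreath_iff\<close>).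

  \<^bold>\<open>The module.\<close> Present \<open>A\<close> by generators indexed by a set \<open>I\<close>, where the generator \<open>k\<close> has order
  \<open>n k\<close>, with \<open>0\<close> for infinite order. Then \<open>N\<close> is the free module on \<open>I\<close> modulo the multiples of
  \<open>n k\<close> in each coordinate \<open>k\<close>. Its endomorphisms lift to endomorphisms of the free module that
  preserve these relations (\<open>base_hopfian_iff_hopfian_mod\<close>). A lifted endomorphism sends torsion
  coordinates to torsion coordinates and does not mix different primes, so the free part and the
  primary parts can be treated one after the other.

  \<^bold>\<open>The free part.\<close> A surjective endomorphism \<open>\<theta>\<close> of a free module of
  finite rank has a right inverse \<open>\<rho>\<close>, and \<open>P = 1 - \<rho>\<theta>\<close> is an idempotent of trace zero. By a
  theorem of Kaplansky such an idempotent vanishes (\<open>idempotent_trace_zero\<close>).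

  \<^bold>\<open>The primary part at \<open>p\<close>.\<close> Group the coordinates by the exponent \<open>i\<close> of their order \<open>p ^ i\<close>.
  Modulo \<open>p\<close> the endomorphism is block triangular with respect to this grouping, and the diagonal
  block for \<open>i\<close> is a square matrix of size \<open>d p i\<close> over \<open>F\<^sub>p[\<Gamma>]\<close>. Surjectivity together with direct
  finiteness makes the blocks injective, starting from the largest exponent, and injectivity of all
  the blocks gives injectivity (\<open>hopfian_mod_prime_power\<close>). Direct finiteness in the largest size
  implies it in the smaller ones. Conversely, a one-sided inverse over \<open>F\<^sub>p[\<Gamma>]\<close> that is not
  two-sided lifts to an endomorphism of the block for a single \<open>i\<close>, which is surjective since it is so
  modulo the nilpotent ideal generated by \<open>p\<close>, and is not injective
  (\<open>directly_finite_mod_of_hopfian_mod\<close>).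
\<close>

section \<open>Free modules over the integral group ring\<close>

definition restr :: "'i set \<Rightarrow> ('i \<times> 'g \<Rightarrow> int) \<Rightarrow> 'i \<times> 'g \<Rightarrow> int" where
  "restr J f = (\<lambda>z. if fst z \<in> J then f z else 0)"

definition delta :: "'z \<Rightarrow> 'z \<Rightarrow> int" where
  "delta z = (\<lambda>w. if w = z then 1 else 0)"

lemma restr_add: "restr J (f + h) = restr J f + restr J h"
  and restr_diff: "restr J (f - h) = restr J f - restr J h"
  by (auto simp: restr_def)

lemma restr_idem [simp]: "restr J (restr J f) = restr J f"
  by (auto simp: restr_def)

lemma int_induct_plus_minus:
  assumes z: "P (0::int)" and s: "\<And>m. P m \<Longrightarrow> P (m + 1)" and n: "\<And>m. P m \<Longrightarrow> P (m - 1)"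
  shows "P m"
  by (induction m rule: int_induct [where k = 0]) (use assms in auto)

context group
begin

text \<open>
  An element of the free module on \<open>I\<close> is recorded by its integral coefficients on the pairs
  \<open>(k, x)\<close>, where \<open>(k, x)\<close> stands for the translate by \<open>x\<close> of the generator \<open>k\<close>. Coefficients vanish
  outside of \<open>I \<times> carrier G\<close>, so that elements are equal as soon as they are equal as functions.
\<close>

definition free_module :: "'i set \<Rightarrow> ('i \<times> 'a \<Rightarrow> int) set" where
  "free_module I = {f. finite {z. f z \<noteq> 0} \<and> {z. f z \<noteq> 0} \<subseteq> I \<times> carrier G}"

definition shift :: "'a \<Rightarrow> ('i \<times> 'a \<Rightarrow> int) \<Rightarrow> 'i \<times> 'a \<Rightarrow> int" where
  "shift g f = (\<lambda>(k, x). if x \<in> carrier G then f (k, inv g \<otimes> x) else 0)"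

definition module_endo :: "'i set \<Rightarrow> (('i \<times> 'a \<Rightarrow> int) \<Rightarrow> ('i \<times> 'a \<Rightarrow> int)) \<Rightarrow> bool" where
  "module_endo I \<theta> \<longleftrightarrow>
     (\<forall>f\<in>free_module I. \<theta> f \<in> free_module I) \<and>
     (\<forall>f\<in>free_module I. \<forall>h\<in>free_module I. \<theta> (f + h) = \<theta> f + \<theta> h) \<and>
     (\<forall>g\<in>carrier G. \<forall>f\<in>free_module I. \<theta> (shift g f) = shift g (\<theta> f))"

lemma free_moduleI:
  assumes "finite S" "S \<subseteq> I \<times> carrier G" "\<And>z. z \<notin> S \<Longrightarrow> f z = 0"
  shows "f \<in> free_module I"
proof -
  have "{z. f z \<noteq> 0} \<subseteq> S" using assms(3) by auto
  then show ?thesis using assms(1,2) by (auto simp: free_module_def intro: finite_subset)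
qed

lemma free_module_finite: "f \<in> free_module I \<Longrightarrow> finite {z. f z \<noteq> 0}"
  by (simp add: free_module_def)

lemma free_module_subset: "f \<in> free_module I \<Longrightarrow> {z. f z \<noteq> 0} \<subseteq> I \<times> carrier G"
  by (simp add: free_module_def)

lemma free_module_outside: "f \<in> free_module I \<Longrightarrow> z \<notin> I \<times> carrier G \<Longrightarrow> f z = 0"
  by (auto simp: free_module_def)

lemma free_module_zero [simp]: "0 \<in> free_module I"
  by (simp add: free_module_def)

lemma free_module_add [simp]:
  "f \<in> free_module I \<Longrightarrow> h \<in> free_module I \<Longrightarrow> f + h \<in> free_module I"
  by (rule free_moduleI [of "{z. f z \<noteq> 0} \<union> {z. h z \<noteq> 0}"]) (auto simp: free_module_def)

lemma free_module_diff [simp]: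
  "f \<in> free_module I \<Longrightarrow> h \<in> free_module I \<Longrightarrow> f - h \<in> free_module I"
  by (rule free_moduleI [of "{z. f z \<noteq> 0} \<union> {z. h z \<noteq> 0}"]) (auto simp: free_module_def)

lemma free_module_scale [simp]: "f \<in> free_module I \<Longrightarrow> (\<lambda>z. c * f z) \<in> free_module I"
  by (rule free_moduleI [of "{z. f z \<noteq> 0}"]) (auto simp: free_module_def)

lemma free_module_delta [simp]:
  "k \<in> I \<Longrightarrow> y \<in> carrier G \<Longrightarrow> delta (k, y) \<in> free_module I"
  by (rule free_moduleI [of "{(k, y)}"]) (auto simp: delta_def)

lemma free_module_sum:
  assumes "\<And>s. s \<in> S \<Longrightarrow> F s \<in> free_module I"
  shows "(\<lambda>w. \<Sum>s\<in>S. c s * F s w) \<in> free_module I"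
  using assms
proof (induction S rule: infinite_finite_induct)
  case (insert x S)
  have "(\<lambda>w. \<Sum>s\<in>insert x S. c s * F s w) = (\<lambda>w. c x * F x w) + (\<lambda>w. \<Sum>s\<in>S. c s * F s w)"
    using insert by (auto simp: fun_eq_iff)
  then show ?case using insert by simp
qed (simp_all flip: zero_fun_def)

lemma free_module_mono: "J \<subseteq> I \<Longrightarrow> f \<in> free_module J \<Longrightarrow> f \<in> free_module I"
  by (auto simp: free_module_def)

lemma free_module_restr: "f \<in> free_module I \<Longrightarrow> restr J f \<in> free_module (I \<inter> J)"
  by (rule free_moduleI [of "{z. f z \<noteq> 0} \<inter> {z. fst z \<in> J}"])
    (auto simp: free_module_def restr_def)

lemma free_module_restr_subset: "f \<in> free_module I \<Longrightarrow> J \<subseteq> I \<Longrightarrow> restr J f \<in> free_module J"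
  using free_module_restr [of f I J] by (simp add: Int_absorb1)

lemma free_module_restr' [simp]: "f \<in> free_module I \<Longrightarrow> restr J f \<in> free_module I"
  using free_module_mono free_module_restr Int_lower1 by metis

lemma restr_free_module: "f \<in> free_module J \<Longrightarrow> restr J f = f"
  by (auto simp: restr_def free_module_def fun_eq_iff)

lemma shift_add: "shift g (f + h) = shift g f + shift g h"
  by (auto simp: shift_def)

lemma shift_scale: "shift g (\<lambda>z. c * f z) = (\<lambda>z. c * shift g f z)"
  by (auto simp: shift_def)

lemma shift_sum: "shift g (\<lambda>w. \<Sum>s\<in>S. c s * F s w) = (\<lambda>w. \<Sum>s\<in>S. c s * shift g (F s) w)"
  by (auto simp: shift_def)

lemma shift_restr: "shift g (restr J f) = restr J (shift g f)"
  by (auto simp: shift_def restr_def)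

lemma inj_translate: "g \<in> carrier G \<Longrightarrow> inj_on (\<lambda>(k, y). (k, g \<otimes> y)) (UNIV \<times> carrier G)"
  by (auto simp: inj_on_def)

lemma supp_shift:
  assumes "f \<in> free_module I" "g \<in> carrier G"
  shows "{z. shift g f z \<noteq> 0} = (\<lambda>(k, y). (k, g \<otimes> y)) ` {z. f z \<noteq> 0}" (is "?L = ?R")
proof
  show "?L \<subseteq> ?R"
  proof clarify
    fix k x assume "shift g f (k, x) \<noteq> 0"
    then have "x \<in> carrier G" "f (k, inv g \<otimes> x) \<noteq> 0"
      by (auto simp: shift_def split: if_splits)
    moreover from this have "(k, x) = (\<lambda>(k, y). (k, g \<otimes> y)) (k, inv g \<otimes> x)"
      using assms by (simp add: inv_solve_left' m_assoc [symmetric])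
    ultimately show "(k, x) \<in> ?R" by blast
  qed
  show "?R \<subseteq> ?L"
    using assms free_module_subset [OF assms(1)]
    by (auto simp: shift_def m_assoc [symmetric])
qed

lemma free_module_shift [simp]:
  assumes "f \<in> free_module I" "g \<in> carrier G" shows "shift g f \<in> free_module I"
  unfolding free_module_def mem_Collect_eq supp_shift [OF assms]
  using assms free_module_subset [OF assms(1)] free_module_finite [OF assms(1)] by auto

lemma shift_delta:
  "g \<in> carrier G \<Longrightarrow> y \<in> carrier G \<Longrightarrow> shift g (delta (k, y)) = delta (k, g \<otimes> y)"
  by (auto simp: shift_def delta_def fun_eq_iff inv_solve_left' m_assoc [symmetric])

lemma shift_shift:
  "g \<in> carrier G \<Longrightarrow> h \<in> carrier G \<Longrightarrow> shift g (shift h f) = shift (g \<otimes> h) f"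
  by (auto simp: shift_def fun_eq_iff inv_mult_group m_assoc)

lemma shift_one: "f \<in> free_module I \<Longrightarrow> shift \<one> f = f"
  by (auto simp: shift_def fun_eq_iff dest: free_module_outside)

lemma endo_closed: "module_endo I \<theta> \<Longrightarrow> f \<in> free_module I \<Longrightarrow> \<theta> f \<in> free_module I"
  by (simp add: module_endo_def)

lemma endo_add:
  "module_endo I \<theta> \<Longrightarrow> f \<in> free_module I \<Longrightarrow> h \<in> free_module I \<Longrightarrow> \<theta> (f + h) = \<theta> f + \<theta> h"
  by (simp add: module_endo_def)

lemma endo_shift:
  "module_endo I \<theta> \<Longrightarrow> f \<in> free_module I \<Longrightarrow> g \<in> carrier G \<Longrightarrow> \<theta> (shift g f) = shift g (\<theta> f)"
  by (simp add: module_endo_def)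

lemma endo_zero: assumes "module_endo I \<theta>" shows "\<theta> 0 = 0"
proof -
  have "\<theta> (0 + 0) = \<theta> 0 + \<theta> 0" by (rule endo_add [OF assms]) auto
  then show ?thesis by simp
qed

lemma endo_diff:
  assumes "module_endo I \<theta>" "f \<in> free_module I" "h \<in> free_module I"
  shows "\<theta> (f - h) = \<theta> f - \<theta> h"
proof -
  have "\<theta> (f - h + h) = \<theta> (f - h) + \<theta> h"
    by (rule endo_add [OF assms(1)]) (use assms in auto)
  then have "\<theta> (f - h) = \<theta> (f - h + h) - \<theta> h" by (metis add_diff_cancel)
  also have "f - h + h = f" by (rule diff_add_cancel)
  finally show ?thesis .
qed

lemma endo_scale:
  assumes "module_endo I \<theta>" "f \<in> free_module I"
  shows "\<theta> (\<lambda>z. c * f z) = (\<lambda>z. c * \<theta> f z)"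
proof (induction c rule: int_induct_plus_minus)
  case 1
  then show ?case using endo_zero [OF assms(1)] by (simp add: zero_fun_def)
next
  case (2 m)
  have "(\<lambda>z. (m + 1) * f z) = (\<lambda>z. m * f z) + f" by (auto simp: distrib_right)
  then have "\<theta> (\<lambda>z. (m + 1) * f z) = \<theta> (\<lambda>z. m * f z) + \<theta> f"
    using endo_add [OF assms(1)] assms(2) by simp
  then show ?case using 2 by (auto simp: algebra_simps)
next
  case (3 m)
  have "(\<lambda>z. (m - 1) * f z) = (\<lambda>z. m * f z) - f" by (auto simp: algebra_simps)
  then have "\<theta> (\<lambda>z. (m - 1) * f z) = \<theta> (\<lambda>z. m * f z) - \<theta> f"
    using endo_diff [OF assms(1), of "\<lambda>z. m * f z" f] assms(2) by (simp only: free_module_scale)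
  then show ?case using 3 by (auto simp: fun_eq_iff left_diff_distrib)
qed

lemma endo_sum:
  assumes "module_endo I \<theta>" "\<And>s. s \<in> S \<Longrightarrow> F s \<in> free_module I"
  shows "\<theta> (\<lambda>w. \<Sum>s\<in>S. c s * F s w) = (\<lambda>w. \<Sum>s\<in>S. c s * \<theta> (F s) w)"
  using assms(2)
proof (induction S rule: infinite_finite_induct)
  case (insert x S)
  have "(\<lambda>w. \<Sum>s\<in>insert x S. c s * F s w) = (\<lambda>w. c x * F x w) + (\<lambda>w. \<Sum>s\<in>S. c s * F s w)"
    using insert by (auto simp: fun_eq_iff)
  then have "\<theta> (\<lambda>w. \<Sum>s\<in>insert x S. c s * F s w)
      = \<theta> (\<lambda>w. c x * F x w) + \<theta> (\<lambda>w. \<Sum>s\<in>S. c s * F s w)"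
    using insert.prems free_module_sum [of S F I c] endo_add [OF assms(1)] by simp
  then show ?case using insert endo_scale [OF assms(1)] by (auto simp: fun_eq_iff)
qed (use endo_zero [OF assms(1)] in \<open>simp_all add: zero_fun_def\<close>)

lemma module_expand:
  assumes "finite S" "\<And>z. z \<notin> S \<Longrightarrow> f z = 0"
  shows "f = (\<lambda>w. \<Sum>z\<in>S. f z * delta z w)"
proof
  fix w
  have "(\<Sum>z\<in>S. f z * delta z w) = (\<Sum>z\<in>S. if z = w then f z else 0)"
    by (intro sum.cong) (auto simp: delta_def)
  then show "f w = (\<Sum>z\<in>S. f z * delta z w)" using assms by auto
qed

lemma endo_delta:
  assumes "module_endo I \<theta>" "k \<in> I" "y \<in> carrier G"
  shows "\<theta> (delta (k, y)) = shift y (\<theta> (delta (k, \<one>)))"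
  using endo_shift [OF assms(1), of "delta (k, \<one>)" y] assms by (simp add: shift_delta)

text \<open>
  By additivity and equivariance an endomorphism is determined by its values on the generators
  \<open>delta (k, \<one>)\<close>; all later computations with endomorphisms rest on this formula. Any finite set
  containing the support may be summed over, since several elements often have to be expanded over
  a common set.
\<close>

lemma endo_expand:
  assumes "module_endo I \<theta>" "finite S" "S \<subseteq> I \<times> carrier G" "\<And>z. z \<notin> S \<Longrightarrow> f z = 0"
  shows "\<theta> f = (\<lambda>w. \<Sum>z\<in>S. f z * shift (snd z) (\<theta> (delta (fst z, \<one>))) w)"
proof -
  have "\<theta> f = \<theta> (\<lambda>w. \<Sum>z\<in>S. f z * delta z w)"
    by (rule arg_cong [OF module_expand [OF assms(2,4)]])
  also have "\<dots> = (\<lambda>w. \<Sum>z\<in>S. f z * \<theta> (delta z) w)"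
    by (rule endo_sum [OF assms(1)]) (use assms(3) in auto)
  also have "\<dots> = (\<lambda>w. \<Sum>z\<in>S. f z * shift (snd z) (\<theta> (delta (fst z, \<one>))) w)"
  proof (intro ext sum.cong refl)
    fix w z assume "z \<in> S"
    then have "\<theta> (delta (fst z, snd z)) = shift (snd z) (\<theta> (delta (fst z, \<one>)))"
      using assms(3) by (intro endo_delta [OF assms(1)]) auto
    then show "f z * \<theta> (delta z) w = f z * shift (snd z) (\<theta> (delta (fst z, \<one>))) w"
      by simp
  qed
  finally show ?thesis .
qed

lemma endo_expand':
  assumes "module_endo I \<theta>" "f \<in> free_module I"
  shows "\<theta> f = (\<lambda>w. \<Sum>z | f z \<noteq> 0. f z * shift (snd z) (\<theta> (delta (fst z, \<one>))) w)"
  by (rule endo_expand) (use assms in \<open>auto simp: free_module_def\<close>)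

lemma endo_comp: "module_endo I \<theta> \<Longrightarrow> module_endo I \<eta> \<Longrightarrow> module_endo I (\<lambda>f. \<theta> (\<eta> f))"
  by (simp add: module_endo_def)

lemma endo_id: "module_endo I (\<lambda>f. f)"
  by (simp add: module_endo_def)

lemma shift_diff: "shift g (f - h) = shift g f - shift g h"
  by (auto simp: shift_def)

lemma endo_minus:
  assumes "module_endo I \<theta>" "module_endo I \<eta>"
  shows "module_endo I (\<lambda>f. \<theta> f - \<eta> f)"
  unfolding module_endo_def
  using assms
  by (intro conjI ballI) (simp_all add: endo_closed endo_add endo_shift shift_diff fun_eq_iff)

lemma endo_scaleby:
  assumes "module_endo I \<theta>"
  shows "module_endo I (\<lambda>f z. c * \<theta> f z)"
  unfolding module_endo_def
  using assms
  by (intro conjI ballI)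
    (simp_all add: endo_closed endo_add endo_shift shift_scale fun_eq_iff distrib_left)

lemma endo_restr:
  assumes \<theta>: "module_endo I \<theta>" and J: "J \<subseteq> I"
  shows "module_endo J (\<lambda>f. restr J (\<theta> f))"
  unfolding module_endo_def
proof (intro conjI ballI)
  fix f assume "f \<in> free_module J"
  then have f: "f \<in> free_module I" by (rule free_module_mono [OF J])
  show "restr J (\<theta> f) \<in> free_module J"
    by (rule free_module_restr_subset [OF endo_closed [OF \<theta> f] J])
  fix h assume "h \<in> free_module J"
  then have h: "h \<in> free_module I" by (rule free_module_mono [OF J])
  show "restr J (\<theta> (f + h)) = restr J (\<theta> f) + restr J (\<theta> h)"
    by (simp only: endo_add [OF \<theta> f h] restr_add)
next
  fix g f assume g: "g \<in> carrier G" and "f \<in> free_module J"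
  then have f: "f \<in> free_module I" using free_module_mono [OF J] by blast
  show "restr J (\<theta> (shift g f)) = shift g (restr J (\<theta> f))"
    by (simp only: endo_shift [OF \<theta> f g] shift_restr)
qed

text \<open>
  The endomorphism with prescribed values on the generators. It is right multiplication by the
  matrix over the group ring whose rows are the \<open>M k\<close>.
\<close>

definition linear_extension :: "('i \<Rightarrow> 'i \<times> 'a \<Rightarrow> int) \<Rightarrow> ('i \<times> 'a \<Rightarrow> int) \<Rightarrow> 'i \<times> 'a \<Rightarrow> int" where
  "linear_extension M f = (\<lambda>w. \<Sum>z | f z \<noteq> 0. f z * shift (snd z) (M (fst z)) w)"

lemma linear_extension_eq:
  assumes "finite S" "\<And>z. z \<notin> S \<Longrightarrow> f z = 0"
  shows "linear_extension M f = (\<lambda>w. \<Sum>z\<in>S. f z * shift (snd z) (M (fst z)) w)"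
  unfolding linear_extension_def using assms by (intro ext sum.mono_neutral_left) auto

lemma endo_linear_extension:
  assumes M: "\<And>k. k \<in> I \<Longrightarrow> M k \<in> free_module I"
  shows "module_endo I (linear_extension M)"
  unfolding module_endo_def
proof (intro conjI ballI)
  fix f assume f: "f \<in> free_module I"
  show "linear_extension M f \<in> free_module I"
    unfolding linear_extension_def using free_module_subset [OF f]
    by (intro free_module_sum free_module_shift M) auto
  fix h assume h: "h \<in> free_module I"
  let ?S = "{z. f z \<noteq> 0} \<union> {z. h z \<noteq> 0}"
  have S: "finite ?S" using f h by (simp add: free_module_def)
  show "linear_extension M (f + h) = linear_extension M f + linear_extension M h"
    by (subst (1 2 3) linear_extension_eq [OF S])
      (auto simp: fun_eq_iff sum.distrib algebra_simps)
next
  fix g f assume g: "g \<in> carrier G" and f: "f \<in> free_module I"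
  have i: "inj_on (\<lambda>(k, y). (k, g \<otimes> y)) {z. f z \<noteq> 0}"
    by (rule inj_on_subset [OF inj_translate [OF g]]) (use free_module_subset [OF f] in auto)
  have car: "z \<in> {z. f z \<noteq> 0} \<Longrightarrow> snd z \<in> carrier G" for z
    using free_module_subset [OF f] by auto
  show "linear_extension M (shift g f) = shift g (linear_extension M f)"
    unfolding linear_extension_def supp_shift [OF f g] sum.reindex [OF i] shift_sum
  proof (intro ext sum.cong refl)
    fix w z assume z: "z \<in> {z. f z \<noteq> 0}"
    obtain k y where [simp]: "z = (k, y)" by (cases z)
    have "y \<in> carrier G" using car [OF z] by simp
    then show "((\<lambda>z. shift g f z * shift (snd z) (M (fst z)) w) \<circ> (\<lambda>(k, y). (k, g \<otimes> y))) z
        = f z * shift g (shift (snd z) (M (fst z))) w"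
      using g by (auto simp: shift_shift) (auto simp: shift_def m_assoc [symmetric])
  qed
qed

lemma linear_extension_delta: "M k \<in> free_module I \<Longrightarrow> linear_extension M (delta (k, \<one>)) = M k"
  by (subst linear_extension_eq [of "{(k, \<one>)}"]) (auto simp: delta_def shift_one)

lemma endo_ext:
  assumes "module_endo I \<theta>" "module_endo I \<eta>"
    and "\<And>k. k \<in> I \<Longrightarrow> \<theta> (delta (k, \<one>)) = \<eta> (delta (k, \<one>))" "f \<in> free_module I"
  shows "\<theta> f = \<eta> f"
  unfolding endo_expand' [OF assms(1,4)] endo_expand' [OF assms(2,4)]
  using free_module_subset [OF assms(4)] assms(3) by (intro ext sum.cong) auto

end

section \<open>Kaplansky's theorem: the integral group ring is stably finite\<close>

lemma Cauchy_Schwarz_int: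
  fixes a b :: "'z \<Rightarrow> int"
  shows "(\<Sum>z\<in>S. a z * b z)\<^sup>2 \<le> (\<Sum>z\<in>S. (a z)\<^sup>2) * (\<Sum>z\<in>S. (b z)\<^sup>2)"
proof -
  have "0 \<le> (\<Sum>z\<in>S. \<Sum>w\<in>S. (a z * b w - a w * b z)\<^sup>2)"
    by (intro sum_nonneg) auto
  also have "\<dots> = (\<Sum>z\<in>S. \<Sum>w\<in>S. (a z)\<^sup>2 * (b w)\<^sup>2 + (a w)\<^sup>2 * (b z)\<^sup>2 - 2 * ((a z * b z) * (a w * b w)))"
    by (intro sum.cong refl) (auto simp: power2_eq_square algebra_simps)
  also have "\<dots> = (\<Sum>z\<in>S. \<Sum>w\<in>S. (a z)\<^sup>2 * (b w)\<^sup>2) + (\<Sum>z\<in>S. \<Sum>w\<in>S. (a w)\<^sup>2 * (b z)\<^sup>2)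
      - 2 * (\<Sum>z\<in>S. \<Sum>w\<in>S. (a z * b z) * (a w * b w))"
    by (simp add: sum.distrib sum_subtractf sum_distrib_left)
  also have "(\<Sum>z\<in>S. \<Sum>w\<in>S. (a w)\<^sup>2 * (b z)\<^sup>2) = (\<Sum>z\<in>S. \<Sum>w\<in>S. (a z)\<^sup>2 * (b w)\<^sup>2)"
    by (rule sum.swap)
  finally show ?thesis
    by (simp add: power2_eq_square sum_product)
qed

text \<open>
  Cauchy-Schwarz on the support of \<open>c\<close> only: over the integers the indicator of the support is
  bounded by \<open>c\<^sup>2\<close>, and so the bound does not depend on the size of \<open>S\<close>.
\<close>

lemma sum_mult_square_le:
  fixes a c :: "'z \<Rightarrow> int"
  shows "(\<Sum>z\<in>S. a z * c z)\<^sup>2 \<le> (\<Sum>z\<in>S. (a z)\<^sup>2 * (c z)\<^sup>2) * (\<Sum>z\<in>S. (c z)\<^sup>2)"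
proof -
  define u where "u = (\<lambda>z. if c z = 0 then 0 else (1::int))"
  have "(\<Sum>z\<in>S. a z * c z) = (\<Sum>z\<in>S. (a z * c z) * u z)"
    by (intro sum.cong) (auto simp: u_def)
  then have "(\<Sum>z\<in>S. a z * c z)\<^sup>2 \<le> (\<Sum>z\<in>S. (a z * c z)\<^sup>2) * (\<Sum>z\<in>S. (u z)\<^sup>2)"
    using Cauchy_Schwarz_int [of "\<lambda>z. a z * c z" u S] by simp
  also have "\<dots> \<le> (\<Sum>z\<in>S. (a z * c z)\<^sup>2) * (\<Sum>z\<in>S. (c z)\<^sup>2)"
  proof (intro mult_left_mono sum_mono sum_nonneg)
    show "(u z)\<^sup>2 \<le> (c z)\<^sup>2" for z
      using zero_less_power2 [of "c z"] by (cases "c z = 0") (simp_all add: u_def int_one_le_iff_zero_less)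
  qed auto
  finally show ?thesis by (simp add: power_mult_distrib)
qed

definition inner :: "('z \<Rightarrow> int) \<Rightarrow> ('z \<Rightarrow> int) \<Rightarrow> int" where
  "inner f h = (\<Sum>z | f z \<noteq> 0. f z * h z)"

lemma inner_eq:
  assumes "finite {z. f z \<noteq> 0}" "finite S" "\<And>z. z \<notin> S \<Longrightarrow> f z = 0 \<or> h z = 0"
  shows "inner f h = (\<Sum>z\<in>S. f z * h z)"
proof -
  have "inner f h = (\<Sum>z\<in>{z. f z \<noteq> 0} \<inter> S. f z * h z)"
    unfolding inner_def using assms by (intro sum.mono_neutral_right) auto
  also have "\<dots> = (\<Sum>z\<in>S. f z * h z)"
    using assms by (intro sum.mono_neutral_left) auto
  finally show ?thesis .
qed

lemma inner_scale_left: "inner (\<lambda>z. c * f z) h = c * inner f h"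
  by (cases "c = 0") (auto simp: inner_def sum_distrib_left mult.assoc)

context group
begin

context
  fixes I :: "'i set"
begin

private abbreviation "V \<equiv> free_module I"

lemma inner_commute: "f \<in> V \<Longrightarrow> h \<in> V \<Longrightarrow> inner f h = inner h f"
  by (subst (1 2) inner_eq [of _ "{z. f z \<noteq> 0} \<union> {z. h z \<noteq> 0}"])
    (auto dest: free_module_finite simp: mult.commute)

lemma inner_add_left: "f \<in> V \<Longrightarrow> f' \<in> V \<Longrightarrow> h \<in> V \<Longrightarrow> inner (f + f') h = inner f h + inner f' h"
  using free_module_finite [OF free_module_add, of f I f']
  by (subst (1 2 3) inner_eq [of _ "{z. f z \<noteq> 0} \<union> {z. f' z \<noteq> 0}"])
    (auto dest: free_module_finite simp: distrib_right sum.distrib)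

lemma inner_diff_left: "f \<in> V \<Longrightarrow> f' \<in> V \<Longrightarrow> h \<in> V \<Longrightarrow> inner (f - f') h = inner f h - inner f' h"
  using inner_add_left [of "f - f'" f' h] by (simp only: diff_add_cancel free_module_diff)

lemma inner_diff_right: "f \<in> V \<Longrightarrow> f' \<in> V \<Longrightarrow> h \<in> V \<Longrightarrow> inner h (f - f') = inner h f - inner h f'"
  by (simp only: inner_commute [of h] inner_diff_left free_module_diff)

lemma inner_scale_right: "f \<in> V \<Longrightarrow> h \<in> V \<Longrightarrow> inner h (\<lambda>z. c * f z) = c * inner h f"
  by (simp add: inner_commute [of h] inner_scale_left)

lemma inner_delta: "f \<in> V \<Longrightarrow> inner f (delta z) = f z"
  by (subst inner_eq [of _ "{z}"]) (auto simp: delta_def dest: free_module_finite)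

lemma inner_nonneg: "0 \<le> inner f f"
  unfolding inner_def by (intro sum_nonneg) auto

lemma sum_squares_le_inner:
  assumes "f \<in> V" "finite S" shows "(\<Sum>z\<in>S. (f z)\<^sup>2) \<le> inner f f"
proof -
  have "inner f f = (\<Sum>z\<in>{z. f z \<noteq> 0} \<union> S. f z * f z)"
    using assms by (intro inner_eq) (auto dest: free_module_finite)
  also have "\<dots> \<ge> (\<Sum>z\<in>S. f z * f z)"
    using assms by (intro sum_mono2) (auto dest: free_module_finite)
  finally show ?thesis by (simp add: power2_eq_square)
qed

lemma square_le_inner: "f \<in> V \<Longrightarrow> (f z)\<^sup>2 \<le> inner f f"
  using sum_squares_le_inner [of f "{z}"] by simp

lemma inner_eq_0: "f \<in> V \<Longrightarrow> inner f f = 0 \<Longrightarrow> f = 0"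
  using square_le_inner [of f] by (auto simp: fun_eq_iff)

lemma inner_shift:
  assumes "f \<in> V" "g \<in> carrier G" shows "inner (shift g f) (shift g f) = inner f f"
proof -
  have i: "inj_on (\<lambda>(k, y). (k, g \<otimes> y)) {z. f z \<noteq> 0}"
    by (rule inj_on_subset [OF inj_translate [OF assms(2)]])
      (use free_module_subset [OF assms(1)] in auto)
  show ?thesis
    unfolding inner_def supp_shift [OF assms] sum.reindex [OF i]
    using free_module_subset [OF assms(1)] assms(2)
    by (intro sum.cong) (auto simp: shift_def m_assoc [symmetric])
qed

text \<open>
  The column \<open>l\<close> of the matrix of \<open>\<theta>\<close>, with the group elements inverted. These are the rows of the
  conjugate transposed matrix, and so their linear extension is the adjoint of \<open>\<theta>\<close> for \<open>inner\<close>, see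
  \<open>inner_adjoint\<close> below.
\<close>

definition adjoint_col :: "(('i \<times> 'a \<Rightarrow> int) \<Rightarrow> 'i \<times> 'a \<Rightarrow> int) \<Rightarrow> 'i \<Rightarrow> 'i \<times> 'a \<Rightarrow> int" where
  "adjoint_col \<theta> l = (\<lambda>(k, y). if k \<in> I \<and> y \<in> carrier G then \<theta> (delta (k, \<one>)) (l, inv y) else 0)"

definition trace :: "(('i \<times> 'a \<Rightarrow> int) \<Rightarrow> 'i \<times> 'a \<Rightarrow> int) \<Rightarrow> int" where
  "trace \<theta> = (\<Sum>i\<in>I. \<theta> (delta (i, \<one>)) (i, \<one>))"

context
  assumes fin: "finite I"
begin

lemma adjoint_col_free_module:
  assumes "module_endo I \<theta>" shows "adjoint_col \<theta> l \<in> V"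
proof (rule free_moduleI)
  let ?S = "\<Union>k\<in>I. (\<lambda>(l, w). (k, inv w)) ` {z. \<theta> (delta (k, \<one>)) z \<noteq> 0}"
  have V: "k \<in> I \<Longrightarrow> \<theta> (delta (k, \<one>)) \<in> V" for k
    by (rule endo_closed [OF assms]) simp
  show "finite ?S" using fin V by (auto dest: free_module_finite)
  show "?S \<subseteq> I \<times> carrier G" using free_module_subset [OF V] by fastforce
  show "adjoint_col \<theta> l z = 0" if "z \<notin> ?S" for z
  proof (rule ccontr)
    assume "adjoint_col \<theta> l z \<noteq> 0"
    then obtain k y where *: "z = (k, y)" "k \<in> I" "y \<in> carrier G" "\<theta> (delta (k, \<one>)) (l, inv y) \<noteq> 0"
      by (cases z) (auto simp: adjoint_col_def split: if_splits)
    then have "z \<in> (\<lambda>(l, w). (k, inv w)) ` {z. \<theta> (delta (k, \<one>)) z \<noteq> 0}"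
      by (auto intro!: image_eqI [of _ _ "(l, inv y)"])
    then show False using that * by blast
  qed
qed

lemma endo_adjoint: "module_endo I \<theta> \<Longrightarrow> module_endo I (linear_extension (adjoint_col \<theta>))"
  by (intro endo_linear_extension adjoint_col_free_module)

lemma shift_adjoint_col:
  assumes "z \<in> I \<times> carrier G" "w \<in> I \<times> carrier G"
  shows "shift (snd w) (adjoint_col \<theta> (fst w)) z = shift (snd z) (\<theta> (delta (fst z, \<one>))) w"
  using assms by (auto simp: shift_def adjoint_col_def inv_mult_group)

lemma inner_adjoint:
  assumes "module_endo I \<theta>" "f \<in> V" "h \<in> V"
  shows "inner (\<theta> f) h = inner f (linear_extension (adjoint_col \<theta>) h)"
proof -
  let ?S = "{z. f z \<noteq> 0}" and ?T = "{z. h z \<noteq> 0}"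
  note S = free_module_finite [OF assms(2)] free_module_subset [OF assms(2)]
  note T = free_module_finite [OF assms(3)] free_module_subset [OF assms(3)]
  have "inner (\<theta> f) h = (\<Sum>w\<in>?T. \<theta> f w * h w)"
    using T endo_closed [OF assms(1,2)] by (intro inner_eq) (auto dest: free_module_finite)
  also have "\<dots> = (\<Sum>w\<in>?T. \<Sum>z\<in>?S. f z * shift (snd z) (\<theta> (delta (fst z, \<one>))) w * h w)"
    by (subst endo_expand' [OF assms(1,2)]) (simp add: sum_distrib_right)
  also have "\<dots> = (\<Sum>z\<in>?S. \<Sum>w\<in>?T. f z * shift (snd z) (\<theta> (delta (fst z, \<one>))) w * h w)"
    by (rule sum.swap)
  also have "\<dots> = (\<Sum>z\<in>?S. f z * linear_extension (adjoint_col \<theta>) h z)"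
    unfolding linear_extension_def sum_distrib_left
  proof (intro sum.cong refl)
    fix z w assume "z \<in> ?S" "w \<in> ?T"
    then have "z \<in> I \<times> carrier G" "w \<in> I \<times> carrier G" using S T by auto
    then show "f z * shift (snd z) (\<theta> (delta (fst z, \<one>))) w * h w
      = f z * (h w * shift (snd w) (adjoint_col \<theta> (fst w)) z)"
      by (simp add: shift_adjoint_col)
  qed
  also have "\<dots> = inner f (linear_extension (adjoint_col \<theta>) h)" by (simp add: inner_def)
  finally show ?thesis .
qed

text \<open>
  Expand \<open>\<theta> f\<close> and apply Cauchy-Schwarz in each coordinate. The matrix entries that lead into a
  fixed coordinate form a translate of a column, those that leave a fixed coordinate form a
  translate of a row, and translation preserves the norm.
\<close>

lemma endo_bounded:
  assumes "module_endo I \<theta>"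
  shows "\<exists>C. 2 \<le> C \<and> (\<forall>f\<in>V. inner (\<theta> f) (\<theta> f) \<le> C * inner f f)"
proof -
  define C1 where "C1 = (\<Sum>l\<in>I. inner (adjoint_col \<theta> l) (adjoint_col \<theta> l))"
  define C2 where "C2 = (\<Sum>k\<in>I. inner (\<theta> (delta (k, \<one>))) (\<theta> (delta (k, \<one>))))"
  have C: "0 \<le> C1" "0 \<le> C2" unfolding C1_def C2_def by (auto intro!: sum_nonneg inner_nonneg)
  have V: "k \<in> I \<Longrightarrow> \<theta> (delta (k, \<one>)) \<in> V" for k
    by (rule endo_closed [OF assms]) simp
  have "inner (\<theta> f) (\<theta> f) \<le> C1 * C2 * inner f f" if f: "f \<in> V" for f
  proof -
    let ?S = "{z. f z \<noteq> 0}" and ?T = "{z. \<theta> f z \<noteq> 0}"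
    define c where "c = (\<lambda>z w. shift (snd z) (\<theta> (delta (fst z, \<one>))) w)"
    note S = free_module_finite [OF f] free_module_subset [OF f]
    note T = free_module_finite [OF endo_closed [OF assms f]] free_module_subset [OF endo_closed [OF assms f]]
    have c1: "(\<Sum>z\<in>?S. (c z w)\<^sup>2) \<le> C1" if "w \<in> ?T" for w
    proof -
      have w: "fst w \<in> I" "snd w \<in> carrier G" "w \<in> I \<times> carrier G" using T that by auto
      have "(\<Sum>z\<in>?S. (c z w)\<^sup>2) = (\<Sum>z\<in>?S. (shift (snd w) (adjoint_col \<theta> (fst w)) z)\<^sup>2)"
        unfolding c_def using S w by (intro sum.cong refl) (subst shift_adjoint_col; auto)
      also have "\<dots> \<le> inner (shift (snd w) (adjoint_col \<theta> (fst w))) (shift (snd w) (adjoint_col \<theta> (fst w)))"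
        using w S by (intro sum_squares_le_inner free_module_shift adjoint_col_free_module assms) auto
      also have "\<dots> = inner (adjoint_col \<theta> (fst w)) (adjoint_col \<theta> (fst w))"
        using w by (intro inner_shift adjoint_col_free_module assms) auto
      also have "\<dots> \<le> C1"
        unfolding C1_def using w fin by (intro member_le_sum) (auto intro: inner_nonneg)
      finally show ?thesis .
    qed
    have c2: "(\<Sum>w\<in>?T. (c z w)\<^sup>2) \<le> C2" if "z \<in> ?S" for z
    proof -
      have z: "fst z \<in> I" "snd z \<in> carrier G" using S that by auto
      let ?t = "\<theta> (delta (fst z, \<one>))"
      have "(\<Sum>w\<in>?T. (c z w)\<^sup>2) \<le> inner (shift (snd z) ?t) (shift (snd z) ?t)"
        unfolding c_def using z T V by (intro sum_squares_le_inner free_module_shift) auto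
      also have "\<dots> = inner ?t ?t"
        using z V by (intro inner_shift) auto
      also have "\<dots> \<le> C2"
        unfolding C2_def using z fin
        by (intro member_le_sum [of "fst z" I "\<lambda>k. inner (\<theta> (delta (k, \<one>))) (\<theta> (delta (k, \<one>)))"])
           (auto intro: inner_nonneg)
      finally show ?thesis .
    qed
    have "inner (\<theta> f) (\<theta> f) = (\<Sum>w\<in>?T. (\<theta> f w)\<^sup>2)" by (simp add: inner_def power2_eq_square)
    also have "\<dots> = (\<Sum>w\<in>?T. (\<Sum>z\<in>?S. f z * c z w)\<^sup>2)"
      unfolding c_def
    proof (intro sum.cong refl)
      fix w
      show "(\<theta> f w)\<^sup>2 = (\<Sum>z | f z \<noteq> 0. f z * shift (snd z) (\<theta> (delta (fst z, \<one>))) w)\<^sup>2"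
        using fun_cong [OF endo_expand' [OF assms f], of w] by simp
    qed
    also have "\<dots> \<le> (\<Sum>w\<in>?T. (\<Sum>z\<in>?S. (f z)\<^sup>2 * (c z w)\<^sup>2) * C1)"
    proof (intro sum_mono)
      fix w assume "w \<in> ?T"
      then show "(\<Sum>z\<in>?S. f z * c z w)\<^sup>2 \<le> (\<Sum>z\<in>?S. (f z)\<^sup>2 * (c z w)\<^sup>2) * C1"
        by (intro order_trans [OF sum_mult_square_le] mult_left_mono c1 sum_nonneg) auto
    qed
    also have "\<dots> = (\<Sum>w\<in>?T. \<Sum>z\<in>?S. (f z)\<^sup>2 * (c z w)\<^sup>2) * C1"
      by (rule sum_distrib_right [symmetric])
    also have "(\<Sum>w\<in>?T. \<Sum>z\<in>?S. (f z)\<^sup>2 * (c z w)\<^sup>2) = (\<Sum>z\<in>?S. (f z)\<^sup>2 * (\<Sum>w\<in>?T. (c z w)\<^sup>2))"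
      by (subst sum.swap) (simp add: sum_distrib_left)
    also have "\<dots> * C1 \<le> (\<Sum>z\<in>?S. (f z)\<^sup>2 * C2) * C1"
      by (intro mult_right_mono sum_mono mult_left_mono c2 C) auto
    also have "\<dots> = C1 * C2 * inner f f"
      by (simp add: inner_def power2_eq_square sum_distrib_left sum_distrib_right mult_ac)
    finally show ?thesis .
  qed
  then have "inner (\<theta> f) (\<theta> f) \<le> (C1 * C2 + 2) * inner f f" if "f \<in> V" for f
    using that inner_nonneg [of f] by (fastforce simp: distrib_right)
  then show ?thesis using C by (intro exI [of _ "C1 * C2 + 2"]) auto
qed

text \<open>
  Both sides are sums of products of two matrix entries, at \<open>y\<close> and at its inverse. Inverting \<open>y\<close>
  exchanges them, once the sum runs over a finite set that is closed under inversion.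
\<close>

lemma trace_commute:
  assumes "module_endo I \<theta>" "module_endo I \<eta>"
  shows "trace (\<lambda>f. \<theta> (\<eta> f)) = trace (\<lambda>f. \<eta> (\<theta> f))"
proof -
  define Y0 where "Y0 = (\<Union>i\<in>I. snd ` {z. \<theta> (delta (i, \<one>)) z \<noteq> 0} \<union> snd ` {z. \<eta> (delta (i, \<one>)) z \<noteq> 0})"
  define Y where "Y = Y0 \<union> m_inv G ` Y0"
  have V: "k \<in> I \<Longrightarrow> \<theta> (delta (k, \<one>)) \<in> V" "k \<in> I \<Longrightarrow> \<eta> (delta (k, \<one>)) \<in> V" for k
    by (auto intro: endo_closed assms)
  have "finite Y0" unfolding Y0_def using fin V by (auto dest: free_module_finite)
  moreover have Y0: "Y0 \<subseteq> carrier G" unfolding Y0_def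
    using free_module_subset [OF V(1)] free_module_subset [OF V(2)] by fastforce
  ultimately have Y: "finite Y" "Y \<subseteq> carrier G" by (auto simp: Y_def)
  have invY: "m_inv G ` Y = Y"
    using Y0 by (force simp: Y_def image_Un image_image subset_iff)
  have tr: "trace (\<lambda>f. \<theta> (\<eta> f)) = (\<Sum>i\<in>I. \<Sum>k\<in>I. \<Sum>y\<in>Y. \<eta> (delta (i, \<one>)) (k, y) * \<theta> (delta (k, \<one>)) (i, inv y))"
    if endo: "module_endo I \<theta>" "module_endo I \<eta>"
      and sub: "\<And>i. i \<in> I \<Longrightarrow> snd ` {z. \<eta> (delta (i, \<one>)) z \<noteq> 0} \<subseteq> Y" for \<theta> \<eta>
  proof -
    have "\<theta> (\<eta> (delta (i, \<one>))) (i, \<one>) = (\<Sum>k\<in>I. \<Sum>y\<in>Y. \<eta> (delta (i, \<one>)) (k, y) * \<theta> (delta (k, \<one>)) (i, inv y))"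
      if i: "i \<in> I" for i
    proof -
      have "\<eta> (delta (i, \<one>)) \<in> V" using endo i by (auto intro: endo_closed)
      then have z: "\<eta> (delta (i, \<one>)) z = 0" if "z \<notin> I \<times> Y" for z
        using sub [OF i] that free_module_subset [of "\<eta> (delta (i, \<one>))" I] by (force simp: image_subset_iff)
      have "\<theta> (\<eta> (delta (i, \<one>))) = (\<lambda>w. \<Sum>z\<in>I \<times> Y. \<eta> (delta (i, \<one>)) z * shift (snd z) (\<theta> (delta (fst z, \<one>))) w)"
        using fin Y z by (intro endo_expand [OF endo(1)]) auto
      then have "\<theta> (\<eta> (delta (i, \<one>))) (i, \<one>) = (\<Sum>z\<in>I \<times> Y. \<eta> (delta (i, \<one>)) z * shift (snd z) (\<theta> (delta (fst z, \<one>))) (i, \<one>))"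
        by simp
      also have "\<dots> = (\<Sum>k\<in>I. \<Sum>y\<in>Y. \<eta> (delta (i, \<one>)) (k, y) * shift y (\<theta> (delta (k, \<one>))) (i, \<one>))"
        by (simp add: sum.cartesian_product split_beta)
      also have "\<dots> = (\<Sum>k\<in>I. \<Sum>y\<in>Y. \<eta> (delta (i, \<one>)) (k, y) * \<theta> (delta (k, \<one>)) (i, inv y))"
        using Y by (intro sum.cong refl) (auto simp: shift_def)
      finally show ?thesis .
    qed
    then show ?thesis by (simp add: trace_def)
  qed
  have "trace (\<lambda>f. \<theta> (\<eta> f)) = (\<Sum>i\<in>I. \<Sum>k\<in>I. \<Sum>y\<in>Y. \<eta> (delta (i, \<one>)) (k, y) * \<theta> (delta (k, \<one>)) (i, inv y))"
    by (rule tr) (auto simp: assms Y_def Y0_def)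
  also have "\<dots> = (\<Sum>i\<in>I. \<Sum>k\<in>I. \<Sum>y\<in>m_inv G ` Y. \<eta> (delta (i, \<one>)) (k, y) * \<theta> (delta (k, \<one>)) (i, inv y))"
    by (simp only: invY)
  also have "\<dots> = (\<Sum>i\<in>I. \<Sum>k\<in>I. \<Sum>y\<in>Y. \<eta> (delta (i, \<one>)) (k, inv y) * \<theta> (delta (k, \<one>)) (i, y))"
  proof (rule sum.cong [OF refl], rule sum.cong [OF refl])
    fix i k :: 'i
    have "inj_on (m_inv G) Y" using Y by (auto intro: inj_on_subset [OF inv_inj])
    then show "(\<Sum>y\<in>m_inv G ` Y. \<eta> (delta (i, \<one>)) (k, y) * \<theta> (delta (k, \<one>)) (i, inv y))
        = (\<Sum>y\<in>Y. \<eta> (delta (i, \<one>)) (k, inv y) * \<theta> (delta (k, \<one>)) (i, y))"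
      using Y by (subst sum.reindex) (auto intro!: sum.cong)
  qed
  also have "\<dots> = (\<Sum>k\<in>I. \<Sum>i\<in>I. \<Sum>y\<in>Y. \<theta> (delta (k, \<one>)) (i, y) * \<eta> (delta (i, \<one>)) (k, inv y))"
    by (subst sum.swap) (simp only: mult.commute)
  also have "\<dots> = trace (\<lambda>f. \<eta> (\<theta> f))"
    by (rule tr [symmetric]) (auto simp: assms Y_def Y0_def)
  finally show ?thesis .
qed

text \<open>
  Kaplansky's theorem. Let \<open>Q\<close> be the adjoint of \<open>P\<close>. In the von Neumann algebra of the group, the
  orthogonal projection onto the image of \<open>P\<close> has the same trace as \<open>P\<close>, and its trace is a sum of
  squares. That projection is the limit of the operators \<open>1 - (1 - PQ/C)\<^sup>k\<close> for \<open>C\<close> at least the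
  square of the norm of \<open>P\<close>. The proof works with these approximations directly. Scaled by \<open>C\<^sup>k\<close>
  they are the integral operators \<open>F k\<close>, where \<open>r = C - PQ\<close>. On the one hand their trace is at
  least \<open>C ^ (k - 1)\<close> times the sum \<open>a\<close> of the squared norms of the \<open>P (delta (i, \<one>))\<close>. On the
  other hand \<open>r\<close> multiplies squared norms on the image of \<open>P\<close> by at most \<open>C\<^sup>2 - C\<close>, and since the
  trace of \<open>P\<close> is zero, the trace of \<open>F k\<close> grows only like the square root of \<open>(C\<^sup>2 - C) ^ k\<close>. So \<open>a\<close>
  is zero.
\<close>

lemma idempotent_trace_zero:
  assumes P: "module_endo I P" and idem: "\<And>f. f \<in> V \<Longrightarrow> P (P f) = P f"
    and tr: "trace P = 0" and f: "f \<in> V"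
  shows "P f = 0"
proof -
  define Q where "Q = linear_extension (adjoint_col P)"
  have Q: "module_endo I Q" unfolding Q_def by (rule endo_adjoint [OF P])
  have adj: "inner (P f) h = inner f (Q h)" if "f \<in> V" "h \<in> V" for f h
    unfolding Q_def by (rule inner_adjoint [OF P that])
  obtain C where C: "2 \<le> C" and bd: "\<And>f. f \<in> V \<Longrightarrow> inner (P f) (P f) \<le> C * inner f f"
    using endo_bounded [OF P] by blast
  have PV [simp]: "P f \<in> V" if "f \<in> V" for f using endo_closed [OF P that] .
  have QV [simp]: "Q f \<in> V" if "f \<in> V" for f using endo_closed [OF Q that] .
  define r where "r = (\<lambda>f. (\<lambda>z. C * f z) - P (Q f))"
  have PQ: "module_endo I (\<lambda>f. P (Q f))" by (rule endo_comp [OF P Q])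
  have r: "module_endo I r"
    unfolding r_def by (intro endo_minus endo_scaleby endo_id PQ)
  have rV [simp]: "r f \<in> V" if "f \<in> V" for f using endo_closed [OF r that] .
  have rk: "module_endo I (r ^^ k)" for k
  proof (induction k)
    case 0 then show ?case by (simp add: endo_id id_def)
  next
    case (Suc k) then show ?case using endo_comp [OF r Suc] by (simp add: o_def)
  qed
  have rkV [simp]: "(r ^^ k) f \<in> V" if "f \<in> V" for k f using endo_closed [OF rk that] .
  have PQ_sym: "inner f (P (Q h)) = inner (Q f) (Q h)" if "f \<in> V" "h \<in> V" for f h
    using that by (simp add: inner_commute [of f] adj) (simp add: inner_commute)
  have r_sq: "inner (r y) (r y)
      = C * (C * inner y y) - 2 * (C * inner (Q y) (Q y)) + inner (P (Q y)) (P (Q y))"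
    if y: "y \<in> V" for y
  proof -
    have u: "P (Q y) \<in> V" "(\<lambda>z. C * y z) \<in> V" using y by auto
    have uy: "inner y (P (Q y)) = inner (Q y) (Q y)" "inner (P (Q y)) y = inner (Q y) (Q y)"
      using y u by (auto simp: PQ_sym inner_commute [of "P (Q y)"])
    have "inner (r y) (r y) = inner (\<lambda>z. C * y z) (\<lambda>z. C * y z) - inner (\<lambda>z. C * y z) (P (Q y))
       - (inner (P (Q y)) (\<lambda>z. C * y z) - inner (P (Q y)) (P (Q y)))"
      unfolding r_def using u by (simp only: inner_diff_left inner_diff_right free_module_diff)
    then show ?thesis
      using y u by (simp add: inner_scale_left inner_scale_right uy)
  qed
  have Qle: "inner (Q y) (Q y) \<le> C * inner y y" if y: "y \<in> V" for y
  proof -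
    have "0 \<le> inner (r y) (r y)" by (rule inner_nonneg)
    also have "\<dots> = C * (C * inner y y) - 2 * (C * inner (Q y) (Q y)) + inner (P (Q y)) (P (Q y))"
      by (rule r_sq [OF y])
    also have "\<dots> \<le> C * (C * inner y y) - C * inner (Q y) (Q y)"
      using bd [of "Q y"] y by simp
    finally have "C * inner (Q y) (Q y) \<le> C * (C * inner y y)" by simp
    then show ?thesis using C by (simp add: mult_le_cancel_left)
  qed
  have r_sym: "inner (r f) h = inner f (r h)" if "f \<in> V" "h \<in> V" for f h
    using that by (simp add: r_def inner_diff_left inner_diff_right inner_scale_left
          inner_scale_right PQ_sym adj)
  \<comment> \<open>\<open>r\<close> is symmetric and positive; symmetry moves factors of \<open>r ^^ j\<close> to the other side until at most one is left.\<close>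
  have r_pos: "0 \<le> inner ((r ^^ j) y) y" if "y \<in> V" for j y
    using that
  proof (induction j arbitrary: y rule: less_induct)
    case (less j)
    consider "j = 0" | "j = 1" | i where "j = Suc (Suc i)"
      by (metis One_nat_def not0_implies_Suc)
    then show ?case
    proof cases
      case 1 then show ?thesis by (simp add: inner_nonneg)
    next
      case 2
      have "inner (r y) y = C * inner y y - inner (Q y) (Q y)"
        using less.prems by (simp add: r_def inner_diff_left inner_scale_left adj)
      then show ?thesis using Qle [OF less.prems] 2 by simp
    next
      case 3
      have "inner ((r ^^ j) y) y = inner ((r ^^ i) (r y)) (r y)"
        unfolding 3 funpow.simps(2) [of "Suc i"] o_apply
        using less.prems rkV [of y "Suc i"] by (subst r_sym) (simp_all add: funpow_swap1)
      then show ?thesis using less 3 by simp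
    qed
  qed
  \<comment> \<open>On the image of \<open>P\<close> the adjoint does not decrease norms, hence \<open>PQ\<close> is bounded below there.\<close>
  have contract: "inner (r y) (r y) \<le> (C * C - C) * inner y y" if y: "y \<in> V" and Py: "P y = y" for y
  proof -
    have "0 \<le> inner (y - Q y) (y - Q y)" by (rule inner_nonneg)
    also have "\<dots> = inner (Q y) (Q y) - inner y y"
      using y adj [of y y] inner_commute [of y "Q y"] Py
      by (simp add: inner_diff_left inner_diff_right)
    finally have Qge: "inner y y \<le> inner (Q y) (Q y)" by simp
    have "inner (r y) (r y) = C * (C * inner y y) - 2 * (C * inner (Q y) (Q y)) + inner (P (Q y)) (P (Q y))"
      by (rule r_sq [OF y])
    also have "\<dots> \<le> C * (C * inner y y) - C * inner (Q y) (Q y)"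
      using bd [of "Q y"] y by simp
    also have "\<dots> \<le> C * (C * inner y y) - C * inner y y"
      using Qge C by simp
    finally show ?thesis by (simp add: algebra_simps)
  qed
  have Pr: "P (r y) = r y" if "y \<in> V" "P y = y" for y
    using that by (simp add: r_def endo_diff [OF P] endo_scale [OF P] idem)
  have contract_k: "P ((r ^^ k) y) = (r ^^ k) y \<and>
      inner ((r ^^ k) y) ((r ^^ k) y) \<le> (C * C - C) ^ k * inner y y"
    if "y \<in> V" "P y = y" for k y
  proof (induction k)
    case 0 then show ?case using that by simp
  next
    case (Suc k)
    have "inner ((r ^^ Suc k) y) ((r ^^ Suc k) y) \<le> (C * C - C) * inner ((r ^^ k) y) ((r ^^ k) y)"
      using contract [of "(r ^^ k) y"] Suc that by simp
    also have "\<dots> \<le> (C * C - C) * ((C * C - C) ^ k * inner y y)"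
      using Suc C by (intro mult_left_mono) auto
    finally show ?case using Suc Pr [of "(r ^^ k) y"] that by (simp add: mult.assoc)
  qed
  have trace_add: "trace (\<lambda>f. \<theta> f + \<eta> f) = trace \<theta> + trace \<eta>" for \<theta> \<eta>
    by (simp add: trace_def sum.distrib)
  have trace_scale: "trace (\<lambda>f z. c * \<theta> f z) = c * trace \<theta>" for c \<theta>
    by (simp add: trace_def sum_distrib_left)
  have trace_cong: "trace \<theta> = trace \<eta>" if "\<And>f. f \<in> V \<Longrightarrow> \<theta> f = \<eta> f" for \<theta> \<eta>
    using that by (simp add: trace_def)
  define F where "F = (\<lambda>k f. (\<lambda>z. C ^ k * f z) - (r ^^ k) f)"
  have F: "module_endo I (F k)" for k
    unfolding F_def by (intro endo_minus endo_scaleby endo_id rk)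
  define T where "T = (\<lambda>k f. Q ((r ^^ k) f))"
  have T: "module_endo I (T k)" for k
    unfolding T_def by (rule endo_comp [OF Q rk])
  have F_Suc: "F (Suc k) f = (\<lambda>z. C * F k f z) + P (T k f)" for k f
    by (simp add: F_def T_def r_def fun_eq_iff algebra_simps)
  have PF: "P (F k f) = F k f" if f: "f \<in> V" for k f
  proof (induction k)
    case 0
    have "F 0 f = 0" by (simp add: F_def fun_eq_iff)
    then show ?case by (simp only: endo_zero [OF P])
  next
    case (Suc k)
    have "F k f \<in> V" "T k f \<in> V" using endo_closed [OF F f] endo_closed [OF T f] by auto
    then have "P (F (Suc k) f) = P (\<lambda>z. C * F k f z) + P (P (T k f))"
      unfolding F_Suc by (intro endo_add [OF P]) auto
    also have "\<dots> = F (Suc k) f"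
      unfolding F_Suc using Suc \<open>F k f \<in> V\<close> \<open>T k f \<in> V\<close> by (simp only: endo_scale [OF P] idem)
    finally show ?case .
  qed
  define e where "e = (\<lambda>i. P (delta (i, \<one>)))"
  have eV: "e i \<in> V" "P (e i) = e i" if "i \<in> I" for i using that by (auto simp: e_def idem)
  define a where "a = (\<Sum>i\<in>I. inner (e i) (e i))"
  have trPT: "trace (\<lambda>f. P (T k f)) = (\<Sum>i\<in>I. inner ((r ^^ k) (e i)) (e i))" for k
  proof -
    have "trace (\<lambda>f. P (T k f)) = trace (\<lambda>f. T k (P f))" by (rule trace_commute [OF P T])
    also have "\<dots> = (\<Sum>i\<in>I. inner ((r ^^ k) (e i)) (e i))"
      unfolding trace_def
    proof (intro sum.cong refl)
      fix i assume i: "i \<in> I"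
      then have d: "delta (i, \<one>) \<in> V" by simp
      have "T k (P (delta (i, \<one>))) (i, \<one>) = inner (Q ((r ^^ k) (e i))) (delta (i, \<one>))"
        using eV [OF i] by (simp add: inner_delta T_def e_def)
      also have "\<dots> = inner (e i) ((r ^^ k) (e i))"
        using eV [OF i] d adj [OF d, of "(r ^^ k) (e i)"]
        by (simp add: inner_commute [of _ "delta (i, \<one>)"]) (simp add: e_def)
      finally show "T k (P (delta (i, \<one>))) (i, \<one>) = inner ((r ^^ k) (e i)) (e i)"
        using eV [OF i] by (simp add: inner_commute)
    qed
    finally show ?thesis .
  qed
  have trF: "C ^ k * a \<le> trace (F (Suc k))" for k
  proof (induction k)
    case 0
    have "trace (F (Suc 0)) = trace (\<lambda>f. P (T 0 f))"
      by (intro trace_cong) (simp add: F_Suc, simp add: F_def fun_eq_iff)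
    then show ?case by (simp add: trPT a_def)
  next
    case (Suc k)
    have "trace (F (Suc (Suc k))) = C * trace (F (Suc k)) + trace (\<lambda>f. P (T (Suc k) f))"
      by (subst trace_scale [symmetric], subst trace_add [symmetric]) (rule arg_cong [of _ _ trace], rule ext, rule F_Suc)
    also have "\<dots> \<ge> C * trace (F (Suc k))"
      unfolding trPT using eV by (auto intro!: sum_nonneg r_pos simp del: funpow.simps)
    finally have "C * trace (F (Suc k)) \<le> trace (F (Suc (Suc k)))" .
    moreover have "C * (C ^ k * a) \<le> C * trace (F (Suc k))"
      by (rule mult_left_mono [OF Suc]) (use C in simp)
    ultimately show ?case by (simp only: power_Suc mult.assoc)
  qed
  have trF_bound: "(trace (F k))\<^sup>2 \<le> int (card I) * ((C * C - C) ^ k * a)" for k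
  proof -
    have "trace (F k) = trace (\<lambda>f. P (F k f))" by (rule trace_cong) (simp add: PF)
    also have "\<dots> = trace (\<lambda>f. F k (P f))" by (rule trace_commute [OF P F])
    also have "\<dots> = C ^ k * trace P - (\<Sum>i\<in>I. (r ^^ k) (e i) (i, \<one>))"
      by (simp add: trace_def F_def e_def sum_subtractf sum_distrib_left)
    finally have "(trace (F k))\<^sup>2 = (\<Sum>i\<in>I. 1 * (r ^^ k) (e i) (i, \<one>))\<^sup>2"
      using tr by simp
    also have "\<dots> \<le> (\<Sum>i\<in>I. 1\<^sup>2) * (\<Sum>i\<in>I. ((r ^^ k) (e i) (i, \<one>))\<^sup>2)"
      by (rule Cauchy_Schwarz_int)
    also have "\<dots> \<le> int (card I) * (\<Sum>i\<in>I. (C * C - C) ^ k * inner (e i) (e i))"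
    proof -
      have "((r ^^ k) (e i) (i, \<one>))\<^sup>2 \<le> (C * C - C) ^ k * inner (e i) (e i)" if "i \<in> I" for i
        using square_le_inner [of "(r ^^ k) (e i)" "(i, \<one>)"] contract_k [of "e i" k] eV [OF that] by simp
      then show ?thesis by (auto intro!: mult_left_mono sum_mono)
    qed
    finally show ?thesis by (simp add: a_def sum_distrib_left)
  qed
  have "a = 0"
  proof (rule ccontr)
    assume "a \<noteq> 0"
    moreover have "0 \<le> a" unfolding a_def by (auto intro: sum_nonneg inner_nonneg)
    ultimately have a: "0 < a" by simp
    have key: "(C ^ k)\<^sup>2 * a \<le> int (card I) * (C * C - C) ^ Suc k" for k
    proof -
      have "(C ^ k * a)\<^sup>2 \<le> (trace (F (Suc k)))\<^sup>2"
        using trF [of k] a C by (intro power_mono) auto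
      also note trF_bound [of "Suc k"]
      finally have "((C ^ k)\<^sup>2 * a) * a \<le> (int (card I) * (C * C - C) ^ Suc k) * a"
        by (simp add: power_mult_distrib power2_eq_square mult_ac)
      then show ?thesis using a by (simp add: mult_le_cancel_right)
    qed
    define b where "b = real_of_int (C * C - C)"
    have C2: "C * 2 \<le> C * C" using C by (intro mult_left_mono) auto
    have b: "0 < b" "b < real_of_int (C * C)" unfolding b_def using C C2 by auto
    then have "1 < real_of_int (C * C) / b" by simp
    then obtain k where "real (card I) * b / real_of_int a < (real_of_int (C * C) / b) ^ k"
      using real_arch_pow by blast
    then have "real (card I) * b ^ Suc k < real_of_int (C * C) ^ k * real_of_int a"
      using a b by (simp add: field_simps power_divide)
    moreover have "real_of_int ((C ^ k)\<^sup>2 * a) \<le> real_of_int (int (card I) * (C * C - C) ^ Suc k)"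
      using key by (simp only: of_int_le_iff)
    then have "real_of_int (C * C) ^ k * real_of_int a \<le> real (card I) * b ^ Suc k"
      by (simp add: b_def power2_eq_square power_mult_distrib)
    ultimately show False by simp
  qed
  then have "inner (e i) (e i) = 0" if "i \<in> I" for i
    using that fin unfolding a_def by (subst (asm) sum_nonneg_eq_0_iff) (auto intro: inner_nonneg)
  then have "P (delta (i, \<one>)) = 0" if "i \<in> I" for i
    using that inner_eq_0 [of "e i"] eV by (auto simp: e_def)
  then show ?thesis
    using free_module_subset [OF f]
    by (subst endo_expand' [OF P f]) (auto simp: fun_eq_iff shift_def intro!: sum.neutral)
qed

text \<open>
  Lifting the generators gives a right inverse \<open>\<rho>\<close>, and \<open>1 - \<rho>\<theta>\<close> is an idempotent whose trace is
  the rank minus the trace of \<open>\<theta>\<rho> = 1\<close>.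
\<close>

theorem integral_endo_surj_imp_inj:
  assumes \<theta>: "module_endo I \<theta>" and surj: "\<And>h. h \<in> V \<Longrightarrow> \<exists>f\<in>V. \<theta> f = h"
    and f: "f \<in> V" "\<theta> f = 0"
  shows "f = 0"
proof -
  have "\<forall>k\<in>I. \<exists>f\<in>V. \<theta> f = delta (k, \<one>)" using surj by simp
  then obtain M where M: "\<And>k. k \<in> I \<Longrightarrow> M k \<in> V" "\<And>k. k \<in> I \<Longrightarrow> \<theta> (M k) = delta (k, \<one>)"
    by metis
  define \<rho> where "\<rho> = linear_extension M"
  have \<rho>: "module_endo I \<rho>" unfolding \<rho>_def by (rule endo_linear_extension [OF M(1)])
  have sec: "\<theta> (\<rho> h) = h" if "h \<in> V" for h
  proof (rule endo_ext [OF endo_comp [OF \<theta> \<rho>] endo_id _ that])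
    fix k assume "k \<in> I"
    then show "\<theta> (\<rho> (delta (k, \<one>))) = delta (k, \<one>)"
      unfolding \<rho>_def by (subst linear_extension_delta) (use M in auto)
  qed
  define P where "P = (\<lambda>f. f - \<rho> (\<theta> f))"
  have P: "module_endo I P" unfolding P_def by (intro endo_minus endo_id endo_comp [OF \<rho> \<theta>])
  have "trace (\<lambda>f. \<rho> (\<theta> f)) = trace (\<lambda>f. \<theta> (\<rho> f))" by (rule trace_commute [OF \<rho> \<theta>])
  also have "\<dots> = trace (\<lambda>f. f)" by (simp add: trace_def sec)
  finally have tr: "trace P = 0" by (simp add: P_def trace_def sum_subtractf)
  have "P (P f) = P f" if f: "f \<in> V" for f
  proof -
    have "\<theta> (P f) = 0"
      using f endo_closed [OF \<theta>] endo_closed [OF \<rho>] by (simp add: P_def endo_diff [OF \<theta>] sec)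
    then have "P (P f) = P f - \<rho> 0" by (simp only: P_def)
    then show ?thesis using endo_zero [OF \<rho>] by simp
  qed
  from idempotent_trace_zero [OF P this tr f(1)] have "P f = 0" .
  then show ?thesis using f(2) endo_zero [OF \<rho>] by (simp add: P_def)
qed

end
end
end

section \<open>Endomorphisms modulo a prime\<close>

definition cong_mod :: "int \<Rightarrow> ('z \<Rightarrow> int) \<Rightarrow> ('z \<Rightarrow> int) \<Rightarrow> bool" where
  "cong_mod p f h \<longleftrightarrow> (\<forall>z. p dvd f z - h z)"

lemma cong_mod_refl [simp]: "cong_mod p f f"
  by (simp add: cong_mod_def)

lemma cong_mod_sym: "cong_mod p f h \<Longrightarrow> cong_mod p h f"
  by (simp add: cong_mod_def dvd_diff_commute)

lemma cong_mod_trans [trans]: "cong_mod p f h \<Longrightarrow> cong_mod p h u \<Longrightarrow> cong_mod p f u"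
  unfolding cong_mod_def
proof
  fix z assume "\<forall>z. p dvd f z - h z" "\<forall>z. p dvd h z - u z"
  then have "p dvd (f z - h z) + (h z - u z)" by (intro dvd_add) auto
  then show "p dvd f z - u z" by simp
qed

lemma cong_mod_add: "cong_mod p f f' \<Longrightarrow> cong_mod p h h' \<Longrightarrow> cong_mod p (f + h) (f' + h')"
  unfolding cong_mod_def
proof
  fix z assume "\<forall>z. p dvd f z - f' z" "\<forall>z. p dvd h z - h' z"
  then have "p dvd (f z - f' z) + (h z - h' z)" by (intro dvd_add) auto
  then show "p dvd (f + h) z - (f' + h') z" by (simp add: algebra_simps)
qed

lemma cong_mod_zero: "cong_mod p f 0 \<longleftrightarrow> (\<forall>z. p dvd f z)"
  by (simp add: cong_mod_def)

lemma cong_mod_restr: "cong_mod p f h \<Longrightarrow> cong_mod p (restr J f) (restr J h)"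
  by (simp add: cong_mod_def restr_def)

lemma restr_zero [simp]: "restr J 0 = 0"
  by (simp add: restr_def fun_eq_iff)

context group
begin

text \<open>
  Direct finiteness of the matrix ring over the group ring modulo \<open>p\<close>, with the index set of the
  matrices as parameter and with matrices replaced by integral endomorphisms up to congruence.
\<close>

definition directly_finite_mod :: "int \<Rightarrow> 'i set \<Rightarrow> bool" where
  "directly_finite_mod p I \<longleftrightarrow> (\<forall>\<theta> \<rho>. module_endo I \<theta> \<longrightarrow> module_endo I \<rho> \<longrightarrow>
     (\<forall>f\<in>free_module I. cong_mod p (\<theta> (\<rho> f)) f) \<longrightarrow>
     (\<forall>f\<in>free_module I. cong_mod p (\<rho> (\<theta> f)) f))"

text \<open>
  The relations saying that the generator \<open>k\<close> has order \<open>n k\<close>, where order \<open>0\<close> means infinite order.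
\<close>

definition relations :: "'i set \<Rightarrow> ('i \<Rightarrow> nat) \<Rightarrow> ('i \<times> 'a \<Rightarrow> int) set" where
  "relations I n = {f \<in> free_module I. \<forall>z. int (n (fst z)) dvd f z}"

text \<open>
  The Hopf property of the quotient module by these relations, expressed through the lifts of its
  endomorphisms to the free module.
\<close>

definition hopfian_mod :: "'i set \<Rightarrow> ('i \<Rightarrow> nat) \<Rightarrow> bool" where
  "hopfian_mod I n \<longleftrightarrow> (\<forall>\<theta>. module_endo I \<theta> \<longrightarrow>
     (\<forall>f\<in>relations I n. \<theta> f \<in> relations I n) \<longrightarrow>
     (\<forall>h\<in>free_module I. \<exists>f\<in>free_module I. h - \<theta> f \<in> relations I n) \<longrightarrow>
     (\<forall>f\<in>free_module I. \<theta> f \<in> relations I n \<longrightarrow> f \<in> relations I n))"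

lemma free_module_div:
  assumes "f \<in> free_module I" shows "(\<lambda>z. f z div c) \<in> free_module I"
  by (rule free_moduleI [of "{z. f z \<noteq> 0}"])
    (use free_module_subset [OF assms] free_module_finite [OF assms] in auto)

lemma endo_dvd:
  assumes \<theta>: "module_endo I \<theta>" and f: "f \<in> free_module I" and d: "\<And>z. c dvd f z"
  shows "c dvd \<theta> f z"
proof -
  have "f = (\<lambda>z. c * (f z div c))" using d by (auto simp: fun_eq_iff)
  then have "\<theta> f = \<theta> (\<lambda>z. c * (f z div c))" by (rule arg_cong)
  also have "\<dots> = (\<lambda>z. c * \<theta> (\<lambda>z. f z div c) z)"
    by (rule endo_scale [OF \<theta> free_module_div [OF f]])
  finally show ?thesis by simp
qed

lemma endo_cong_mod:
  assumes "module_endo I \<theta>" "f \<in> free_module I" "h \<in> free_module I" "cong_mod p f h"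
  shows "cong_mod p (\<theta> f) (\<theta> h)"
proof -
  have "p dvd \<theta> (f - h) z" for z
    by (rule endo_dvd [OF assms(1)]) (use assms in \<open>auto simp: cong_mod_def simp del: minus_apply\<close>, simp add: cong_mod_def)
  then show ?thesis using endo_diff [OF assms(1-3)] by (simp add: cong_mod_def)
qed

lemma endo_ext_cong:
  assumes "module_endo I \<theta>" "module_endo I \<eta>"
    and *: "\<And>k. k \<in> I \<Longrightarrow> cong_mod p (\<theta> (delta (k, \<one>))) (\<eta> (delta (k, \<one>)))" and f: "f \<in> free_module I"
  shows "cong_mod p (\<theta> f) (\<eta> f)"
  unfolding cong_mod_def
proof
  fix w
  have "\<theta> f w - \<eta> f w = (\<Sum>z | f z \<noteq> 0. f z * (shift (snd z) (\<theta> (delta (fst z, \<one>))) w - shift (snd z) (\<eta> (delta (fst z, \<one>))) w))"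
    using fun_cong [OF endo_expand' [OF assms(1) f], of w] fun_cong [OF endo_expand' [OF assms(2) f], of w]
    by (simp add: sum_subtractf right_diff_distrib)
  also have "p dvd \<dots>"
  proof (intro dvd_sum dvd_mult)
    fix z assume "z \<in> {z. f z \<noteq> 0}"
    then have "fst z \<in> I" using free_module_subset [OF f] by auto
    then show "p dvd shift (snd z) (\<theta> (delta (fst z, \<one>))) w - shift (snd z) (\<eta> (delta (fst z, \<one>))) w"
      using * by (auto simp: shift_def cong_mod_def split: prod.splits)
  qed
  finally show "p dvd \<theta> f w - \<eta> f w" .
qed

lemma directly_finite_mod_surj_imp_inj:
  assumes df: "directly_finite_mod p I" and \<theta>: "module_endo I \<theta>"
    and surj: "\<And>h. h \<in> free_module I \<Longrightarrow> \<exists>f\<in>free_module I. cong_mod p (\<theta> f) h"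
    and f: "f \<in> free_module I" "cong_mod p (\<theta> f) 0"
  shows "cong_mod p f 0"
proof -
  have "\<forall>k\<in>I. \<exists>f\<in>free_module I. cong_mod p (\<theta> f) (delta (k, \<one>))" using surj by simp
  then obtain M where M: "\<And>k. k \<in> I \<Longrightarrow> M k \<in> free_module I"
      "\<And>k. k \<in> I \<Longrightarrow> cong_mod p (\<theta> (M k)) (delta (k, \<one>))"
    by metis
  define \<rho> where "\<rho> = linear_extension M"
  have \<rho>: "module_endo I \<rho>" unfolding \<rho>_def by (rule endo_linear_extension [OF M(1)])
  have sec: "cong_mod p (\<theta> (\<rho> h)) h" if "h \<in> free_module I" for h
  proof (rule endo_ext_cong [OF endo_comp [OF \<theta> \<rho>] endo_id _ that])
    fix k assume "k \<in> I"
    then show "cong_mod p (\<theta> (\<rho> (delta (k, \<one>)))) (delta (k, \<one>))"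
      unfolding \<rho>_def by (subst linear_extension_delta) (use M in auto)
  qed
  have "cong_mod p (\<rho> (\<theta> f)) f"
    using df \<theta> \<rho> sec f(1) unfolding directly_finite_mod_def by blast
  moreover have "cong_mod p (\<rho> (\<theta> f)) (\<rho> 0)"
    by (rule endo_cong_mod [OF \<rho> endo_closed [OF \<theta> f(1)] free_module_zero f(2)])
  ultimately show ?thesis
    using cong_mod_trans [OF cong_mod_sym] by (simp only: endo_zero [OF \<rho>]) blast
qed

text \<open>
  A smaller matrix is made into a larger one by adding an identity block. This gives both the
  passage to smaller sizes and the independence of the index set.
\<close>

lemma directly_finite_mod_reindex:
  fixes e :: "'i \<Rightarrow> 'j"
  assumes df: "directly_finite_mod p J" and e: "inj_on e I" "e ` I \<subseteq> J"
  shows "directly_finite_mod p I"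
  unfolding directly_finite_mod_def
proof (intro allI impI ballI)
  fix \<theta> \<rho> :: "('i \<times> 'a \<Rightarrow> int) \<Rightarrow> 'i \<times> 'a \<Rightarrow> int" and f0 :: "'i \<times> 'a \<Rightarrow> int"
  assume \<theta>: "module_endo I \<theta>" and \<rho>: "module_endo I \<rho>"
    and sec: "\<forall>f\<in>free_module I. cong_mod p (\<theta> (\<rho> f)) f" and f0: "f0 \<in> free_module I"
  define pull where "pull = (\<lambda>(f::'j \<times> 'a \<Rightarrow> int) (i, x). if i \<in> I then f (e i, x) else 0)"
  define push where "push = (\<lambda>(f::'i \<times> 'a \<Rightarrow> int) (j, x). if j \<in> e ` I then f (inv_into I e j, x) else 0)"
  have pull_V: "pull f \<in> free_module I" if f: "f \<in> free_module J" for f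
  proof (rule free_moduleI)
    let ?S = "(\<lambda>(j, x). (inv_into I e j, x)) ` ({z. f z \<noteq> 0} \<inter> e ` I \<times> carrier G)"
    show "finite ?S" using free_module_finite [OF f] by simp
    show "?S \<subseteq> I \<times> carrier G" by (auto intro: inv_into_into)
    show "pull f z = 0" if "z \<notin> ?S" for z
    proof (rule ccontr)
      assume "pull f z \<noteq> 0"
      then obtain i x where z: "z = (i, x)" "i \<in> I" "f (e i, x) \<noteq> 0"
        by (cases z) (auto simp: pull_def split: if_splits)
      then have "x \<in> carrier G" using free_module_subset [OF f] by auto
      then have "z \<in> ?S" using z e by (auto intro!: image_eqI [of _ _ "(e i, x)"])
      then show False using that by blast
    qed
  qed
  have push_V: "push f \<in> free_module J" if f: "f \<in> free_module I" for f
  proof (rule free_moduleI)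
    let ?S = "(\<lambda>(i, x). (e i, x)) ` {z. f z \<noteq> 0}"
    show "finite ?S" using free_module_finite [OF f] by simp
    show "?S \<subseteq> J \<times> carrier G" using free_module_subset [OF f] e by auto
    show "push f z = 0" if "z \<notin> ?S" for z
      using that e by (cases z) (force simp: push_def image_iff)
  qed
  have pull_push: "pull (push f) = f" if "f \<in> free_module I" for f
    using free_module_outside [OF that] e by (auto simp: pull_def push_def fun_eq_iff)
  have pull_add: "pull (f + h) = pull f + pull h" for f h by (auto simp: pull_def)
  have push_add: "push (f + h) = push f + push h" for f h by (auto simp: push_def)
  have pull_shift: "pull (shift g f) = shift g (pull f)" for g f by (auto simp: pull_def shift_def)
  have push_shift: "push (shift g f) = shift g (push f)" for g f by (auto simp: push_def shift_def)
  have push_cong: "cong_mod p (push f) (push h)" if "cong_mod p f h" for f h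
    using that by (auto simp: push_def cong_mod_def)
  have pull_cong: "cong_mod p (pull f) (pull h)" if "cong_mod p f h" for f h
    using that by (auto simp: pull_def cong_mod_def)
  have pull_rest: "pull (restr (- e ` I) f) = 0" for f by (auto simp: pull_def restr_def)
  have rest_push: "restr (- e ` I) (push f) = 0" for f by (auto simp: push_def restr_def)
  have split: "push (pull f) + restr (- e ` I) f = f" if "f \<in> free_module J" for f
    using e by (auto simp: push_def pull_def restr_def fun_eq_iff)
  define ext where "ext = (\<lambda>\<theta> f. push (\<theta> (pull f)) + restr (- e ` I) f)"
  have ext: "module_endo J (ext \<theta>)" if \<theta>: "module_endo I \<theta>" for \<theta>
    unfolding module_endo_def ext_def
    using \<theta> by (intro conjI ballI)
      (simp_all only: free_module_add free_module_restr' push_V pull_V endo_closed endo_add pull_add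
        push_add restr_add endo_shift pull_shift push_shift shift_add shift_restr add_ac)
  have ext_comp: "ext \<theta> (ext \<rho> f) = push (\<theta> (\<rho> (pull f))) + restr (- e ` I) f"
    if "module_endo I \<theta>" "module_endo I \<rho>" "f \<in> free_module J" for \<theta> \<rho> f
    using that unfolding ext_def
    by (simp only: pull_add pull_push pull_rest restr_add rest_push restr_idem endo_closed pull_V
        add_0_right add_0_left)
  have "cong_mod p (ext \<theta> (ext \<rho> f)) f" if f: "f \<in> free_module J" for f
  proof -
    have "cong_mod p (push (\<theta> (\<rho> (pull f))) + restr (- e ` I) f) (push (pull f) + restr (- e ` I) f)"
      using sec pull_V [OF f] by (intro cong_mod_add push_cong) auto
    then show ?thesis by (simp only: ext_comp [OF \<theta> \<rho> f] split [OF f])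
  qed
  then have "cong_mod p (ext \<rho> (ext \<theta> (push f0))) (push f0)"
    using df ext [OF \<theta>] ext [OF \<rho>] push_V [OF f0] unfolding directly_finite_mod_def by blast
  then have "cong_mod p (pull (push (\<rho> (\<theta> f0)))) (pull (push f0))"
    by (intro pull_cong) (simp only: ext_comp [OF \<rho> \<theta> push_V [OF f0]] pull_push f0 rest_push add_0_right)
  then show "cong_mod p (\<rho> (\<theta> f0)) f0"
    by (simp only: pull_push f0 endo_closed [OF \<rho>] endo_closed [OF \<theta>])
qed

lemma relationsD: "f \<in> relations I n \<Longrightarrow> f \<in> free_module I" "f \<in> relations I n \<Longrightarrow> int (n (fst z)) dvd f z"
  by (simp_all add: relations_def del: split_paired_All)

lemma relations_zero [simp]: "0 \<in> relations I n"
  by (simp add: relations_def)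

lemma relations_diff: "f \<in> relations I n \<Longrightarrow> h \<in> relations I n \<Longrightarrow> f - h \<in> relations I n"
  by (simp add: relations_def dvd_diff)

lemma relations_add: "f \<in> relations I n \<Longrightarrow> h \<in> relations I n \<Longrightarrow> f + h \<in> relations I n"
  by (simp add: relations_def dvd_add)

lemma relations_scale: "f \<in> relations I n \<Longrightarrow> (\<lambda>z. c * f z) \<in> relations I n"
  by (simp add: relations_def)

section \<open>Primary parts\<close>

text \<open>
  Write \<open>J i\<close> for the coordinates of order \<open>p ^ i\<close>. An endomorphism that respects the relations
  maps elements killed by \<open>p ^ i\<close> to such elements, hence modulo \<open>p\<close> it does not lead from
  coordinates of order at most \<open>p ^ i\<close> to coordinates of larger order. Let \<open>Gi i\<close> be the elements that
  vanish modulo \<open>p\<close> in the coordinates of order larger than \<open>p ^ i\<close>. On \<open>Gi i\<close> the coordinates in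
  \<open>J i\<close> are transformed, modulo \<open>p\<close>, by the diagonal block alone.

  If the blocks above \<open>i\<close> are injective modulo \<open>p\<close>, then every preimage of an element supported on
  \<open>J i\<close> lies in \<open>Gi i\<close>, and so the block for \<open>i\<close> is surjective; direct finiteness makes it injective.
  If finally \<open>\<theta> f\<close> is a relation and \<open>f\<close> is not, multiply \<open>f\<close> by a power of \<open>p\<close> until it is killed by
  \<open>p\<close> in the quotient, and take the smallest order \<open>p ^ i\<close> of a coordinate that violates its relation.
  Up to relations, \<open>f\<close> is then \<open>p ^ (i - 1)\<close> times an element of \<open>Gi i\<close> that contradicts
  the injectivity of the block for \<open>i\<close>.
\<close>

theorem hopfian_mod_prime_power:
  fixes e :: "'i \<Rightarrow> nat"
  assumes p: "prime p" and fin: "finite J" and e: "\<And>k. k \<in> J \<Longrightarrow> 1 \<le> e k"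
    and df: "\<And>i. 1 \<le> i \<Longrightarrow> directly_finite_mod (int p) {k \<in> J. e k = i}"
  shows "hopfian_mod J (\<lambda>k. p ^ e k)"
  unfolding hopfian_mod_def
proof (intro allI impI ballI)
  fix \<theta> :: "('i \<times> 'a \<Rightarrow> int) \<Rightarrow> 'i \<times> 'a \<Rightarrow> int" and f0
  let ?V = "free_module J" and ?K = "relations J (\<lambda>k. p ^ e k)"
  let ?J = "\<lambda>i. {k \<in> J. e k = i}"
  assume \<theta>: "module_endo J \<theta>" and \<theta>K: "\<forall>f\<in>?K. \<theta> f \<in> ?K"
    and surj: "\<forall>h\<in>?V. \<exists>f\<in>?V. h - \<theta> f \<in> ?K"
    and f0: "f0 \<in> ?V" "\<theta> f0 \<in> ?K"
  note [simp del] = split_paired_All split_paired_Ex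
  have p0: "int p \<noteq> 0" using p by auto
  have K_iff: "f \<in> ?K \<longleftrightarrow> f \<in> ?V \<and> (\<forall>z. int p ^ e (fst z) dvd f z)" for f
    by (simp add: relations_def)
  have upper: "int p dvd \<theta> f z"
    if f: "f \<in> ?V" "\<And>z. i < e (fst z) \<Longrightarrow> f z = 0" and z: "i < e (fst z)" for f i z
  proof -
    have "int p ^ e (fst w) dvd int p ^ i * f w" for w
      using f(2) [of w] by (cases "i < e (fst w)") (simp_all add: dvd_mult2 le_imp_power_dvd)
    then have "(\<lambda>z. int p ^ i * f z) \<in> ?K" using f by (simp add: K_iff)
    then have "(\<lambda>z. int p ^ i * \<theta> f z) \<in> ?K"
      using \<theta>K endo_scale [OF \<theta> f(1)] by metis
    then have "int p ^ e (fst z) dvd int p ^ i * \<theta> f z" by (simp add: K_iff)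
    moreover have "int p ^ Suc i dvd int p ^ e (fst z)" using z by (intro le_imp_power_dvd) simp
    ultimately have "int p ^ i * int p dvd int p ^ i * \<theta> f z"
      by (metis dvd_trans mult.commute power_Suc)
    then show ?thesis using p0 by simp
  qed
  define Gi where "Gi = (\<lambda>i. {f \<in> ?V. \<forall>z. i < e (fst z) \<longrightarrow> int p dvd f z})"
  have GiD: "f \<in> ?V" if "f \<in> Gi i" for f i using that by (simp add: Gi_def)
  have diag: "cong_mod (int p) (restr (?J i) (\<theta> f)) (restr (?J i) (\<theta> (restr (?J i) f)))"
    if f: "f \<in> Gi i" for f i
    unfolding cong_mod_def
  proof
    fix z
    define f1 where "f1 = (\<lambda>z. if e (fst z) < i then f z else 0)"
    define f2 where "f2 = (\<lambda>z. if i < e (fst z) then f z else 0)"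
    have V: "f1 \<in> ?V" "f2 \<in> ?V" "restr (?J i) f \<in> ?V"
      using free_module_restr' [OF GiD [OF f], of "{k. e k < i}"]
        free_module_restr' [OF GiD [OF f], of "{k. i < e k}"] free_module_restr' [OF GiD [OF f], of "?J i"]
      by (auto simp: f1_def f2_def restr_def)
    have "f = restr (?J i) f + (f1 + f2)"
      using free_module_outside [OF GiD [OF f]] by (auto simp: f1_def f2_def restr_def fun_eq_iff)
    then have "\<theta> f = \<theta> (restr (?J i) f + (f1 + f2))" by (rule arg_cong)
    also have "\<dots> = \<theta> (restr (?J i) f) + (\<theta> f1 + \<theta> f2)"
      using V by (simp only: endo_add [OF \<theta>] free_module_add)
    finally have eq: "\<theta> f = \<theta> (restr (?J i) f) + (\<theta> f1 + \<theta> f2)" .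
    have d2: "int p dvd \<theta> f2 z"
      by (rule endo_dvd [OF \<theta> V(2)]) (use f in \<open>auto simp: f2_def Gi_def\<close>)
    have d1: "int p dvd \<theta> f1 z" if "fst z \<in> ?J i"
      by (rule upper [OF V(1), of "i - 1"]) (use that e in \<open>force simp: f1_def\<close>)+
    show "int p dvd restr (?J i) (\<theta> f) z - restr (?J i) (\<theta> (restr (?J i) f)) z"
      using d1 d2 eq by (simp add: restr_def)
  qed
  obtain N where N: "\<And>k. k \<in> J \<Longrightarrow> e k \<le> N"
    using fin by (meson finite_imageI finite_nat_set_iff_bounded_le imageI)
  have endo_i: "module_endo (?J i) (\<lambda>f. restr (?J i) (\<theta> f))" for i
    by (rule endo_restr [OF \<theta>]) auto
  have inj: "cong_mod (int p) f 0"
    if "f \<in> free_module (?J i)" "cong_mod (int p) (restr (?J i) (\<theta> f)) 0" for i f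
    using that
  proof (induction "N - i" arbitrary: i f rule: less_induct)
    case less
    show ?case
    proof (cases "i = 0")
      case True
      then have "?J i = {}" using e by force
      then have "f = 0" using less.prems(1) by (auto simp: free_module_def fun_eq_iff)
      then show ?thesis by simp
    next
      case False
      show ?thesis
      proof (rule directly_finite_mod_surj_imp_inj [OF df endo_i _ less.prems])
        show "1 \<le> i" using False by simp
        fix h assume h: "h \<in> free_module (?J i)"
        then have "h \<in> ?V" by (rule free_module_mono [rotated]) auto
        then obtain f where f: "f \<in> ?V" "h - \<theta> f \<in> ?K" using surj by blast
        have hf: "cong_mod (int p) (\<theta> f) h"
          unfolding cong_mod_def
        proof
          fix z
          show "int p dvd \<theta> f z - h z"
          proof (cases "fst z \<in> J")
            case True
            then have "int p dvd int p ^ e (fst z)" using e [of "fst z"] by (intro dvd_power) auto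
            then have "int p dvd (h - \<theta> f) z" using f(2) dvd_trans unfolding K_iff by blast
            then show ?thesis by (simp add: dvd_diff_commute)
          next
            case False
            then show ?thesis
              using free_module_outside [OF endo_closed [OF \<theta> f(1)], of z] free_module_outside [OF h, of z]
              by (auto simp: mem_Times_iff)
          qed
        qed
        have "f \<in> Gi (max N i)"
          unfolding Gi_def
        proof (intro CollectI conjI allI impI f(1))
          fix z :: "'i \<times> 'a" assume "max N i < e (fst z)"
          then have "fst z \<notin> J" using N [of "fst z"] by auto
          then show "int p dvd f z" using free_module_outside [OF f(1), of z] by (auto simp: mem_Times_iff)
        qed
        moreover have "f \<in> Gi n" if "i \<le> n" "n < max N i" "f \<in> Gi (Suc n)" for n
        proof -
          have n: "N - Suc n < N - i" using that by auto
          have "cong_mod (int p) (restr (?J (Suc n)) (\<theta> (restr (?J (Suc n)) f))) (restr (?J (Suc n)) (\<theta> f))"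
            by (rule cong_mod_sym [OF diag [OF \<open>f \<in> Gi (Suc n)\<close>]])
          also have "cong_mod (int p) (restr (?J (Suc n)) (\<theta> f)) (restr (?J (Suc n)) h)"
            by (rule cong_mod_restr [OF hf])
          also have "restr (?J (Suc n)) h = 0"
          proof (rule ext)
            fix z
            show "restr (?J (Suc n)) h z = 0 z"
              using free_module_outside [OF h, of z] \<open>i \<le> n\<close> by (auto simp: restr_def mem_Times_iff)
          qed
          finally have *: "cong_mod (int p) (restr (?J (Suc n)) (\<theta> (restr (?J (Suc n)) f))) 0" .
          have "cong_mod (int p) (restr (?J (Suc n)) f) 0"
            by (rule less.hyps [OF n free_module_restr_subset [OF f(1)] *]) auto
          then have d: "int p dvd f z" if "e (fst z) = Suc n" for z
          proof (cases "fst z \<in> J")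
            case True
            have "int p dvd restr (?J (Suc n)) f z"
              using \<open>cong_mod (int p) (restr (?J (Suc n)) f) 0\<close> unfolding cong_mod_zero by blast
            then show ?thesis using True that by (simp add: restr_def)
          next
            case False
            then show ?thesis using free_module_outside [OF f(1), of z] by (auto simp: mem_Times_iff)
          qed
          show ?thesis
            unfolding Gi_def
          proof (intro CollectI conjI allI impI f(1))
            fix z :: "'i \<times> 'a" assume "n < e (fst z)"
            then show "int p dvd f z"
              using \<open>f \<in> Gi (Suc n)\<close> d [of z] by (cases "e (fst z) = Suc n") (simp_all add: Gi_def)
          qed
        qed
        ultimately have "f \<in> Gi i"
          by (rule inc_induct [OF max.cobounded2])
        then have "cong_mod (int p) (restr (?J i) (\<theta> (restr (?J i) f))) (restr (?J i) (\<theta> f))"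
          by (intro cong_mod_sym [OF diag])
        also have "cong_mod (int p) (restr (?J i) (\<theta> f)) (restr (?J i) h)"
          by (rule cong_mod_restr [OF hf])
        also have "restr (?J i) h = h" by (rule restr_free_module [OF h])
        finally show "\<exists>f\<in>free_module (?J i). cong_mod (int p) (restr (?J i) (\<theta> f)) h"
          using free_module_restr_subset [OF f(1), of "?J i"] by blast
      qed
    qed
  qed
  show "f0 \<in> ?K"
  proof (rule ccontr)
    assume nK: "f0 \<notin> ?K"
    have "(\<lambda>z. int p ^ N * f0 z) \<in> ?K"
      unfolding K_iff
    proof (intro conjI allI)
      show "int p ^ e (fst z) dvd int p ^ N * f0 z" for z
        using N [of "fst z"] free_module_outside [OF f0(1), of z]
        by (cases "fst z \<in> J") (auto intro: dvd_mult2 le_imp_power_dvd simp: mem_Times_iff)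
    qed (use f0 in simp)
    define t where "t = (LEAST t. (\<lambda>z. int p ^ t * f0 z) \<in> ?K)"
    have tK: "(\<lambda>z. int p ^ t * f0 z) \<in> ?K"
      unfolding t_def by (rule LeastI) fact
    have "t \<noteq> 0"
    proof
      assume "t = 0"
      then show False using tK nK by simp
    qed
    then obtain s where s: "t = Suc s" by (cases t) auto
    define f1 where "f1 = (\<lambda>z. int p ^ s * f0 z)"
    have f1V: "f1 \<in> ?V" using f0 by (simp add: f1_def)
    have f1K: "f1 \<notin> ?K" unfolding f1_def
      using not_less_Least [of s "\<lambda>t. (\<lambda>z. int p ^ t * f0 z) \<in> ?K"] s t_def by auto
    have pf1: "int p ^ e (fst z) dvd int p * f1 z" for z
      using tK by (simp add: K_iff f1_def s mult.assoc)
    have \<theta>f1: "\<theta> f1 \<in> ?K"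
      unfolding f1_def endo_scale [OF \<theta> f0(1)] by (rule relations_scale [OF f0(2)])
    define bad where "bad = (\<lambda>i. \<exists>z. e (fst z) = i \<and> \<not> int p ^ i dvd f1 z)"
    define i where "i = (LEAST i. bad i)"
    have "\<exists>i. bad i" using f1K f1V by (auto simp: bad_def K_iff)
    then have "bad i" unfolding i_def by (rule LeastI_ex)
    then obtain z0 where z0: "e (fst z0) = i" "\<not> int p ^ i dvd f1 z0" by (auto simp: bad_def)
    have small: "int p ^ e (fst z) dvd f1 z" if "e (fst z) < i" for z
      using not_less_Least [of "e (fst z)" bad] that by (auto simp: bad_def i_def)
    have "f1 z0 \<noteq> 0" using z0 by auto
    then have z0J: "fst z0 \<in> J" using free_module_subset [OF f1V] by auto
    then obtain i' where i': "i = Suc i'" using e [OF z0J] z0 by (cases i) auto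
    have big: "int p ^ (e (fst z) - 1) dvd f1 z" if "i \<le> e (fst z)" for z
    proof -
      have "e (fst z) = Suc (e (fst z) - 1)" using that i' by simp
      then have "int p * int p ^ (e (fst z) - 1) dvd int p * f1 z" using pf1 [of z] by (metis power_Suc)
      then show ?thesis using p0 by simp
    qed
    define h where "h = (\<lambda>z. (if i \<le> e (fst z) then f1 z else 0) div int p ^ i')"
    define \<kappa> where "\<kappa> = (\<lambda>z. if e (fst z) < i then f1 z else 0)"
    have hV: "h \<in> ?V"
      using free_module_div [OF free_module_restr' [OF f1V, of "{k. i \<le> e k}"], of "int p ^ i'"]
      by (simp add: h_def restr_def)
    have \<kappa>V: "\<kappa> \<in> ?V"
      using free_module_restr' [OF f1V, of "{k. e k < i}"] by (simp add: \<kappa>_def restr_def)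
    have \<kappa>K: "\<kappa> \<in> ?K" using small \<kappa>V by (auto simp: K_iff \<kappa>_def)
    have hmul: "int p ^ i' * h z = f1 z" if "i \<le> e (fst z)" for z
    proof -
      have "int p ^ i' dvd int p ^ (e (fst z) - 1)" using that i' by (intro le_imp_power_dvd) simp
      then have "int p ^ i' dvd f1 z" using big [OF that] dvd_trans by blast
      then show ?thesis using that by (simp add: h_def)
    qed
    have f1_eq: "f1 = (\<lambda>z. int p ^ i' * h z) + \<kappa>"
      using hmul by (auto simp: fun_eq_iff \<kappa>_def h_def not_less)
    have "\<theta> f1 = (\<lambda>z. int p ^ i' * \<theta> h z) + \<theta> \<kappa>"
      by (subst f1_eq, subst endo_add [OF \<theta>]) (simp_all only: hV \<kappa>V endo_scale [OF \<theta> hV] free_module_scale)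
    then have "(\<lambda>z. int p ^ i' * \<theta> h z) = \<theta> f1 - \<theta> \<kappa>" by (simp only: add_diff_cancel)
    then have hK: "(\<lambda>z. int p ^ i' * \<theta> h z) \<in> ?K"
      using relations_diff [OF \<theta>f1] \<theta>K \<kappa>K by simp
    have h_div: "int p dvd \<theta> h z" if "e (fst z) = i" for z
    proof -
      have "int p ^ i' * int p dvd int p ^ i' * \<theta> h z"
      proof -
        have "int p ^ e (fst z) dvd int p ^ i' * \<theta> h z" using hK unfolding K_iff by blast
        then show ?thesis unfolding that i' by (simp only: power_Suc2)
      qed
      then show ?thesis using p0 by simp
    qed
    have hG: "h \<in> Gi i"
      unfolding Gi_def
    proof (intro CollectI conjI allI impI hV)
      fix z :: "'i \<times> 'a" assume z: "i < e (fst z)"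
      have "int p ^ i dvd int p ^ (e (fst z) - 1)" using z by (intro le_imp_power_dvd) simp
      also have "\<dots> dvd f1 z" using z by (intro big) simp
      also have "f1 z = int p ^ i' * h z" using z by (intro hmul [symmetric]) simp
      finally have "int p ^ i' * int p dvd int p ^ i' * h z"
        unfolding i' by (simp only: power_Suc2)
      then show "int p dvd h z" using p0 by simp
    qed
    have "cong_mod (int p) (restr (?J i) (\<theta> (restr (?J i) h))) (restr (?J i) (\<theta> h))"
      by (rule cong_mod_sym [OF diag [OF hG]])
    also have "cong_mod (int p) (restr (?J i) (\<theta> h)) 0"
      using h_div by (auto simp: cong_mod_zero restr_def)
    finally have *: "cong_mod (int p) (restr (?J i) (\<theta> (restr (?J i) h))) 0" .
    have "cong_mod (int p) (restr (?J i) h) 0"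
      by (rule inj [OF free_module_restr_subset [OF hV] *]) auto
    then have "int p dvd h z0" using z0 z0J by (auto simp: cong_mod_zero restr_def split: if_splits)
    then have "int p ^ i' * int p dvd int p ^ i' * h z0" by (rule mult_dvd_mono [OF dvd_refl])
    also have "int p ^ i' * h z0 = f1 z0" using z0 by (intro hmul) simp
    finally show False using z0(2) unfolding i' power_Suc2 by contradiction
  qed
qed

end

section \<open>Matrices over the group ring as endomorphisms\<close>

lemma residue_ring_simps:
  "carrier (residue_ring m) = {0..m - 1}"
  "x \<otimes>\<^bsub>residue_ring m\<^esub> y = (x * y) mod m"
  "x \<oplus>\<^bsub>residue_ring m\<^esub> y = (x + y) mod m"
  "\<zero>\<^bsub>residue_ring m\<^esub> = 0" "\<one>\<^bsub>residue_ring m\<^esub> = 1"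
  by (simp_all add: residue_ring_def)

lemma abelian_monoid_residue_ring:
  assumes "1 < m" shows "abelian_monoid (residue_ring m)"
proof -
  interpret residues m "residue_ring m" by unfold_locales (use assms in auto)
  show ?thesis by (rule abelian_monoid_axioms)
qed

lemma finsum_residue_ring:
  assumes m: "1 < m" and f: "\<And>s. s \<in> S \<Longrightarrow> f s \<in> {0..m - 1}" and S: "finite S"
  shows "(\<Oplus>\<^bsub>residue_ring m\<^esub>s\<in>S. f s) = (\<Sum>s\<in>S. f s) mod m"
  using S f
proof (induction S)
  case empty
  then show ?case
    using abelian_monoid.finsum_empty [OF abelian_monoid_residue_ring [OF m]]
    by (simp add: residue_ring_simps)
next
  case (insert x S)
  then show ?case
    by (subst abelian_monoid.finsum_insert [OF abelian_monoid_residue_ring [OF m]])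
      (auto simp: residue_ring_simps mod_simps)
qed

context group
begin

context
  fixes p :: int
  assumes p: "1 < p"
begin

private abbreviation "GR \<equiv> group_ring (residue_ring p) G"

lemma carrier_group_ring:
  "f \<in> carrier GR \<longleftrightarrow> f \<in> carrier G \<rightarrow>\<^sub>E {0..p - 1} \<and> finite {x \<in> carrier G. f x \<noteq> 0}"
  by (simp add: group_ring_def residue_ring_simps)

lemma add_group_ring:
  "f \<oplus>\<^bsub>GR\<^esub> h = (\<lambda>x\<in>carrier G. (f x + h x) mod p)"
  by (simp add: group_ring_def residue_ring_simps)

lemma zero_group_ring: "\<zero>\<^bsub>GR\<^esub> = (\<lambda>x\<in>carrier G. 0)"
  by (simp add: group_ring_def residue_ring_simps)

lemma one_group_ring: "\<one>\<^bsub>GR\<^esub> = (\<lambda>x\<in>carrier G. if x = \<one> then 1 else 0)"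
  unfolding group_ring_def monoid.simps residue_ring_simps ..

lemma group_ring_range: "f \<in> carrier GR \<Longrightarrow> x \<in> carrier G \<Longrightarrow> f x \<in> {0..p - 1}"
  unfolding carrier_group_ring by (blast dest: PiE_mem)

lemma group_ring_mod: "f \<in> carrier GR \<Longrightarrow> x \<in> carrier G \<Longrightarrow> f x mod p = f x"
  using group_ring_range [of f x] by simp

lemma mult_group_ring:
  assumes f: "f \<in> carrier GR"
  shows "f \<otimes>\<^bsub>GR\<^esub> h = (\<lambda>x\<in>carrier G. (\<Sum>y\<in>{y \<in> carrier G. f y \<noteq> 0}. f y * h (inv y \<otimes> x)) mod p)"
  unfolding group_ring_def monoid.simps residue_ring_simps
proof (intro restrict_ext)
  fix x
  have "(\<Oplus>\<^bsub>residue_ring p\<^esub>y\<in>{y \<in> carrier G. f y \<noteq> 0}. f y * h (inv y \<otimes> x) mod p)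
      = (\<Sum>y\<in>{y \<in> carrier G. f y \<noteq> 0}. f y * h (inv y \<otimes> x) mod p) mod p"
    using p f by (intro finsum_residue_ring) (auto simp: carrier_group_ring)
  then show "(\<Oplus>\<^bsub>residue_ring p\<^esub>y\<in>{y \<in> carrier G. f y \<noteq> 0}. f y * h (inv y \<otimes> x) mod p)
      = (\<Sum>y\<in>{y \<in> carrier G. f y \<noteq> 0}. f y * h (inv y \<otimes> x)) mod p"
    by (simp add: mod_sum_eq)
qed

lemma group_ring_closed_mod:
  assumes "finite S" "S \<subseteq> carrier G" "\<And>x. x \<in> carrier G \<Longrightarrow> x \<notin> S \<Longrightarrow> f x = 0"
  shows "(\<lambda>x\<in>carrier G. f x mod p) \<in> carrier GR"
proof -
  have "{x \<in> carrier G. (\<lambda>x\<in>carrier G. f x mod p) x \<noteq> 0} \<subseteq> S"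
  proof
    fix x assume "x \<in> {x \<in> carrier G. (\<lambda>x\<in>carrier G. f x mod p) x \<noteq> 0}"
    then have "x \<in> carrier G" "f x \<noteq> 0" by auto
    then show "x \<in> S" using assms(3) by blast
  qed
  then have "finite {x \<in> carrier G. (\<lambda>x\<in>carrier G. f x mod p) x \<noteq> 0}"
    by (rule finite_subset [OF _ assms(1)])
  then show ?thesis using p unfolding carrier_group_ring by (intro conjI) auto
qed

lemma abelian_monoid_group_ring: "abelian_monoid GR"
proof (rule abelian_monoidI)
  fix f h u assume f: "f \<in> carrier GR" and h: "h \<in> carrier GR"
  show "f \<oplus>\<^bsub>GR\<^esub> h \<in> carrier GR"
    unfolding add_group_ring
    by (rule group_ring_closed_mod [of "{x \<in> carrier G. f x \<noteq> 0} \<union> {x \<in> carrier G. h x \<noteq> 0}"])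
      (use f h in \<open>auto simp: carrier_group_ring\<close>)
  show "f \<oplus>\<^bsub>GR\<^esub> h \<oplus>\<^bsub>GR\<^esub> u = f \<oplus>\<^bsub>GR\<^esub> (h \<oplus>\<^bsub>GR\<^esub> u)"
    by (auto simp: add_group_ring mod_simps add.assoc restrict_def)
  show "f \<oplus>\<^bsub>GR\<^esub> h = h \<oplus>\<^bsub>GR\<^esub> f" by (simp add: add_group_ring add.commute)
  have "x \<in> carrier G \<Longrightarrow> f x mod p = f x" "x \<notin> carrier G \<Longrightarrow> undefined = f x" for x
    using f group_ring_mod [OF f, of x] by (auto simp: carrier_group_ring PiE_def extensional_def)
  then show "\<zero>\<^bsub>GR\<^esub> \<oplus>\<^bsub>GR\<^esub> f = f"
    unfolding add_group_ring zero_group_ring by (simp add: fun_eq_iff restrict_def)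
next
  show "\<zero>\<^bsub>GR\<^esub> \<in> carrier GR"
    using p by (auto simp: zero_group_ring carrier_group_ring)
qed

lemma finsum_group_ring:
  assumes "finite K" "\<And>k. k \<in> K \<Longrightarrow> F k \<in> carrier GR"
  shows "(\<Oplus>\<^bsub>GR\<^esub>k\<in>K. F k) = (\<lambda>x\<in>carrier G. (\<Sum>k\<in>K. F k x) mod p)"
  using assms
proof (induction K)
  case empty
  then show ?case
    by (subst abelian_monoid.finsum_empty [OF abelian_monoid_group_ring])
      (auto simp: zero_group_ring)
next
  case (insert k K)
  then show ?case
    by (subst abelian_monoid.finsum_insert [OF abelian_monoid_group_ring])
      (auto simp: add_group_ring mod_simps restrict_def)
qed

lemma mult_group_ring_closed:
  assumes f: "f \<in> carrier GR" and h: "h \<in> carrier GR"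
  shows "f \<otimes>\<^bsub>GR\<^esub> h \<in> carrier GR"
  unfolding mult_group_ring [OF f]
proof (rule group_ring_closed_mod)
  let ?S = "(\<lambda>(y, z). y \<otimes> z) ` ({y \<in> carrier G. f y \<noteq> 0} \<times> {y \<in> carrier G. h y \<noteq> 0})"
  show "finite ?S" using f h by (auto simp: carrier_group_ring)
  show "?S \<subseteq> carrier G" by auto
  fix x assume x: "x \<in> carrier G" "x \<notin> ?S"
  show "(\<Sum>y\<in>{y \<in> carrier G. f y \<noteq> 0}. f y * h (inv y \<otimes> x)) = 0"
  proof (rule sum.neutral, rule ballI)
    fix y assume y: "y \<in> {y \<in> carrier G. f y \<noteq> 0}"
    have "h (inv y \<otimes> x) = 0"
    proof (rule ccontr)
      assume "h (inv y \<otimes> x) \<noteq> 0"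
      moreover have "x = y \<otimes> (inv y \<otimes> x)" using x y by (simp add: m_assoc [symmetric])
      ultimately have "x \<in> ?S" using x y by (auto intro!: image_eqI [of _ _ "(y, inv y \<otimes> x)"])
      then show False using x by simp
    qed
    then show "f y * h (inv y \<otimes> x) = 0" by simp
  qed
qed

context
  fixes n :: nat
begin

private abbreviation "MR \<equiv> matrix_ring n GR"

text \<open>
  A row of a matrix over the group ring, as an element of the free module on the column indices.
\<close>

definition row :: "(nat \<times> nat \<Rightarrow> 'a \<Rightarrow> int) \<Rightarrow> nat \<Rightarrow> nat \<times> 'a \<Rightarrow> int" where
  "row X i = (\<lambda>(l, x). if l < n \<and> x \<in> carrier G then X (i, l) x else 0)"

definition matrix_of :: "((nat \<times> 'a \<Rightarrow> int) \<Rightarrow> nat \<times> 'a \<Rightarrow> int) \<Rightarrow> nat \<times> nat \<Rightarrow> 'a \<Rightarrow> int" where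
  "matrix_of \<theta> = (\<lambda>(i, j)\<in>{..<n} \<times> {..<n}. \<lambda>x\<in>carrier G. \<theta> (delta (i, \<one>)) (j, x) mod p)"

lemma carrier_matrix_ring: "X \<in> carrier MR \<longleftrightarrow> X \<in> {..<n} \<times> {..<n} \<rightarrow>\<^sub>E carrier GR"
  by (simp add: matrix_ring_def)

lemma entry_closed: "X \<in> carrier MR \<Longrightarrow> i < n \<Longrightarrow> j < n \<Longrightarrow> X (i, j) \<in> carrier GR"
  by (auto simp: carrier_matrix_ring dest: PiE_mem)

lemma supp_row: "{z. row X i z \<noteq> 0} = Sigma {..<n} (\<lambda>k. {y \<in> carrier G. X (i, k) y \<noteq> 0})"
  by (auto simp: row_def split: if_splits)

lemma row_closed:
  assumes "X \<in> carrier MR" "i \<in> {..<n}" shows "row X i \<in> free_module {..<n}"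
  unfolding free_module_def mem_Collect_eq supp_row
  using entry_closed [OF assms(1), of i] assms(2) by (auto simp: carrier_group_ring)

text \<open>
  Matrices act on rows from the right, so the product \<open>X \<otimes> Y\<close> corresponds to applying \<open>X\<close> first.
\<close>

lemma mult_matrix_ring:
  assumes X: "X \<in> carrier MR" and Y: "Y \<in> carrier MR" and ij: "i < n" "j < n" and x: "x \<in> carrier G"
  shows "(X \<otimes>\<^bsub>MR\<^esub> Y) (i, j) x = linear_extension (row Y) (row X i) (j, x) mod p"
proof -
  have "(X \<otimes>\<^bsub>MR\<^esub> Y) (i, j) = (\<Oplus>\<^bsub>GR\<^esub>k\<in>{..<n}. X (i, k) \<otimes>\<^bsub>GR\<^esub> Y (k, j))"
    using ij by (simp add: matrix_ring_def)
  also have "\<dots> = (\<lambda>x\<in>carrier G. (\<Sum>k<n. (X (i, k) \<otimes>\<^bsub>GR\<^esub> Y (k, j)) x) mod p)"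
    using ij by (intro finsum_group_ring mult_group_ring_closed entry_closed X Y) auto
  finally have "(X \<otimes>\<^bsub>MR\<^esub> Y) (i, j) x = (\<Sum>k<n. (X (i, k) \<otimes>\<^bsub>GR\<^esub> Y (k, j)) x) mod p"
    using x by simp
  also have "\<dots> = (\<Sum>k<n. \<Sum>y\<in>{y \<in> carrier G. X (i, k) y \<noteq> 0}. X (i, k) y * Y (k, j) (inv y \<otimes> x)) mod p"
  proof -
    have "(\<Sum>k<n. (X (i, k) \<otimes>\<^bsub>GR\<^esub> Y (k, j)) x)
        = (\<Sum>k<n. (\<Sum>y\<in>{y \<in> carrier G. X (i, k) y \<noteq> 0}. X (i, k) y * Y (k, j) (inv y \<otimes> x)) mod p)"
      using x ij by (intro sum.cong refl) (simp add: mult_group_ring entry_closed [OF X])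
    then show ?thesis by (simp add: mod_sum_eq)
  qed
  also have "(\<Sum>k<n. \<Sum>y\<in>{y \<in> carrier G. X (i, k) y \<noteq> 0}. X (i, k) y * Y (k, j) (inv y \<otimes> x))
      = linear_extension (row Y) (row X i) (j, x)"
    unfolding linear_extension_def supp_row
    using entry_closed [OF X] ij x
    by (subst sum.Sigma) (auto simp: carrier_group_ring row_def shift_def intro!: sum.cong)
  finally show ?thesis .
qed

lemma matrix_of_closed:
  assumes "module_endo {..<n} \<theta>" shows "matrix_of \<theta> \<in> carrier MR"
proof -
  have "(\<lambda>x\<in>carrier G. \<theta> (delta (i, \<one>)) (j, x) mod p) \<in> carrier GR" if "i < n" for i j
  proof -
    have V: "\<theta> (delta (i, \<one>)) \<in> free_module {..<n}" using that by (intro endo_closed [OF assms]) auto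
    show ?thesis
      by (rule group_ring_closed_mod [of "snd ` {z. \<theta> (delta (i, \<one>)) z \<noteq> 0}"])
        (use free_module_finite [OF V] free_module_subset [OF V] in \<open>force+\<close>)
  qed
  then show ?thesis by (auto simp: carrier_matrix_ring matrix_of_def)
qed

lemma row_matrix_of:
  assumes "module_endo {..<n} \<theta>" "i \<in> {..<n}"
  shows "cong_mod p (row (matrix_of \<theta>) i) (\<theta> (delta (i, \<one>)))"
proof -
  have V: "\<theta> (delta (i, \<one>)) \<in> free_module {..<n}" using assms(2) by (intro endo_closed [OF assms(1)]) auto
  show ?thesis
    unfolding cong_mod_def
  proof
    fix z :: "nat \<times> 'a"
    show "p dvd row (matrix_of \<theta>) i z - \<theta> (delta (i, \<one>)) z"
      using free_module_outside [OF V, of z] assms(2)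
      by (cases z) (auto simp: row_def matrix_of_def mod_eq_dvd_iff [symmetric])
  qed
qed

lemma one_matrix_ring_iff:
  assumes X: "X \<in> carrier MR" and Y: "Y \<in> carrier MR"
  shows "X \<otimes>\<^bsub>MR\<^esub> Y = \<one>\<^bsub>MR\<^esub> \<longleftrightarrow> (\<forall>f\<in>free_module {..<n}. cong_mod p (linear_extension (row Y) (linear_extension (row X) f)) f)"
    (is "?L \<longleftrightarrow> ?R")
proof -
  note endoX = endo_linear_extension [of "{..<n}" "row X", OF row_closed [OF X]]
  note endoY = endo_linear_extension [of "{..<n}" "row Y", OF row_closed [OF Y]]
  have linear_extension_row: "linear_extension (row X) (delta (i, \<one>)) = row X i" if "i < n" for i
    using that by (intro linear_extension_delta [of "row X" i "{..<n}"] row_closed [OF X]) simp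
  have one: "\<one>\<^bsub>MR\<^esub> (i, j) x = delta (i, \<one>) (j, x)" if "i < n" "j < n" "x \<in> carrier G" for i j x
    using that by (auto simp: matrix_ring_def one_group_ring zero_group_ring delta_def)
  have delta_mod: "delta z w mod p = delta z w" for z w :: "nat \<times> 'a" using p by (simp add: delta_def)
  have entry: "(X \<otimes>\<^bsub>MR\<^esub> Y) (i, j) x = \<one>\<^bsub>MR\<^esub> (i, j) x \<longleftrightarrow>
      p dvd linear_extension (row Y) (linear_extension (row X) (delta (i, \<one>))) (j, x) - delta (i, \<one>) (j, x)"
    if "i < n" "j < n" "x \<in> carrier G" for i j x
    using that delta_mod [of "(i, \<one>)" "(j, x)"]
    by (simp add: mult_matrix_ring [OF X Y] one linear_extension_row mod_eq_dvd_iff [symmetric])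
  have "?L \<longleftrightarrow> (\<forall>i<n. \<forall>j<n. \<forall>x\<in>carrier G. (X \<otimes>\<^bsub>MR\<^esub> Y) (i, j) x = \<one>\<^bsub>MR\<^esub> (i, j) x)"
  proof (intro iffI)
    assume *: "\<forall>i<n. \<forall>j<n. \<forall>x\<in>carrier G. (X \<otimes>\<^bsub>MR\<^esub> Y) (i, j) x = \<one>\<^bsub>MR\<^esub> (i, j) x"
    have "(X \<otimes>\<^bsub>MR\<^esub> Y) (i, j) = \<one>\<^bsub>MR\<^esub> (i, j)" if ij: "i < n" "j < n" for i j
    proof -
      have "(X \<otimes>\<^bsub>MR\<^esub> Y) (i, j) = (\<Oplus>\<^bsub>GR\<^esub>k\<in>{..<n}. X (i, k) \<otimes>\<^bsub>GR\<^esub> Y (k, j))"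
        using ij by (simp add: matrix_ring_def)
      also have "\<dots> \<in> extensional (carrier G)"
        using ij by (subst finsum_group_ring) (auto intro!: mult_group_ring_closed entry_closed X Y)
      finally have "(X \<otimes>\<^bsub>MR\<^esub> Y) (i, j) \<in> extensional (carrier G)" .
      moreover have "\<one>\<^bsub>MR\<^esub> (i, j) \<in> extensional (carrier G)"
        using ij by (simp add: matrix_ring_def one_group_ring zero_group_ring)
      ultimately show ?thesis using * ij by (intro extensionalityI) auto
    qed
    then show ?L
      by (intro extensionalityI [of _ "{..<n} \<times> {..<n}"]) (auto simp: matrix_ring_def)
  qed simp
  also have "\<dots> \<longleftrightarrow> (\<forall>i<n. \<forall>j<n. \<forall>x\<in>carrier G.
      p dvd linear_extension (row Y) (linear_extension (row X) (delta (i, \<one>))) (j, x) - delta (i, \<one>) (j, x))"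
    using entry by simp
  also have "\<dots> \<longleftrightarrow> (\<forall>i<n. cong_mod p (linear_extension (row Y) (linear_extension (row X) (delta (i, \<one>)))) (delta (i, \<one>)))"
  proof (intro iff_allI imp_cong refl)
    fix i assume i: "i < n"
    have V: "linear_extension (row Y) (linear_extension (row X) (delta (i, \<one>))) - delta (i, \<one>) \<in> free_module {..<n}"
      using i by (intro free_module_diff endo_closed [OF endoY] endo_closed [OF endoX]) auto
    have "p dvd linear_extension (row Y) (linear_extension (row X) (delta (i, \<one>))) (j, x) - delta (i, \<one>) (j, x)"
      if "\<not> (j < n \<and> x \<in> carrier G)" for j x
      using free_module_outside [OF V, of "(j, x)"] that by simp
    then show "(\<forall>j<n. \<forall>x\<in>carrier G. p dvd linear_extension (row Y) (linear_extension (row X) (delta (i, \<one>))) (j, x) - delta (i, \<one>) (j, x))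
      \<longleftrightarrow> cong_mod p (linear_extension (row Y) (linear_extension (row X) (delta (i, \<one>)))) (delta (i, \<one>))"
      unfolding cong_mod_def by auto
  qed
  also have "\<dots> \<longleftrightarrow> ?R"
  proof
    assume *: "\<forall>i<n. cong_mod p (linear_extension (row Y) (linear_extension (row X) (delta (i, \<one>)))) (delta (i, \<one>))"
    show ?R
    proof
      fix f :: "nat \<times> 'a \<Rightarrow> int" assume f: "f \<in> free_module {..<n}"
      show "cong_mod p (linear_extension (row Y) (linear_extension (row X) f)) f"
        by (rule endo_ext_cong [OF endo_comp [OF endoY endoX] endo_id _ f]) (use * in auto)
    qed
  qed auto
  finally show ?thesis .
qed

theorem matrix_ring_directly_finite_iff: "directly_finite MR \<longleftrightarrow> directly_finite_mod p {..<n}"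
proof
  assume df: "directly_finite MR"
  show "directly_finite_mod p {..<n}"
    unfolding directly_finite_mod_def
  proof (intro allI impI ballI)
    fix \<theta> \<rho> f
    assume \<theta>: "module_endo {..<n} \<theta>" and \<rho>: "module_endo {..<n} \<rho>"
      and sec: "\<forall>f\<in>free_module {..<n}. cong_mod p (\<theta> (\<rho> f)) f" and f: "f \<in> free_module {..<n}"
    have mat: "cong_mod p (linear_extension (row (matrix_of \<theta>)) f) (\<theta> f)"
      if \<theta>: "module_endo {..<n} \<theta>" and f: "f \<in> free_module {..<n}" for \<theta> f
    proof (rule endo_ext_cong [OF endo_linear_extension \<theta> _ f])
      show "k \<in> {..<n} \<Longrightarrow> row (matrix_of \<theta>) k \<in> free_module {..<n}" for k
        by (rule row_closed [OF matrix_of_closed [OF \<theta>]])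
      then show "cong_mod p (linear_extension (row (matrix_of \<theta>)) (delta (k, \<one>))) (\<theta> (delta (k, \<one>)))"
        if "k \<in> {..<n}" for k
        using that by (subst linear_extension_delta) (auto intro: row_matrix_of [OF \<theta>])
    qed
    have mat2: "cong_mod p (linear_extension (row (matrix_of \<theta>)) (linear_extension (row (matrix_of \<rho>)) f)) (\<theta> (\<rho> f))"
      if \<theta>: "module_endo {..<n} \<theta>" and \<rho>: "module_endo {..<n} \<rho>" and f: "f \<in> free_module {..<n}" for \<theta> \<rho> f
    proof -
      have V: "linear_extension (row (matrix_of \<rho>)) f \<in> free_module {..<n}"
        by (rule endo_closed [OF endo_linear_extension f]) (rule row_closed [OF matrix_of_closed [OF \<rho>]])
      have "cong_mod p (linear_extension (row (matrix_of \<theta>)) (linear_extension (row (matrix_of \<rho>)) f)) (\<theta> (linear_extension (row (matrix_of \<rho>)) f))"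
        by (rule mat [OF \<theta> V])
      also have "cong_mod p (\<theta> (linear_extension (row (matrix_of \<rho>)) f)) (\<theta> (\<rho> f))"
        by (rule endo_cong_mod [OF \<theta> V endo_closed [OF \<rho> f] mat [OF \<rho> f]])
      finally show ?thesis .
    qed
    note M\<theta> = matrix_of_closed [OF \<theta>] and M\<rho> = matrix_of_closed [OF \<rho>]
    have "matrix_of \<rho> \<otimes>\<^bsub>MR\<^esub> matrix_of \<theta> = \<one>\<^bsub>MR\<^esub>"
      unfolding one_matrix_ring_iff [OF M\<rho> M\<theta>]
      using sec mat2 [OF \<theta> \<rho>] cong_mod_trans by blast
    then have "matrix_of \<theta> \<otimes>\<^bsub>MR\<^esub> matrix_of \<rho> = \<one>\<^bsub>MR\<^esub>"
      using df M\<theta> M\<rho> unfolding directly_finite_def by blast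
    then have "cong_mod p (linear_extension (row (matrix_of \<rho>)) (linear_extension (row (matrix_of \<theta>)) f)) f"
      unfolding one_matrix_ring_iff [OF M\<theta> M\<rho>] using f by blast
    then show "cong_mod p (\<rho> (\<theta> f)) f"
      using cong_mod_trans [OF cong_mod_sym [OF mat2 [OF \<rho> \<theta> f]]] by blast
  qed
next
  assume df: "directly_finite_mod p {..<n}"
  show "directly_finite MR"
    unfolding directly_finite_def
  proof (intro ballI impI)
    fix X Y assume X: "X \<in> carrier MR" and Y: "Y \<in> carrier MR" and "X \<otimes>\<^bsub>MR\<^esub> Y = \<one>\<^bsub>MR\<^esub>"
    then show "Y \<otimes>\<^bsub>MR\<^esub> X = \<one>\<^bsub>MR\<^esub>"
      using df endo_linear_extension [of "{..<n}" "row X", OF row_closed [OF X]]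
        endo_linear_extension [of "{..<n}" "row Y", OF row_closed [OF Y]]
      unfolding one_matrix_ring_iff [OF X Y] one_matrix_ring_iff [OF Y X] directly_finite_mod_def by blast
  qed
qed

end
end
end

section \<open>Surjective endomorphisms modulo a submodule of relations\<close>

context group
begin

text \<open>
  Only the generators that occur in \<open>f\<close> contribute to its image. The case \<open>c = 0\<close> is used to show
  that a coordinate vanishes.
\<close>

lemma endo_dvd_coordinate:
  assumes \<theta>: "module_endo I \<theta>" and f: "f \<in> free_module I"
    and d: "\<And>k x. k \<in> I \<Longrightarrow> (\<exists>y. f (k, y) \<noteq> 0) \<Longrightarrow> c dvd \<theta> (delta (k, \<one>)) (l, x)"
  shows "c dvd \<theta> f (l, x)"
proof -
  have "c dvd (\<Sum>z | f z \<noteq> 0. f z * shift (snd z) (\<theta> (delta (fst z, \<one>))) (l, x))"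
  proof (intro dvd_sum dvd_mult)
    fix z assume z: "z \<in> {z. f z \<noteq> 0}"
    then have "fst z \<in> I" "\<exists>y. f (fst z, y) \<noteq> 0"
      using free_module_subset [OF f] by (auto intro!: exI [of _ "snd z"])
    then have "c dvd \<theta> (delta (fst z, \<one>)) (l, y)" for y by (rule d)
    then show "c dvd shift (snd z) (\<theta> (delta (fst z, \<one>))) (l, x)"
      by (auto simp: shift_def)
  qed
  then show ?thesis using fun_cong [OF endo_expand' [OF \<theta> f], of "(l, x)"] by simp
qed

lemma free_module_outside_fst: "f \<in> free_module I \<Longrightarrow> fst z \<notin> I \<Longrightarrow> f z = 0"
  by (rule free_module_outside) (auto simp: mem_Times_iff)

lemma restr_compl: "restr J (f - restr J f) = 0"
  by (auto simp: restr_def)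

text \<open>
  The relation for the generator \<open>k\<close> forces \<open>n k\<close> times its image into the relations. Torsion
  generators therefore have no component in the torsion-free coordinates, and generators whose order is
  a power of another prime have no component, modulo the relations, in the coordinates for \<open>p\<close>. So
  \<open>\<theta>\<close> induces a surjective endomorphism of the free part, which is injective by Kaplansky's theorem;
  after that any preimage of a \<open>p\<close>-torsion element is torsion, and \<open>\<theta>\<close> induces a surjective
  endomorphism of each primary part.
\<close>

theorem hopfian_mod_of_directly_finite_mod:
  fixes n :: "'i \<Rightarrow> nat"
  assumes fin0: "finite {k \<in> I. n k = 0}"
    and fin: "\<And>p. prime p \<Longrightarrow> finite {k \<in> I. \<exists>e\<ge>1. n k = p ^ e}"
    and n: "\<And>k. k \<in> I \<Longrightarrow> n k = 0 \<or> (\<exists>p e. prime p \<and> 1 \<le> e \<and> n k = p ^ e)"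
    and df: "\<And>p i. prime p \<Longrightarrow> 1 \<le> i \<Longrightarrow> directly_finite_mod (int p) {k \<in> I. n k = p ^ i}"
  shows "hopfian_mod I n"
  unfolding hopfian_mod_def
proof (intro allI impI ballI)
  fix \<theta> :: "('i \<times> 'a \<Rightarrow> int) \<Rightarrow> 'i \<times> 'a \<Rightarrow> int" and f0
  let ?V = "free_module I" and ?K = "relations I n"
  assume \<theta>: "module_endo I \<theta>" and \<theta>K: "\<forall>f\<in>?K. \<theta> f \<in> ?K"
    and surj: "\<forall>h\<in>?V. \<exists>f\<in>?V. h - \<theta> f \<in> ?K"
    and f0: "f0 \<in> ?V" "\<theta> f0 \<in> ?K"
  note [simp del] = split_paired_All split_paired_Ex
  have relation: "int (n l) dvd int (n k) * \<theta> (delta (k, \<one>)) (l, x)" if "k \<in> I" for k l x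
  proof -
    have "(\<lambda>z. int (n k) * delta (k, \<one>) z) \<in> ?K"
      unfolding relations_def
      using that free_module_scale [OF free_module_delta [OF that one_closed]]
      by (auto simp: delta_def)
    then have "\<theta> (\<lambda>z. int (n k) * delta (k, \<one>) z) \<in> ?K" using \<theta>K by blast
    then have "(\<lambda>z. int (n k) * \<theta> (delta (k, \<one>)) z) \<in> ?K"
      by (subst (asm) endo_scale [OF \<theta>]) (use that in auto)
    then show ?thesis using relationsD(2) [of _ I n "(l, x)"] by fastforce
  qed
  define B where "B = {k \<in> I. n k = 0}"
  have B: "B \<subseteq> I" by (auto simp: B_def)
  have torsion: "restr B (\<theta> f) = 0" if f: "f \<in> ?V" "restr B f = 0" for f
  proof
    fix z :: "'i \<times> 'a"
    have "0 dvd \<theta> f (l, x)" if "l \<in> B" for l x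
    proof (rule endo_dvd_coordinate [OF \<theta> f(1)])
      fix k y assume k: "k \<in> I" "\<exists>y. f (k, y) \<noteq> 0"
      then have "k \<notin> B" using fun_cong [OF f(2), of "(k, _)"] by (auto simp: restr_def)
      then show "0 dvd \<theta> (delta (k, \<one>)) (l, y)"
        using relation [OF k(1), of l y] that k(1) by (auto simp: B_def)
    qed
    then show "restr B (\<theta> f) z = 0 z" by (cases z) (auto simp: restr_def)
  qed
  have free_part: "restr B (\<theta> f) = restr B (\<theta> (restr B f))" if f: "f \<in> ?V" for f
  proof -
    have "restr B (\<theta> (f - restr B f)) = 0"
      by (rule torsion) (use f restr_compl in auto)
    then show ?thesis
      using f by (simp add: endo_diff [OF \<theta>] restr_diff)
  qed
  have K_B: "restr B f = 0" if "f \<in> ?K" for f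
  proof
    fix z :: "'i \<times> 'a"
    show "restr B f z = 0 z" using relationsD(2) [OF that, of z] by (auto simp: restr_def B_def)
  qed
  have inj_B: "restr B f = 0" if f: "f \<in> ?V" "restr B (\<theta> f) = 0" for f
  proof (rule integral_endo_surj_imp_inj [of B])
    show "finite B" using fin0 by (simp add: B_def)
    show "module_endo B (\<lambda>f. restr B (\<theta> f))" by (rule endo_restr [OF \<theta> B])
    show "restr B f \<in> free_module B" by (rule free_module_restr_subset [OF f(1) B])
    show "restr B (\<theta> (restr B f)) = 0" using free_part [OF f(1)] f(2) by simp
    fix h :: "'i \<times> 'a \<Rightarrow> int" assume h: "h \<in> free_module B"
    then obtain f where f: "f \<in> ?V" "h - \<theta> f \<in> ?K"
      using surj free_module_mono [OF B] by blast
    have "restr B h - restr B (\<theta> f) = 0" using K_B [OF f(2)] by (simp only: restr_diff)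
    then have "restr B (\<theta> (restr B f)) = h"
      using free_part [OF f(1)] restr_free_module [OF h] by simp
    then show "\<exists>f\<in>free_module B. restr B (\<theta> f) = h"
      using free_module_restr_subset [OF f(1) B] by blast
  qed
  have f0B: "restr B f0 = 0" by (rule inj_B [OF f0(1) K_B [OF f0(2)]])
  have p_part: "int (n k) dvd f0 (k, x)" if p: "prime p" and k: "k \<in> I" "1 \<le> i" "n k = p ^ i" for p k i x
  proof -
    define J where "J = {k \<in> I. \<exists>e\<ge>1. n k = p ^ e}"
    have J: "J \<subseteq> I" by (auto simp: J_def)
    have "\<exists>e. \<forall>k\<in>J. 1 \<le> e k \<and> n k = p ^ e k"
      by (rule bchoice) (auto simp: J_def)
    then obtain e where e: "\<And>k. k \<in> J \<Longrightarrow> 1 \<le> e k" "\<And>k. k \<in> J \<Longrightarrow> n k = p ^ e k" by blast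
    have "{k \<in> J. e k = j} = {k \<in> I. n k = p ^ j}" if "1 \<le> j" for j
    proof (intro equalityI subsetI)
      fix k assume "k \<in> {k \<in> I. n k = p ^ j}"
      moreover from this have "k \<in> J" using that by (auto simp: J_def)
      ultimately have "p ^ e k = p ^ j" using e(2) by simp
      then have "e k = j" using power_inject_exp [OF prime_gt_1_nat [OF p]] by blast
      then show "k \<in> {k \<in> J. e k = j}" using \<open>k \<in> J\<close> by simp
    next
      fix k assume "k \<in> {k \<in> J. e k = j}"
      then show "k \<in> {k \<in> I. n k = p ^ j}" using e(2) [of k] J by blast
    qed
    then have "directly_finite_mod (int p) {k \<in> J. e k = j}" if "1 \<le> j" for j using df [OF p that] that by simp
    moreover have "finite J" using fin [OF p] by (simp add: J_def)
    ultimately have hopf: "hopfian_mod J (\<lambda>k. p ^ e k)" using e(1) by (intro hopfian_mod_prime_power [OF p])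
    let ?KJ = "relations J (\<lambda>k. p ^ e k)"
    have KJ: "restr J f \<in> ?KJ" if f: "f \<in> ?K" for f
    proof -
      have "int (p ^ e (fst z)) dvd restr J f z" for z
        using relationsD(2) [OF f, of z] e(2) [of "fst z"] by (auto simp: restr_def)
      then show ?thesis
        using free_module_restr_subset [OF relationsD(1) [OF f] J] by (simp add: relations_def)
    qed
    have KJ': "f \<in> ?K" if f: "f \<in> ?KJ" for f
    proof -
      have "int (n (fst z)) dvd f z" for z
        using relationsD(2) [OF f, of z] e free_module_outside_fst [OF relationsD(1) [OF f], of z]
        by (cases "fst z \<in> J") (auto simp: mem_Times_iff)
      then show ?thesis using free_module_mono [OF J relationsD(1) [OF f]] by (simp add: relations_def)
    qed
    have other: "restr J (\<theta> f) \<in> ?KJ" if f: "f \<in> ?V" "restr B f = 0" "restr J f = 0" for f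
    proof -
      have "int p ^ e l dvd \<theta> f (l, x)" if l: "l \<in> J" for l x
      proof (rule endo_dvd_coordinate [OF \<theta> f(1)])
        fix k y assume k: "k \<in> I" "\<exists>y. f (k, y) \<noteq> 0"
        then have kBJ: "k \<notin> B" "k \<notin> J"
          using fun_cong [OF f(2), of "(k, _)"] fun_cong [OF f(3), of "(k, _)"] by (auto simp: restr_def)
        then obtain q j where q: "prime q" "1 \<le> j" "n k = q ^ j"
          using n [OF k(1)] k(1) by (auto simp: B_def)
        then have "q \<noteq> p" using kBJ(2) k(1) by (auto simp: J_def)
        then have "coprime (p ^ e l) (q ^ j)" using p q(1) by (simp add: primes_coprime)
        then have "coprime (int p ^ e l) (int q ^ j)" by (metis coprime_int_iff of_nat_power)
        moreover have "int p ^ e l dvd int q ^ j * \<theta> (delta (k, \<one>)) (l, y)"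
          using relation [OF k(1), of l y] q(3) e(2) [OF l] by simp
        ultimately show "int p ^ e l dvd \<theta> (delta (k, \<one>)) (l, y)"
          by (simp add: coprime_dvd_mult_right_iff)
      qed
      then have "int p ^ e (fst z) dvd restr J (\<theta> f) z" for z by (cases z) (auto simp: restr_def)
      then show ?thesis
        using free_module_restr_subset [OF endo_closed [OF \<theta> f(1)] J] by (simp add: relations_def)
    qed
    have block: "restr J (\<theta> f) - restr J (\<theta> (restr J f)) \<in> ?KJ" if f: "f \<in> ?V" "restr B f = 0" for f
    proof -
      have "restr B (restr J f) = restr J (restr B f)" by (auto simp: restr_def)
      then have "restr B (restr J f) = 0" by (simp add: f(2))
      then have "restr J (\<theta> (f - restr J f)) \<in> ?KJ"
        using f restr_compl by (intro other) (auto simp: restr_diff)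
      then show ?thesis using f by (simp add: endo_diff [OF \<theta>] restr_diff)
    qed
    have "restr J f0 \<in> ?KJ"
    proof (rule hopf [unfolded hopfian_mod_def, rule_format, of "\<lambda>f. restr J (\<theta> f)"])
      show "module_endo J (\<lambda>f. restr J (\<theta> f))" by (rule endo_restr [OF \<theta> J])
      show "restr J (\<theta> f) \<in> ?KJ" if "f \<in> ?KJ" for f using KJ KJ' \<theta>K that by blast
      show "restr J f0 \<in> free_module J" by (rule free_module_restr_subset [OF f0(1) J])
      have "restr J (\<theta> f0) - (restr J (\<theta> f0) - restr J (\<theta> (restr J f0))) \<in> ?KJ"
        by (rule relations_diff [OF KJ [OF f0(2)] block [OF f0(1) f0B]])
      then show "restr J (\<theta> (restr J f0)) \<in> ?KJ" by simp
      fix h :: "'i \<times> 'a \<Rightarrow> int" assume h: "h \<in> free_module J"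
      then obtain f where f: "f \<in> ?V" "h - \<theta> f \<in> ?K"
        using surj free_module_mono [OF J] by blast
      have BJ: "k \<in> B \<Longrightarrow> k \<notin> J" for k using p by (auto simp: B_def J_def)
      have "restr B h = 0"
      proof
        fix z :: "'i \<times> 'a"
        show "restr B h z = 0 z"
          using free_module_outside_fst [OF h, of z] BJ by (auto simp: restr_def)
      qed
      then have "restr B (\<theta> f) = 0" using K_B [OF f(2)] by (simp add: restr_diff)
      then have fB: "restr B f = 0" by (rule inj_B [OF f(1)])
      have "restr J (h - \<theta> f) + (restr J (\<theta> f) - restr J (\<theta> (restr J f))) \<in> ?KJ"
        by (rule relations_add [OF KJ [OF f(2)] block [OF f(1) fB]])
      moreover have "restr J (h - \<theta> f) + (restr J (\<theta> f) - restr J (\<theta> (restr J f))) = h - restr J (\<theta> (restr J f))"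
        by (simp add: restr_diff restr_free_module [OF h])
      ultimately show "\<exists>f\<in>free_module J. h - restr J (\<theta> f) \<in> ?KJ"
        using free_module_restr_subset [OF f(1) J] by auto
    qed
    then have "int (p ^ e k) dvd restr J f0 (k, x)" using relationsD(2) [of "restr J f0" J "\<lambda>k. p ^ e k" "(k, x)"] by simp
    moreover have "k \<in> J" using k by (auto simp: J_def)
    ultimately show ?thesis using e by (simp add: restr_def)
  qed
  have "int (n (fst z)) dvd f0 z" for z
  proof (cases "fst z \<in> I")
    case True
    then consider "n (fst z) = 0" | "\<exists>p i. prime p \<and> 1 \<le> i \<and> n (fst z) = p ^ i"
      using n [of "fst z"] by meson
    then show ?thesis
    proof cases
      case 1 then show ?thesis using fun_cong [OF f0B, of z] True by (simp add: restr_def B_def)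
    next
      case 2 then show ?thesis using p_part [of _ "fst z" _ "snd z"] True by auto
    qed
  next
    case False
    then show ?thesis using free_module_outside_fst [OF f0(1), of z] by (auto simp: mem_Times_iff)
  qed
  then show "f0 \<in> ?K" using f0(1) by (simp add: relations_def)
qed

text \<open>
  Let \<open>\<theta>\<rho>\<close> be the identity modulo \<open>p\<close> on the block of order \<open>p ^ i\<close>, and extend \<open>\<theta>\<close> by the identity
  on the other coordinates. Successive approximation modulo powers of \<open>p\<close> shows that this extension
  is surjective modulo the relations, so it is injective modulo the relations. Multiplication by
  \<open>p ^ (i - 1)\<close> identifies the reduction modulo \<open>p\<close> of the block with the elements that \<open>p\<close> kills,
  and hence \<open>\<theta>\<close> is injective modulo \<open>p\<close>. Apply this to \<open>\<rho>\<theta> f - f\<close>.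
\<close>

theorem directly_finite_mod_of_hopfian_mod:
  fixes n :: "'i \<Rightarrow> nat"
  assumes hopf: "hopfian_mod I n" and p: "prime p" and i: "1 \<le> i"
  shows "directly_finite_mod (int p) {k \<in> I. n k = p ^ i}"
  unfolding directly_finite_mod_def
proof (intro allI impI ballI)
  let ?J = "{k \<in> I. n k = p ^ i}"
  let ?V = "free_module I" and ?K = "relations I n" and ?W = "free_module ?J"
  fix \<theta> \<rho> :: "('i \<times> 'a \<Rightarrow> int) \<Rightarrow> 'i \<times> 'a \<Rightarrow> int" and f0
  assume \<theta>: "module_endo ?J \<theta>" and \<rho>: "module_endo ?J \<rho>"
    and sec: "\<forall>f\<in>?W. cong_mod (int p) (\<theta> (\<rho> f)) f" and f0: "f0 \<in> ?W"
  note [simp del] = split_paired_All split_paired_Ex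
  have J: "?J \<subseteq> I" by auto
  have p0: "int p \<noteq> 0" using p by auto
  define \<theta>' where "\<theta>' = (\<lambda>f. \<theta> (restr ?J f) + restr (- ?J) f)"
  have W: "restr ?J f \<in> ?W" if "f \<in> ?V" for f by (rule free_module_restr_subset [OF that J])
  have split: "restr ?J f + restr (- ?J) f = f" for f :: "'i \<times> 'a \<Rightarrow> int"
    by (auto simp: restr_def)
  have \<theta>': "module_endo I \<theta>'"
    unfolding module_endo_def \<theta>'_def
  proof (intro conjI ballI)
    fix f h assume f: "f \<in> ?V" and h: "h \<in> ?V"
    show "\<theta> (restr ?J (f + h)) + restr (- ?J) (f + h)
      = \<theta> (restr ?J f) + restr (- ?J) f + (\<theta> (restr ?J h) + restr (- ?J) h)"
      by (simp only: restr_add endo_add [OF \<theta> W [OF f] W [OF h]] add_ac)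
  next
    fix f assume f: "f \<in> ?V"
    show "\<theta> (restr ?J f) + restr (- ?J) f \<in> ?V"
      using f free_module_mono [OF J endo_closed [OF \<theta> W [OF f]]] by (intro free_module_add) auto
    fix g assume g: "g \<in> carrier G"
    show "\<theta> (restr ?J (shift g f)) + restr (- ?J) (shift g f)
       = shift g (\<theta> (restr ?J f) + restr (- ?J) f)"
      by (simp only: shift_add shift_restr [symmetric] endo_shift [OF \<theta> W [OF f] g])
  qed
  have \<theta>'W: "\<theta>' f = \<theta> f" if "f \<in> ?W" for f
  proof -
    have "restr (- ?J) f = 0" using free_module_outside [OF that] by (auto simp: restr_def fun_eq_iff)
    then show ?thesis by (simp add: \<theta>'_def restr_free_module [OF that])
  qed
  have lift: "\<exists>f\<in>?W. \<forall>z. int p ^ j dvd h z - \<theta> f z" if h: "h \<in> ?W" for h j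
  proof (induction j)
    case 0
    have "(0 :: 'i \<times> 'a \<Rightarrow> int) \<in> ?W" by simp
    then show ?case by (intro bexI [of _ 0]) auto
  next
    case (Suc j)
    then obtain f where f: "f \<in> ?W" "\<And>z. int p ^ j dvd h z - \<theta> f z" by blast
    define u where "u = (\<lambda>z. (h - \<theta> f) z div int p ^ j)"
    have u: "u \<in> ?W" unfolding u_def by (intro free_module_div free_module_diff endo_closed [OF \<theta>] h f)
    have hu: "h z - \<theta> f z = int p ^ j * u z" for z using f(2) [of z] by (simp add: u_def)
    have "int p ^ Suc j dvd h z - \<theta> (f + (\<lambda>z. int p ^ j * \<rho> u z)) z" for z
    proof -
      have "\<theta> (f + (\<lambda>z. int p ^ j * \<rho> u z)) = \<theta> f + (\<lambda>z. int p ^ j * \<theta> (\<rho> u) z)"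
        using f u endo_closed [OF \<rho>] by (simp only: endo_add [OF \<theta>] endo_scale [OF \<theta>] free_module_scale)
      then have "h z - \<theta> (f + (\<lambda>z. int p ^ j * \<rho> u z)) z = int p ^ j * (u z - \<theta> (\<rho> u) z)"
        using hu [of z] by (simp add: algebra_simps)
      moreover have "int p dvd u z - \<theta> (\<rho> u) z" using sec u by (auto simp: cong_mod_def dvd_diff_commute)
      ultimately show ?thesis by (simp add: mult_dvd_mono mult.commute)
    qed
    moreover have "f + (\<lambda>z. int p ^ j * \<rho> u z) \<in> ?W" using f u endo_closed [OF \<rho>] by simp
    ultimately show ?case by blast
  qed
  have inj: "cong_mod (int p) f 0" if f: "f \<in> ?W" "cong_mod (int p) (\<theta> f) 0" for f
  proof -
    define g where "g = (\<lambda>z. int p ^ (i - 1) * f z)"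
    have gW: "g \<in> ?W" using f by (simp add: g_def)
    have pi: "int p ^ i = int p ^ (i - 1) * int p" using i power_minus_mult [of i "int p"] by simp
    have "\<theta>' g = (\<lambda>z. int p ^ (i - 1) * \<theta> f z)"
      using \<theta>'W [OF gW] endo_scale [OF \<theta> f(1)] by (simp add: g_def)
    moreover have "(\<lambda>z. int p ^ (i - 1) * \<theta> f z) \<in> ?K"
    proof -
      have "int (n (fst z)) dvd int p ^ (i - 1) * \<theta> f z" for z
      proof (cases "fst z \<in> ?J")
        case True
        then have "int (n (fst z)) = int p ^ (i - 1) * int p" using pi by simp
        then show ?thesis using f(2) by (auto simp: cong_mod_zero intro: mult_dvd_mono)
      next
        case False
        then show ?thesis using free_module_outside_fst [OF endo_closed [OF \<theta> f(1)], of z]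
          by (simp add: mem_Times_iff)
      qed
      then show ?thesis
        using free_module_mono [OF J endo_closed [OF \<theta> f(1)]] by (simp add: relations_def)
    qed
    ultimately have \<theta>'g: "\<theta>' g \<in> ?K" by simp
    have gK: "g \<in> ?K"
    proof (rule hopf [unfolded hopfian_mod_def, rule_format, OF \<theta>' _ _ free_module_mono [OF J gW] \<theta>'g])
      fix f assume f: "f \<in> ?K"
      have "int (p ^ i) dvd \<theta> (restr ?J f) z" for z
      proof (rule endo_dvd [OF \<theta> W [OF relationsD(1) [OF f]]])
        show "int (p ^ i) dvd restr ?J f z" for z
          using relationsD(2) [OF f, of z] by (auto simp: restr_def)
      qed
      then have "int (n (fst z)) dvd \<theta>' f z" for z
        using relationsD(2) [OF f, of z] free_module_outside [OF endo_closed [OF \<theta> W [OF relationsD(1) [OF f]]], of z]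
        by (cases "fst z \<in> ?J") (auto simp: \<theta>'_def restr_def mem_Times_iff)
      then show "\<theta>' f \<in> ?K" using endo_closed [OF \<theta>' relationsD(1) [OF f]] by (simp add: relations_def)
    next
      fix h assume h: "h \<in> ?V"
      obtain f where f: "f \<in> ?W" "\<And>z. int p ^ i dvd restr ?J h z - \<theta> f z"
        using lift [OF W [OF h]] by blast
      have f': "f + restr (- ?J) h \<in> ?V" using free_module_mono [OF J f(1)] h by simp
      have "restr ?J (f + restr (- ?J) h) = f" "restr (- ?J) (f + restr (- ?J) h) = restr (- ?J) h"
        using free_module_outside [OF f(1)] by (auto simp: restr_def fun_eq_iff)
      then have "\<theta>' (f + restr (- ?J) h) = \<theta> f + restr (- ?J) h" by (simp only: \<theta>'_def)
      then have "h - \<theta>' (f + restr (- ?J) h) = restr ?J h - \<theta> f"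
        using split [of h] by (simp add: algebra_simps)
      moreover have "int (n (fst z)) dvd (restr ?J h - \<theta> f) z" for z
        using f(2) [of z] free_module_outside_fst [OF endo_closed [OF \<theta> f(1)], of z]
        by (cases "fst z \<in> ?J") (auto simp: restr_def mem_Times_iff)
      then have "restr ?J h - \<theta> f \<in> ?K"
        using h free_module_mono [OF J endo_closed [OF \<theta> f(1)]]
        unfolding relations_def by (intro CollectI conjI allI free_module_diff) auto
      ultimately show "\<exists>f\<in>?V. h - \<theta>' f \<in> ?K" using f' by (metis (no_types))
    qed
    have "int p dvd f z" for z
    proof (cases "fst z \<in> ?J")
      case True
      then have "int p ^ (i - 1) * int p dvd int p ^ (i - 1) * f z"
        using relationsD(2) [OF gK, of z] pi by (simp add: g_def)
      then show ?thesis using p0 by simp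
    next
      case False
      then show ?thesis using free_module_outside_fst [OF f(1), of z] by (simp add: mem_Times_iff)
    qed
    then show ?thesis by (simp add: cong_mod_zero)
  qed
  have V: "\<theta> f0 \<in> ?W" "\<rho> (\<theta> f0) \<in> ?W" using f0 endo_closed [OF \<theta>] endo_closed [OF \<rho>] by auto
  have "cong_mod (int p) (\<rho> (\<theta> f0) - f0) 0"
  proof (rule inj)
    show "\<rho> (\<theta> f0) - f0 \<in> ?W" by (intro free_module_diff V f0)
    have "cong_mod (int p) (\<theta> (\<rho> (\<theta> f0))) (\<theta> f0)" using sec V by blast
    then show "cong_mod (int p) (\<theta> (\<rho> (\<theta> f0) - f0)) 0"
      by (simp add: endo_diff [OF \<theta> V(2) f0] cong_mod_def)
  qed
  then show "cong_mod (int p) (\<rho> (\<theta> f0)) f0" by (simp add: cong_mod_def)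
qed

end

section \<open>Surjective endomorphisms of wreath products\<close>

locale abelian_wreath = A: comm_group A + G: group G
  for A :: "'a monoid" and G :: "'g monoid"
begin

abbreviation N :: "('g \<Rightarrow> 'a) monoid" where "N \<equiv> sum_group (carrier G) (\<lambda>_. A)"
abbreviation W :: "(('g \<Rightarrow> 'a) \<times> 'g) monoid" where "W \<equiv> wreath_product A G"

definition act :: "'g \<Rightarrow> ('g \<Rightarrow> 'a) \<Rightarrow> 'g \<Rightarrow> 'a" where
  "act g f = (\<lambda>x\<in>carrier G. f (inv\<^bsub>G\<^esub> g \<otimes>\<^bsub>G\<^esub> x))"

definition single :: "'a \<Rightarrow> 'g \<Rightarrow> 'a" where
  "single a = (\<lambda>x\<in>carrier G. if x = \<one>\<^bsub>G\<^esub> then a else \<one>\<^bsub>A\<^esub>)"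

text \<open>
  The Hopf property of the base group as a module over the integral group ring of \<open>G\<close>.
\<close>

definition base_hopfian :: bool where
  "base_hopfian \<longleftrightarrow> (\<forall>\<psi>\<in>hom N N. (\<forall>g\<in>carrier G. \<forall>f\<in>carrier N. \<psi> (act g f) = act g (\<psi> f)) \<longrightarrow>
     \<psi> ` carrier N = carrier N \<longrightarrow> inj_on \<psi> (carrier N))"

lemma carrier_N: "f \<in> carrier N \<longleftrightarrow>
    f \<in> carrier G \<rightarrow>\<^sub>E carrier A \<and> finite {x \<in> carrier G. f x \<noteq> \<one>\<^bsub>A\<^esub>}"
  by (subst carrier_sum_group) (auto simp: A.is_group)

lemma N_group: "group N"
  by (simp add: A.is_group)

lemma N_value [simp]: "f \<in> carrier N \<Longrightarrow> x \<in> carrier G \<Longrightarrow> f x \<in> carrier A"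
  unfolding carrier_N by blast

lemma N_ext:
  assumes "f \<in> carrier N" "h \<in> carrier N" "\<And>x. x \<in> carrier G \<Longrightarrow> f x = h x"
  shows "f = h"
proof (rule PiE_ext [of f "carrier G" "\<lambda>_. carrier A" h])
  show "f \<in> carrier G \<rightarrow>\<^sub>E carrier A" "h \<in> carrier G \<rightarrow>\<^sub>E carrier A"
    using assms(1,2) unfolding carrier_N by blast+
qed (rule assms(3))

lemma N_mult [simp]: "x \<in> carrier G \<Longrightarrow> (f \<otimes>\<^bsub>N\<^esub> h) x = f x \<otimes>\<^bsub>A\<^esub> h x"
  and N_one [simp]: "x \<in> carrier G \<Longrightarrow> \<one>\<^bsub>N\<^esub> x = \<one>\<^bsub>A\<^esub>"
  by simp_all

lemma N_inv [simp]: "f \<in> carrier N \<Longrightarrow> x \<in> carrier G \<Longrightarrow> (inv\<^bsub>N\<^esub> f) x = inv\<^bsub>A\<^esub> f x"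
  by (subst inv_sum_group) (auto simp: A.is_group)

sublocale N: comm_group N
proof -
  interpret N: group N by (rule N_group)
  show "comm_group N"
    by (rule N.group_comm_groupI) (rule N_ext, auto simp del: mult_sum_group intro: A.m_comm)
qed

declare mult_sum_group [simp del] one_sum_group [simp del] inv_sum_group [simp del]

lemma N_closedI:
  assumes "finite S" "\<And>x. x \<in> carrier G \<Longrightarrow> f x \<in> carrier A"
    and "\<And>x. x \<in> carrier G \<Longrightarrow> x \<notin> S \<Longrightarrow> f x = \<one>\<^bsub>A\<^esub>" "f \<in> extensional (carrier G)"
  shows "f \<in> carrier N"
proof -
  have "{x \<in> carrier G. f x \<noteq> \<one>\<^bsub>A\<^esub>} \<subseteq> S" using assms(3) by blast
  then have "finite {x \<in> carrier G. f x \<noteq> \<one>\<^bsub>A\<^esub>}" by (rule finite_subset [OF _ assms(1)])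
  then show ?thesis using assms(2,4) unfolding carrier_N PiE_def by blast
qed

lemma act_apply [simp]: "x \<in> carrier G \<Longrightarrow> act g f x = f (inv\<^bsub>G\<^esub> g \<otimes>\<^bsub>G\<^esub> x)"
  by (simp add: act_def)

lemma act_closed [simp]:
  assumes "f \<in> carrier N" "g \<in> carrier G" shows "act g f \<in> carrier N"
proof (rule N_closedI)
  show "finite ((\<lambda>x. g \<otimes>\<^bsub>G\<^esub> x) ` {x \<in> carrier G. f x \<noteq> \<one>\<^bsub>A\<^esub>})"
    using assms(1) unfolding carrier_N by blast
  fix x assume x: "x \<in> carrier G"
  then show "act g f x \<in> carrier A" using assms by simp
  assume *: "x \<notin> (\<lambda>x. g \<otimes>\<^bsub>G\<^esub> x) ` {x \<in> carrier G. f x \<noteq> \<one>\<^bsub>A\<^esub>}"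
  have "x = g \<otimes>\<^bsub>G\<^esub> (inv\<^bsub>G\<^esub> g \<otimes>\<^bsub>G\<^esub> x)" using assms x by (simp add: G.m_assoc [symmetric])
  then have "inv\<^bsub>G\<^esub> g \<otimes>\<^bsub>G\<^esub> x \<notin> {x \<in> carrier G. f x \<noteq> \<one>\<^bsub>A\<^esub>}" using * by blast
  then show "act g f x = \<one>\<^bsub>A\<^esub>" using x assms(2) by simp
qed (simp add: act_def)

lemma act_mult: "f \<in> carrier N \<Longrightarrow> h \<in> carrier N \<Longrightarrow> g \<in> carrier G \<Longrightarrow>
    act g (f \<otimes>\<^bsub>N\<^esub> h) = act g f \<otimes>\<^bsub>N\<^esub> act g h"
  by (rule N_ext) auto

lemma act_one [simp]: "f \<in> carrier N \<Longrightarrow> act \<one>\<^bsub>G\<^esub> f = f"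
  by (rule N_ext) auto

lemma act_act: "f \<in> carrier N \<Longrightarrow> g \<in> carrier G \<Longrightarrow> h \<in> carrier G \<Longrightarrow>
    act g (act h f) = act (g \<otimes>\<^bsub>G\<^esub> h) f"
  by (rule N_ext) (auto simp: G.inv_mult_group G.m_assoc)

lemma act_N_one [simp]: "g \<in> carrier G \<Longrightarrow> act g \<one>\<^bsub>N\<^esub> = \<one>\<^bsub>N\<^esub>"
  by (rule N_ext) auto

lemma single_closed [simp]: "a \<in> carrier A \<Longrightarrow> single a \<in> carrier N"
  by (rule N_closedI [of "{\<one>\<^bsub>G\<^esub>}"]) (auto simp: single_def)

lemma single_apply: "x \<in> carrier G \<Longrightarrow> single a x = (if x = \<one>\<^bsub>G\<^esub> then a else \<one>\<^bsub>A\<^esub>)"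
  by (simp add: single_def)

lemma carrier_W: "carrier W = carrier N \<times> carrier G"
  by (simp add: wreath_product_def semidirect_product_def)

lemma mult_W [simp]: "(f, g) \<otimes>\<^bsub>W\<^esub> (h, k) = (f \<otimes>\<^bsub>N\<^esub> act g h, g \<otimes>\<^bsub>G\<^esub> k)"
  by (simp add: wreath_product_def semidirect_product_def act_def)

lemma one_W: "\<one>\<^bsub>W\<^esub> = (\<one>\<^bsub>N\<^esub>, \<one>\<^bsub>G\<^esub>)"
  by (simp add: wreath_product_def semidirect_product_def)

lemma W_closed [simp]: "(f, g) \<in> carrier W \<longleftrightarrow> f \<in> carrier N \<and> g \<in> carrier G"
  by (simp add: carrier_W)

sublocale W: group W
proof (rule groupI)
  show "\<one>\<^bsub>W\<^esub> \<in> carrier W" by (simp add: one_W)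
  fix u assume u: "u \<in> carrier W"
  obtain f g where [simp]: "u = (f, g)" by (cases u)
  have fg: "f \<in> carrier N" "g \<in> carrier G" using u by auto
  show "\<one>\<^bsub>W\<^esub> \<otimes>\<^bsub>W\<^esub> u = u" using fg by (simp add: one_W)
  show "\<exists>v\<in>carrier W. v \<otimes>\<^bsub>W\<^esub> u = \<one>\<^bsub>W\<^esub>"
    using fg by (intro bexI [of _ "(inv\<^bsub>N\<^esub> (act (inv\<^bsub>G\<^esub> g) f), inv\<^bsub>G\<^esub> g)"]) (auto simp: one_W)
  fix v assume v: "v \<in> carrier W"
  obtain h k where [simp]: "v = (h, k)" by (cases v)
  have hk: "h \<in> carrier N" "k \<in> carrier G" using v by auto
  show "u \<otimes>\<^bsub>W\<^esub> v \<in> carrier W" using fg hk by simp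
  fix w assume w: "w \<in> carrier W"
  then show "u \<otimes>\<^bsub>W\<^esub> v \<otimes>\<^bsub>W\<^esub> w = u \<otimes>\<^bsub>W\<^esub> (v \<otimes>\<^bsub>W\<^esub> w)"
    using fg hk by (cases w) (auto simp: N.m_assoc G.m_assoc act_mult act_act)
qed

lemma snd_mult: "snd (u \<otimes>\<^bsub>W\<^esub> v) = snd u \<otimes>\<^bsub>G\<^esub> snd v"
  by (cases u; cases v) simp

lemma snd_closed [simp]: "u \<in> carrier W \<Longrightarrow> snd u \<in> carrier G"
  and fst_closed [simp]: "u \<in> carrier W \<Longrightarrow> fst u \<in> carrier N"
  by (auto simp: carrier_W)

lemma snd_inv: "u \<in> carrier W \<Longrightarrow> snd (inv\<^bsub>W\<^esub> u) = inv\<^bsub>G\<^esub> snd u"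
  by (rule G.inv_equality [symmetric]) (auto simp: snd_mult [symmetric] one_W)

lemma act_conj:
  "f \<in> carrier N \<Longrightarrow> g \<in> carrier G \<Longrightarrow>
    (act g f, \<one>\<^bsub>G\<^esub>) \<otimes>\<^bsub>W\<^esub> (\<one>\<^bsub>N\<^esub>, g) = (\<one>\<^bsub>N\<^esub>, g) \<otimes>\<^bsub>W\<^esub> (f, \<one>\<^bsub>G\<^esub>)"
  by simp

lemma G_cancel:
  "g \<in> carrier G \<Longrightarrow> h \<in> carrier G \<Longrightarrow> g \<otimes>\<^bsub>G\<^esub> (inv\<^bsub>G\<^esub> g \<otimes>\<^bsub>G\<^esub> h) = h"
  "g \<in> carrier G \<Longrightarrow> h \<in> carrier G \<Longrightarrow> inv\<^bsub>G\<^esub> g \<otimes>\<^bsub>G\<^esub> (g \<otimes>\<^bsub>G\<^esub> h) = h"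
  by (simp_all add: G.m_assoc [symmetric])

lemma hopfian_base:
  assumes "hopfian W" shows base_hopfian
  unfolding base_hopfian_def
proof (intro ballI impI)
  fix \<psi> assume \<psi>: "\<psi> \<in> hom N N" and eq: "\<forall>g\<in>carrier G. \<forall>f\<in>carrier N. \<psi> (act g f) = act g (\<psi> f)"
    and surj: "\<psi> ` carrier N = carrier N"
  define \<phi> where "\<phi> = (\<lambda>(f, g::'g). (\<psi> f, g))"
  have "\<phi> \<in> hom W W"
    using eq hom_in_carrier [OF \<psi>] hom_mult [OF \<psi>]
    by (auto simp: hom_def \<phi>_def carrier_W Pi_iff)
  moreover have "\<phi> ` carrier W = carrier W"
    unfolding carrier_W \<phi>_def using surj by (force simp: image_iff set_eq_iff)
  ultimately have "\<phi> \<in> iso W W" using assms unfolding hopfian_def by blast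
  then have inj: "inj_on \<phi> (carrier W)" by (simp add: iso_def bij_betw_def)
  show "inj_on \<psi> (carrier N)"
  proof (rule inj_onI)
    fix f h assume "f \<in> carrier N" "h \<in> carrier N" "\<psi> f = \<psi> h"
    then show "f = h" using inj_onD [OF inj, of "(f, \<one>\<^bsub>G\<^esub>)" "(h, \<one>\<^bsub>G\<^esub>)"] by (simp add: \<phi>_def)
  qed
qed

text \<open>
  The homomorphism of base groups induced by \<open>\<alpha>\<close>: it multiplies the values along the fibres of \<open>\<alpha>\<close>.
\<close>

definition push :: "('g \<Rightarrow> 'g) \<Rightarrow> ('g \<Rightarrow> 'a) \<Rightarrow> 'g \<Rightarrow> 'a" where
  "push \<alpha> f = (\<lambda>x\<in>carrier G. finprod A f {y \<in> carrier G. f y \<noteq> \<one>\<^bsub>A\<^esub> \<and> \<alpha> y = x})"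

lemma push_apply:
  assumes f: "f \<in> carrier N" and x: "x \<in> carrier G" and S: "finite S" "S \<subseteq> carrier G"
    and supp: "\<And>y. y \<in> carrier G \<Longrightarrow> f y \<noteq> \<one>\<^bsub>A\<^esub> \<Longrightarrow> \<alpha> y = x \<Longrightarrow> y \<in> S"
  shows "push \<alpha> f x = finprod A f {y \<in> S. \<alpha> y = x}"
  unfolding push_def using x S supp f
  by simp (rule A.finprod_mono_neutral_cong_left, auto)

text \<open>
  A surjective endomorphism \<open>\<alpha>\<close> of \<open>G\<close> extends to the wreath product, acting on the base by \<open>push \<alpha>\<close>.
  The extension is surjective because functions can be moved along a section of \<open>\<alpha>\<close>.
\<close>

lemma hopfian_top:
  assumes "hopfian W" shows "hopfian G"
  unfolding hopfian_def
proof (intro conjI G.is_group ballI impI)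
  fix \<alpha> assume \<alpha>: "\<alpha> \<in> hom G G" and surj: "\<alpha> ` carrier G = carrier G"
  interpret \<alpha>: group_hom G G \<alpha> by unfold_locales (rule \<alpha>)
  define supp where "supp = (\<lambda>f. {y \<in> carrier G. f y \<noteq> \<one>\<^bsub>A\<^esub>})"
  have supp: "finite (supp f)" "supp f \<subseteq> carrier G" if "f \<in> carrier N" for f
    using that unfolding carrier_N supp_def by auto
  have closed: "push \<alpha> f \<in> carrier N" if f: "f \<in> carrier N" for f
  proof (rule N_closedI)
    show "finite (\<alpha> ` supp f)" using supp [OF f] by simp
    fix x assume x: "x \<in> carrier G"
    show "push \<alpha> f x \<in> carrier A"
      unfolding push_def restrict_apply'[OF x] using f by (intro A.finprod_closed) auto
    assume "x \<notin> \<alpha> ` supp f"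
    then have "{y \<in> carrier G. f y \<noteq> \<one>\<^bsub>A\<^esub> \<and> \<alpha> y = x} = {}" by (auto simp: supp_def)
    then show "push \<alpha> f x = \<one>\<^bsub>A\<^esub>" unfolding push_def restrict_apply' [OF x] by (simp only: A.finprod_empty)
  qed (simp add: push_def)
  have mult: "push \<alpha> (f \<otimes>\<^bsub>N\<^esub> h) = push \<alpha> f \<otimes>\<^bsub>N\<^esub> push \<alpha> h"
    if f: "f \<in> carrier N" and h: "h \<in> carrier N" for f h
  proof (rule N_ext)
    fix x assume x: "x \<in> carrier G"
    let ?S = "supp f \<union> supp h"
    have S: "finite ?S" "?S \<subseteq> carrier G" using supp f h by auto
    have fS: "push \<alpha> f x = finprod A f {y \<in> ?S. \<alpha> y = x}"
      by (rule push_apply [OF f x S]) (simp add: supp_def)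
    have hS: "push \<alpha> h x = finprod A h {y \<in> ?S. \<alpha> y = x}"
      by (rule push_apply [OF h x S]) (simp add: supp_def)
    have "push \<alpha> (f \<otimes>\<^bsub>N\<^esub> h) x = finprod A (f \<otimes>\<^bsub>N\<^esub> h) {y \<in> ?S. \<alpha> y = x}"
      by (rule push_apply [OF _ x S]) (use f h in \<open>auto simp: supp_def\<close>)
    also have "\<dots> = finprod A (\<lambda>y. f y \<otimes>\<^bsub>A\<^esub> h y) {y \<in> ?S. \<alpha> y = x}"
      using S f h by (intro A.finprod_cong') auto
    also have "\<dots> = push \<alpha> f x \<otimes>\<^bsub>A\<^esub> push \<alpha> h x"
      unfolding fS hS using S f h by (intro A.finprod_multf) auto
    finally show "push \<alpha> (f \<otimes>\<^bsub>N\<^esub> h) x = (push \<alpha> f \<otimes>\<^bsub>N\<^esub> push \<alpha> h) x" using x by simp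
  qed (use f h closed in auto)
  have equiv: "push \<alpha> (act g f) = act (\<alpha> g) (push \<alpha> f)" if f: "f \<in> carrier N" and g: "g \<in> carrier G" for f g
  proof (rule N_ext)
    fix x assume x: "x \<in> carrier G"
    let ?R = "{y \<in> supp f. \<alpha> y = inv\<^bsub>G\<^esub> \<alpha> g \<otimes>\<^bsub>G\<^esub> x}"
    have *: "{y \<in> (\<lambda>y. g \<otimes>\<^bsub>G\<^esub> y) ` supp f. \<alpha> y = x} = (\<lambda>y. g \<otimes>\<^bsub>G\<^esub> y) ` ?R"
      using g x supp(2) [OF f] by (auto simp: subset_iff G_cancel)
    have "push \<alpha> (act g f) x = finprod A (act g f) {y \<in> (\<lambda>y. g \<otimes>\<^bsub>G\<^esub> y) ` supp f. \<alpha> y = x}"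
    proof (rule push_apply [OF act_closed [OF f g] x])
      show "finite ((\<lambda>y. g \<otimes>\<^bsub>G\<^esub> y) ` supp f)" using supp [OF f] by simp
      show "(\<lambda>y. g \<otimes>\<^bsub>G\<^esub> y) ` supp f \<subseteq> carrier G" using g supp [OF f] by auto
      fix y assume y: "y \<in> carrier G" "act g f y \<noteq> \<one>\<^bsub>A\<^esub>"
      then have "inv\<^bsub>G\<^esub> g \<otimes>\<^bsub>G\<^esub> y \<in> supp f" using g by (simp add: supp_def)
      moreover have "y = g \<otimes>\<^bsub>G\<^esub> (inv\<^bsub>G\<^esub> g \<otimes>\<^bsub>G\<^esub> y)" using g y by (simp add: G.m_assoc [symmetric])
      ultimately show "y \<in> (\<lambda>y. g \<otimes>\<^bsub>G\<^esub> y) ` supp f" by blast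
    qed
    also have "\<dots> = finprod A (\<lambda>y. act g f (g \<otimes>\<^bsub>G\<^esub> y)) ?R"
      unfolding * using g f supp(2) [OF f]
      by (intro A.finprod_reindex) (auto simp: subset_iff inj_on_def simp del: act_apply)
    also have "\<dots> = finprod A f ?R"
      using g f supp(2) [OF f] by (intro A.finprod_cong') (auto simp: subset_iff G.m_assoc [symmetric])
    also have "\<dots> = push \<alpha> f (inv\<^bsub>G\<^esub> \<alpha> g \<otimes>\<^bsub>G\<^esub> x)"
      using g x f supp [OF f] by (intro push_apply [symmetric]) (auto simp: supp_def)
    finally show "push \<alpha> (act g f) x = act (\<alpha> g) (push \<alpha> f) x" using x by simp
  qed (use f g closed in auto)
  have push_surj: "\<exists>h\<in>carrier N. push \<alpha> h = f" if f: "f \<in> carrier N" for f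
  proof -
    define \<sigma> where "\<sigma> = inv_into (carrier G) \<alpha>"
    have \<sigma>: "\<sigma> x \<in> carrier G" "\<alpha> (\<sigma> x) = x" if "x \<in> carrier G" for x
      using that surj by (auto simp: \<sigma>_def inv_into_into f_inv_into_f)
    define h where "h = (\<lambda>y\<in>carrier G. if y = \<sigma> (\<alpha> y) then f (\<alpha> y) else \<one>\<^bsub>A\<^esub>)"
    have h: "h \<in> carrier N"
    proof (rule N_closedI)
      show "finite (\<sigma> ` supp f)" using supp [OF f] by simp
      fix y assume y: "y \<in> carrier G"
      show "h y \<in> carrier A" using y f by (simp add: h_def)
      assume "y \<notin> \<sigma> ` supp f"
      then show "h y = \<one>\<^bsub>A\<^esub>" using y by (auto simp: h_def supp_def)
    qed (simp add: h_def)
    have "push \<alpha> h = f"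
    proof (rule N_ext [OF closed [OF h] f])
      fix x assume x: "x \<in> carrier G"
      have "push \<alpha> h x = finprod A h {y \<in> {\<sigma> x}. \<alpha> y = x}"
      proof (rule push_apply [OF h x])
        fix y assume "y \<in> carrier G" "h y \<noteq> \<one>\<^bsub>A\<^esub>" "\<alpha> y = x"
        then show "y \<in> {\<sigma> x}" by (auto simp: h_def split: if_splits)
      qed (use \<sigma> x in auto)
      also have "{y \<in> {\<sigma> x}. \<alpha> y = x} = {\<sigma> x}" using \<sigma> x by auto
      also have "finprod A h {\<sigma> x} = h (\<sigma> x)" using h \<sigma> x by simp
      also have "\<dots> = f x" using \<sigma> x by (simp add: h_def)
      finally show "push \<alpha> h x = f x" .
    qed
    then show ?thesis using h by blast
  qed
  define \<phi> where "\<phi> = (\<lambda>(f, g). (push \<alpha> f, \<alpha> g))"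
  have "\<phi> \<in> hom W W"
    by (auto simp: hom_def \<phi>_def carrier_W Pi_iff closed mult equiv)
  moreover have "\<phi> ` carrier W = carrier W"
  proof (intro equalityI subsetI)
    fix u assume "u \<in> carrier W"
    then obtain f g where u: "u = (f, g)" "f \<in> carrier N" "g \<in> carrier G" by (auto simp: carrier_W)
    obtain h where h: "h \<in> carrier N" "push \<alpha> h = f" using push_surj [OF u(2)] by blast
    from u(3) have "g \<in> \<alpha> ` carrier G" by (simp only: surj)
    then obtain k where k: "k \<in> carrier G" "g = \<alpha> k" by (rule imageE)
    show "u \<in> \<phi> ` carrier W" using u h k by (intro image_eqI [of _ _ "(h, k)"]) (auto simp: \<phi>_def)
  qed (auto simp: \<phi>_def carrier_W closed)
  ultimately have "\<phi> \<in> iso W W" using assms unfolding hopfian_def by blast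
  then have inj: "inj_on \<phi> (carrier W)" by (simp add: iso_def bij_betw_def)
  have "inj_on \<alpha> (carrier G)"
  proof (rule inj_onI)
    fix g k assume "g \<in> carrier G" "k \<in> carrier G" "\<alpha> g = \<alpha> k"
    then show "g = k" using inj_onD [OF inj, of "(\<one>\<^bsub>N\<^esub>, g)" "(\<one>\<^bsub>N\<^esub>, k)"] by (simp add: \<phi>_def)
  qed
  then show "\<alpha> \<in> iso G G" using \<alpha> surj by (simp add: iso_def bij_betw_def)
qed

text \<open>
  The action on the quotient \<open>G\<close> is an automorphism \<open>\<alpha>\<close>, so \<open>\<phi>\<close> maps the base onto the base, and
  the restriction \<open>\<psi>\<close> is equivariant up to \<open>\<alpha>\<close>. Precomposing functions with \<open>\<alpha>\<close>, which is the map \<open>\<tau>\<close>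
  below, removes this twist.
\<close>

lemma inj_of_base_preserved:
  assumes hopf: "hopfian G" and base: base_hopfian
    and \<phi>: "\<phi> \<in> hom W W" and surj: "\<phi> ` carrier W = carrier W"
    and pres: "\<And>f. f \<in> carrier N \<Longrightarrow> snd (\<phi> (f, \<one>\<^bsub>G\<^esub>)) = \<one>\<^bsub>G\<^esub>"
  shows "inj_on \<phi> (carrier W)"
proof -
  interpret \<phi>: group_hom W W \<phi> by unfold_locales (rule \<phi>)
  define \<alpha> where "\<alpha> = (\<lambda>g. snd (\<phi> (\<one>\<^bsub>N\<^esub>, g)))"
  define \<psi> where "\<psi> = (\<lambda>f. fst (\<phi> (f, \<one>\<^bsub>G\<^esub>)))"
  have \<psi>_eq: "\<phi> (f, \<one>\<^bsub>G\<^esub>) = (\<psi> f, \<one>\<^bsub>G\<^esub>)" if "f \<in> carrier N" for f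
    using pres [OF that] by (simp add: \<psi>_def prod_eq_iff)
  have \<phi>_closed: "\<phi> u \<in> carrier W" if "u \<in> carrier W" for u using that by simp
  have \<psi>_closed [simp]: "\<psi> f \<in> carrier N" if "f \<in> carrier N" for f
    using \<phi>_closed [of "(f, \<one>\<^bsub>G\<^esub>)"] that by (simp add: \<psi>_def)
  have \<alpha>_closed [simp]: "\<alpha> g \<in> carrier G" if "g \<in> carrier G" for g
    using \<phi>_closed [of "(\<one>\<^bsub>N\<^esub>, g)"] that by (simp add: \<alpha>_def)
  have snd_\<phi>: "snd (\<phi> (f, g)) = \<alpha> g" if "f \<in> carrier N" "g \<in> carrier G" for f g
  proof -
    have "\<phi> (f, g) = \<phi> (f, \<one>\<^bsub>G\<^esub>) \<otimes>\<^bsub>W\<^esub> \<phi> (\<one>\<^bsub>N\<^esub>, g)"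
      using that by (subst \<phi>.hom_mult [symmetric]) auto
    then show ?thesis using that pres by (simp add: snd_mult \<alpha>_def)
  qed
  have \<alpha>_hom: "\<alpha> \<in> hom G G"
  proof (rule homI)
    fix g h assume gh: "g \<in> carrier G" "h \<in> carrier G"
    have "\<phi> (\<one>\<^bsub>N\<^esub>, g \<otimes>\<^bsub>G\<^esub> h) = \<phi> (\<one>\<^bsub>N\<^esub>, g) \<otimes>\<^bsub>W\<^esub> \<phi> (\<one>\<^bsub>N\<^esub>, h)"
      using gh by (subst \<phi>.hom_mult [symmetric]) auto
    then show "\<alpha> (g \<otimes>\<^bsub>G\<^esub> h) = \<alpha> g \<otimes>\<^bsub>G\<^esub> \<alpha> h" by (simp add: \<alpha>_def snd_mult)
  qed simp
  have "\<alpha> ` carrier G = carrier G"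
  proof (intro equalityI subsetI)
    fix g assume g: "g \<in> carrier G"
    then have "(\<one>\<^bsub>N\<^esub>, g) \<in> \<phi> ` carrier W" using surj by simp
    then obtain f h where "f \<in> carrier N" "h \<in> carrier G" "\<phi> (f, h) = (\<one>\<^bsub>N\<^esub>, g)"
      by (auto simp: carrier_W)
    then show "g \<in> \<alpha> ` carrier G" using snd_\<phi> [of f h] by force
  qed auto
  then have \<alpha>_iso: "\<alpha> \<in> iso G G" using hopf \<alpha>_hom unfolding hopfian_def by blast
  then have \<alpha>_bij: "bij_betw \<alpha> (carrier G) (carrier G)" by (simp add: iso_def)
  interpret \<alpha>: group_hom G G \<alpha> by unfold_locales (rule \<alpha>_hom)
  have \<alpha>_one: "g = \<one>\<^bsub>G\<^esub>" if "g \<in> carrier G" "\<alpha> g = \<one>\<^bsub>G\<^esub>" for g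
    using bij_betw_imp_inj_on [OF \<alpha>_bij] that by (metis \<alpha>.hom_one inj_onD G.one_closed)
  have \<psi>_hom: "\<psi> \<in> hom N N"
  proof (rule homI)
    fix f h assume fh: "f \<in> carrier N" "h \<in> carrier N"
    have "\<phi> (f \<otimes>\<^bsub>N\<^esub> h, \<one>\<^bsub>G\<^esub>) = \<phi> (f, \<one>\<^bsub>G\<^esub>) \<otimes>\<^bsub>W\<^esub> \<phi> (h, \<one>\<^bsub>G\<^esub>)"
      using fh by (subst \<phi>.hom_mult [symmetric]) auto
    then show "\<psi> (f \<otimes>\<^bsub>N\<^esub> h) = \<psi> f \<otimes>\<^bsub>N\<^esub> \<psi> h" using fh by (simp add: \<psi>_eq)
  qed simp
  have \<psi>_act: "\<psi> (act g f) = act (\<alpha> g) (\<psi> f)" if f: "f \<in> carrier N" and g: "g \<in> carrier G" for f g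
  proof -
    obtain c where c: "\<phi> (\<one>\<^bsub>N\<^esub>, g) = (c, \<alpha> g)" by (metis \<alpha>_def prod.collapse)
    then have cN: "c \<in> carrier N" using \<phi>_closed [of "(\<one>\<^bsub>N\<^esub>, g)"] g by simp
    have "\<phi> (act g f, \<one>\<^bsub>G\<^esub>) \<otimes>\<^bsub>W\<^esub> \<phi> (\<one>\<^bsub>N\<^esub>, g) = \<phi> (\<one>\<^bsub>N\<^esub>, g) \<otimes>\<^bsub>W\<^esub> \<phi> (f, \<one>\<^bsub>G\<^esub>)"
      using f g by (subst (1 2) \<phi>.hom_mult [symmetric]) (auto simp: act_conj)
    then have "\<psi> (act g f) \<otimes>\<^bsub>N\<^esub> c = act (\<alpha> g) (\<psi> f) \<otimes>\<^bsub>N\<^esub> c"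
      using f g cN by (simp add: \<psi>_eq c N.m_comm)
    then show ?thesis using f g cN by simp
  qed
  have \<psi>_surj: "\<psi> ` carrier N = carrier N"
  proof (intro equalityI subsetI)
    fix f assume f: "f \<in> carrier N"
    then have "(f, \<one>\<^bsub>G\<^esub>) \<in> \<phi> ` carrier W" using surj by simp
    then obtain h k where hk: "h \<in> carrier N" "k \<in> carrier G" "\<phi> (h, k) = (f, \<one>\<^bsub>G\<^esub>)"
      by (auto simp: carrier_W)
    then have "k = \<one>\<^bsub>G\<^esub>" using snd_\<phi> [of h k] \<alpha>_one [of k] by simp
    then show "f \<in> \<psi> ` carrier N" using hk \<psi>_eq by force
  qed auto
  define \<tau> where "\<tau> = (\<lambda>f. \<lambda>x\<in>carrier G. f (\<alpha> x) :: 'a)"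
  define \<beta> where "\<beta> = inv_into (carrier G) \<alpha>"
  have \<beta>: "\<beta> x \<in> carrier G" "\<alpha> (\<beta> x) = x" "\<beta> (\<alpha> x) = x" if "x \<in> carrier G" for x
    using that \<alpha>_bij by (auto simp: \<beta>_def bij_betw_def inv_into_into f_inv_into_f inv_into_f_f)
  have \<tau>_closed: "\<tau> f \<in> carrier N" if f: "f \<in> carrier N" for f
  proof (rule N_closedI)
    show "finite (\<beta> ` {x \<in> carrier G. f x \<noteq> \<one>\<^bsub>A\<^esub>})" using f unfolding carrier_N by blast
    fix x assume x: "x \<in> carrier G"
    show "\<tau> f x \<in> carrier A" using f x by (simp add: \<tau>_def)
    assume *: "x \<notin> \<beta> ` {x \<in> carrier G. f x \<noteq> \<one>\<^bsub>A\<^esub>}"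
    have "\<alpha> x \<notin> {x \<in> carrier G. f x \<noteq> \<one>\<^bsub>A\<^esub>}"
    proof
      assume "\<alpha> x \<in> {x \<in> carrier G. f x \<noteq> \<one>\<^bsub>A\<^esub>}"
      then have "\<beta> (\<alpha> x) \<in> \<beta> ` {x \<in> carrier G. f x \<noteq> \<one>\<^bsub>A\<^esub>}" by (rule imageI)
      then show False using * unfolding \<beta>(3) [OF x] by contradiction
    qed
    then show "\<tau> f x = \<one>\<^bsub>A\<^esub>" using x by (simp add: \<tau>_def)
  qed (simp add: \<tau>_def)
  have \<tau>_surj: "\<exists>h\<in>carrier N. \<tau> h = f" if f: "f \<in> carrier N" for f
  proof -
    define h where "h = (\<lambda>x\<in>carrier G. f (\<beta> x))"
    have h: "h \<in> carrier N"
    proof (rule N_closedI)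
      show "finite (\<alpha> ` {x \<in> carrier G. f x \<noteq> \<one>\<^bsub>A\<^esub>})" using f unfolding carrier_N by blast
      fix x assume x: "x \<in> carrier G"
      show "h x \<in> carrier A" using f x \<beta> by (simp add: h_def)
      assume *: "x \<notin> \<alpha> ` {x \<in> carrier G. f x \<noteq> \<one>\<^bsub>A\<^esub>}"
      have "\<beta> x \<notin> {x \<in> carrier G. f x \<noteq> \<one>\<^bsub>A\<^esub>}"
      proof
        assume "\<beta> x \<in> {x \<in> carrier G. f x \<noteq> \<one>\<^bsub>A\<^esub>}"
        then have "\<alpha> (\<beta> x) \<in> \<alpha> ` {x \<in> carrier G. f x \<noteq> \<one>\<^bsub>A\<^esub>}" by (rule imageI)
        then show False using * unfolding \<beta>(2) [OF x] by contradiction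
      qed
      then show "h x = \<one>\<^bsub>A\<^esub>" using x \<beta>(1) [OF x] by (simp add: h_def)
    qed (simp add: h_def)
    moreover have "\<tau> h = f"
      by (rule N_ext [OF \<tau>_closed [OF h] f]) (simp add: \<tau>_def h_def \<beta>)
    ultimately show ?thesis by blast
  qed
  have \<tau>_hom: "\<tau> (f \<otimes>\<^bsub>N\<^esub> h) = \<tau> f \<otimes>\<^bsub>N\<^esub> \<tau> h" if "f \<in> carrier N" "h \<in> carrier N" for f h
    by (rule N_ext) (use that \<tau>_closed in \<open>auto simp: \<tau>_def\<close>)
  have \<tau>_act: "\<tau> (act (\<alpha> g) f) = act g (\<tau> f)" if "f \<in> carrier N" "g \<in> carrier G" for f g
    by (rule N_ext) (use that \<tau>_closed in \<open>auto simp: \<tau>_def\<close>)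
  have "inj_on (\<lambda>f. \<tau> (\<psi> f)) (carrier N)"
  proof (rule base [unfolded base_hopfian_def, rule_format])
    show "(\<lambda>f. \<tau> (\<psi> f)) \<in> hom N N"
      by (rule homI) (auto simp: \<tau>_closed \<tau>_hom hom_mult [OF \<psi>_hom])
    show "\<tau> (\<psi> (act g f)) = act g (\<tau> (\<psi> f))" if "g \<in> carrier G" "f \<in> carrier N" for g f
      using that by (simp add: \<psi>_act \<tau>_act)
    show "(\<lambda>f. \<tau> (\<psi> f)) ` carrier N = carrier N"
    proof (intro equalityI subsetI)
      fix f assume "f \<in> carrier N"
      then obtain h where h: "h \<in> carrier N" "\<tau> h = f" using \<tau>_surj by blast
      from h(1) have "h \<in> \<psi> ` carrier N" by (simp only: \<psi>_surj)
      then obtain k where k: "k \<in> carrier N" "h = \<psi> k" by (rule imageE)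
      have "f = \<tau> (\<psi> k)" using h k by simp
      then show "f \<in> (\<lambda>f. \<tau> (\<psi> f)) ` carrier N" using k(1) by (rule image_eqI)
    qed (auto simp: \<tau>_closed)
  qed
  then have \<psi>_inj: "inj_on \<psi> (carrier N)" by (auto simp: inj_on_def)
  interpret \<psi>: group_hom N N \<psi> by unfold_locales (rule \<psi>_hom)
  show ?thesis
  proof (rule \<phi>.inj_on_one_iff [THEN iffD2], intro allI impI)
    fix u assume u: "u \<in> carrier W" "\<phi> u = \<one>\<^bsub>W\<^esub>"
    then obtain f g where fg: "u = (f, g)" "f \<in> carrier N" "g \<in> carrier G" by (auto simp: carrier_W)
    then have g: "g = \<one>\<^bsub>G\<^esub>" using snd_\<phi> [of f g] u \<alpha>_one [of g] by (simp add: one_W)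
    then have "\<psi> f = \<one>\<^bsub>N\<^esub>" using \<psi>_eq [OF fg(2)] u fg by (simp add: one_W)
    then have "f = \<one>\<^bsub>N\<^esub>" using \<psi>_inj fg(2) by (metis \<psi>.hom_one inj_onD N.one_closed)
    then show "u = \<one>\<^bsub>W\<^esub>" using fg g by (simp add: one_W)
  qed
qed

definition commutator :: "('g \<Rightarrow> 'a) \<times> 'g \<Rightarrow> ('g \<Rightarrow> 'a) \<times> 'g \<Rightarrow> ('g \<Rightarrow> 'a) \<times> 'g" where
  "commutator u v = u \<otimes>\<^bsub>W\<^esub> v \<otimes>\<^bsub>W\<^esub> inv\<^bsub>W\<^esub> u \<otimes>\<^bsub>W\<^esub> inv\<^bsub>W\<^esub> v"

lemma commutator_closed [simp]: "u \<in> carrier W \<Longrightarrow> v \<in> carrier W \<Longrightarrow> commutator u v \<in> carrier W"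
  by (simp add: commutator_def)

lemma W_cancel:
  "u \<in> carrier W \<Longrightarrow> v \<in> carrier W \<Longrightarrow> u \<otimes>\<^bsub>W\<^esub> (inv\<^bsub>W\<^esub> u \<otimes>\<^bsub>W\<^esub> v) = v"
  "u \<in> carrier W \<Longrightarrow> v \<in> carrier W \<Longrightarrow> inv\<^bsub>W\<^esub> u \<otimes>\<^bsub>W\<^esub> (u \<otimes>\<^bsub>W\<^esub> v) = v"
  by (simp_all add: W.m_assoc [symmetric])

lemma commutator_eqI:
  assumes "u \<in> carrier W" "v \<in> carrier W" "w \<in> carrier W"
    and "u \<otimes>\<^bsub>W\<^esub> v = w \<otimes>\<^bsub>W\<^esub> (v \<otimes>\<^bsub>W\<^esub> u)"
  shows "commutator u v = w"
proof -
  have "commutator u v = u \<otimes>\<^bsub>W\<^esub> v \<otimes>\<^bsub>W\<^esub> inv\<^bsub>W\<^esub> (v \<otimes>\<^bsub>W\<^esub> u)"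
    using assms(1-3) by (simp add: commutator_def W.inv_mult_group W.m_assoc)
  also have "\<dots> = w" using assms(1-3) unfolding assms(4) by (simp add: W.m_assoc)
  finally show ?thesis .
qed

lemma commutator_base:
  assumes "f \<in> carrier N" "h \<in> carrier N" "g \<in> carrier G"
  shows "commutator (f, \<one>\<^bsub>G\<^esub>) (h, g) = (f \<otimes>\<^bsub>N\<^esub> inv\<^bsub>N\<^esub> (act g f), \<one>\<^bsub>G\<^esub>)"
proof (rule commutator_eqI)
  have "f \<otimes>\<^bsub>N\<^esub> inv\<^bsub>N\<^esub> (act g f) \<otimes>\<^bsub>N\<^esub> (h \<otimes>\<^bsub>N\<^esub> act g f) = f \<otimes>\<^bsub>N\<^esub> h"
    using assms by (simp add: N.m_ac)
  then show "(f, \<one>\<^bsub>G\<^esub>) \<otimes>\<^bsub>W\<^esub> (h, g) = (f \<otimes>\<^bsub>N\<^esub> inv\<^bsub>N\<^esub> (act g f), \<one>\<^bsub>G\<^esub>) \<otimes>\<^bsub>W\<^esub> ((h, g) \<otimes>\<^bsub>W\<^esub> (f, \<one>\<^bsub>G\<^esub>))"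
    using assms by simp
qed (use assms in auto)

lemma commutator_top:
  assumes "f \<in> carrier N" "g \<in> carrier G"
  shows "commutator (\<one>\<^bsub>N\<^esub>, g) (f, \<one>\<^bsub>G\<^esub>) = (act g f \<otimes>\<^bsub>N\<^esub> inv\<^bsub>N\<^esub> f, \<one>\<^bsub>G\<^esub>)"
  by (rule commutator_eqI) (use assms in \<open>auto simp: N.m_assoc\<close>)

lemma commutator_one_iff:
  assumes "u \<in> carrier W" "v \<in> carrier W"
  shows "commutator u v = \<one>\<^bsub>W\<^esub> \<longleftrightarrow> u \<otimes>\<^bsub>W\<^esub> v = v \<otimes>\<^bsub>W\<^esub> u"
proof
  assume "commutator u v = \<one>\<^bsub>W\<^esub>"
  then have "u \<otimes>\<^bsub>W\<^esub> v \<otimes>\<^bsub>W\<^esub> inv\<^bsub>W\<^esub> u \<otimes>\<^bsub>W\<^esub> inv\<^bsub>W\<^esub> v \<otimes>\<^bsub>W\<^esub> (v \<otimes>\<^bsub>W\<^esub> u) = v \<otimes>\<^bsub>W\<^esub> u"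
    using assms by (simp add: commutator_def)
  then show "u \<otimes>\<^bsub>W\<^esub> v = v \<otimes>\<^bsub>W\<^esub> u" using assms by (simp add: W.m_assoc W_cancel)
next
  assume "u \<otimes>\<^bsub>W\<^esub> v = v \<otimes>\<^bsub>W\<^esub> u"
  then show "commutator u v = \<one>\<^bsub>W\<^esub>" using assms by (intro commutator_eqI) auto
qed

lemma commutator_mult_right:
  assumes "u \<in> carrier W" "v \<in> carrier W" "w \<in> carrier W"
  shows "commutator u (v \<otimes>\<^bsub>W\<^esub> w) = commutator u v \<otimes>\<^bsub>W\<^esub> (v \<otimes>\<^bsub>W\<^esub> commutator u w \<otimes>\<^bsub>W\<^esub> inv\<^bsub>W\<^esub> v)"
  using assms unfolding commutator_def
  by (simp add: W.inv_mult_group W.m_assoc W_cancel)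

lemma commutator_hom:
  assumes "\<phi> \<in> hom W W" "u \<in> carrier W" "v \<in> carrier W"
  shows "\<phi> (commutator u v) = commutator (\<phi> u) (\<phi> v)"
proof -
  interpret \<phi>: group_hom W W \<phi> by unfold_locales (rule assms(1))
  show ?thesis using assms by (simp add: commutator_def)
qed

lemma snd_commutator:
  assumes "u \<in> carrier W" "v \<in> carrier W" "snd u \<otimes>\<^bsub>G\<^esub> snd v = snd v \<otimes>\<^bsub>G\<^esub> snd u"
  shows "snd (commutator u v) = \<one>\<^bsub>G\<^esub>"
proof -
  have "snd (commutator u v) = snd u \<otimes>\<^bsub>G\<^esub> snd v \<otimes>\<^bsub>G\<^esub> inv\<^bsub>G\<^esub> (snd v \<otimes>\<^bsub>G\<^esub> snd u)"
    using assms(1,2) by (simp add: commutator_def snd_mult snd_inv G.inv_mult_group G.m_assoc)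
  then show ?thesis using assms by simp
qed

text \<open>
  Adding a generator \<open>s\<close> to a subgroup adds at most the coset of \<open>s\<close>.
\<close>

lemma finite_of_exponent_two:
  assumes exp2: "\<And>a. a \<in> carrier A \<Longrightarrow> a \<otimes>\<^bsub>A\<^esub> a = \<one>\<^bsub>A\<^esub>" and fg: "finitely_generated_group A"
  shows "finite (carrier A)"
proof -
  have "finite (generate A S)" if "finite S" "S \<subseteq> carrier A" for S
    using that
  proof (induction S)
    case empty then show ?case by (simp add: A.generate_empty)
  next
    case (insert s S)
    have s: "s \<in> carrier A" and S: "S \<subseteq> carrier A" using insert by auto
    have sub: "subgroup (generate A S) A" by (rule A.generate_is_subgroup [OF S])
    have gS: "x \<in> carrier A" if "x \<in> generate A S" for x using A.generate_in_carrier [OF S that] .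
    have inv: "inv\<^bsub>A\<^esub> a = a" if "a \<in> carrier A" for a
      using A.inv_equality [OF exp2] that by blast
    let ?X = "generate A S \<union> (\<lambda>x. s \<otimes>\<^bsub>A\<^esub> x) ` generate A S"
    have "generate A (insert s S) \<subseteq> ?X"
    proof
      fix x assume "x \<in> generate A (insert s S)"
      then show "x \<in> ?X"
      proof (induction x rule: generate.induct)
        case one then show ?case using generate.one by blast
      next
        case (incl h)
        have "s = s \<otimes>\<^bsub>A\<^esub> \<one>\<^bsub>A\<^esub>" using s by simp
        then have "s \<in> (\<lambda>x. s \<otimes>\<^bsub>A\<^esub> x) ` generate A S" using generate.one by (rule image_eqI)
        then show ?case using incl generate.incl [of h S A] by blast
      next
        case (inv h)
        have "s = s \<otimes>\<^bsub>A\<^esub> \<one>\<^bsub>A\<^esub>" using s by simp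
        then have "s \<in> (\<lambda>x. s \<otimes>\<^bsub>A\<^esub> x) ` generate A S" using generate.one by (rule image_eqI)
        moreover have "inv\<^bsub>A\<^esub> h = h" using inv.hyps s S \<open>\<And>a. a \<in> carrier A \<Longrightarrow> inv\<^bsub>A\<^esub> a = a\<close> by blast
        ultimately show ?case using inv generate.incl [of h S A] by auto
      next
        case (eng h1 h2)
        then consider "h1 \<in> generate A S" "h2 \<in> generate A S"
          | y where "h1 = s \<otimes>\<^bsub>A\<^esub> y" "y \<in> generate A S" "h2 \<in> generate A S"
          | y where "h1 \<in> generate A S" "h2 = s \<otimes>\<^bsub>A\<^esub> y" "y \<in> generate A S"
          | y z where "h1 = s \<otimes>\<^bsub>A\<^esub> y" "h2 = s \<otimes>\<^bsub>A\<^esub> z" "y \<in> generate A S" "z \<in> generate A S"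
          by blast
        then show ?case
        proof cases
          case 1 then show ?thesis by (intro UnI1 generate.eng)
        next
          case 2
          then have "h1 \<otimes>\<^bsub>A\<^esub> h2 = s \<otimes>\<^bsub>A\<^esub> (y \<otimes>\<^bsub>A\<^esub> h2)" using s gS by (simp add: A.m_assoc)
          moreover have "y \<otimes>\<^bsub>A\<^esub> h2 \<in> generate A S" using 2 by (intro generate.eng)
          ultimately show ?thesis by (intro UnI2 image_eqI)
        next
          case 3
          then have "h1 \<otimes>\<^bsub>A\<^esub> h2 = s \<otimes>\<^bsub>A\<^esub> (h1 \<otimes>\<^bsub>A\<^esub> y)" using s gS by (simp add: A.m_lcomm)
          moreover have "h1 \<otimes>\<^bsub>A\<^esub> y \<in> generate A S" using 3 by (intro generate.eng)
          ultimately show ?thesis by (intro UnI2 image_eqI)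
        next
          case 4
          have "h1 \<otimes>\<^bsub>A\<^esub> h2 = (s \<otimes>\<^bsub>A\<^esub> s) \<otimes>\<^bsub>A\<^esub> (y \<otimes>\<^bsub>A\<^esub> z)"
            using 4 s gS by (simp add: A.m_ac)
          then have "h1 \<otimes>\<^bsub>A\<^esub> h2 = y \<otimes>\<^bsub>A\<^esub> z" using 4 s gS by (simp add: exp2)
          moreover have "y \<otimes>\<^bsub>A\<^esub> z \<in> generate A S" using 4 by (intro generate.eng)
          ultimately show ?thesis by simp
        qed
      qed
    qed
    then show ?case using insert by (auto intro: finite_subset)
  qed
  then show ?thesis using fg unfolding finitely_generated_group_def by metis
qed

text \<open>
  Let \<open>M\<close> be the image of the base, an abelian normal subgroup, and let \<open>(f, g) \<in> M\<close> with \<open>g \<noteq> \<one>\<close>.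
  The commutator of a base element with \<open>(f, g)\<close> lies in \<open>M\<close>, so it is fixed by the translation part of every
  element of \<open>M\<close>. Evaluated on functions supported at one point, this shows that \<open>A\<close> has exponent two and
  that all nontrivial translation parts in \<open>M\<close> are equal to one central involution \<open>z\<close>. Such examples
  exist: the dihedral group of order eight is the wreath product of two groups of order two, and one of
  its automorphisms moves the base.

  If \<open>G\<close> is finite, the whole group is finite. Let \<open>G\<close> be infinite and fix \<open>t = (f0, z) \<in> M\<close>. The
  base elements in \<open>M\<close> are exactly those fixed by \<open>z\<close>, and these are the commutators of \<open>t\<close> with base
  elements. As \<open>z\<close> is central, \<open>t\<close> is central modulo the base, so \<open>s = \<phi> t\<close> is central modulo \<open>M\<close>.
  Finitely supported invariant functions on an infinite group are trivial, and this forces \<open>s \<in> M\<close>. So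
  \<open>s\<close> commutes with \<open>M\<close>, which means that \<open>\<phi>\<close> kills the commutators of \<open>t\<close> with the base, that is, all
  base elements of \<open>M\<close>. Then \<open>s\<close> is central, hence trivial, and \<open>\<phi>\<close> kills \<open>M\<close>. So
  \<open>\<phi> \<circ> \<phi>\<close> factors through \<open>G\<close>, and \<open>G\<close> maps onto the wreath product, hence onto itself with a
  nontrivial kernel, although it is Hopfian.
\<close>

lemma inj_of_base_not_preserved:
  assumes hopf: "hopfian G" and fg: "finitely_generated_group A"
    and \<phi>: "\<phi> \<in> hom W W" and surj: "\<phi> ` carrier W = carrier W"
    and f1: "f1 \<in> carrier N" "snd (\<phi> (f1, \<one>\<^bsub>G\<^esub>)) \<noteq> \<one>\<^bsub>G\<^esub>"
  shows "inj_on \<phi> (carrier W)"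
proof -
  interpret \<phi>: group_hom W W \<phi> by unfold_locales (rule \<phi>)
  define M where "M = {\<phi> (f, \<one>\<^bsub>G\<^esub>) | f. f \<in> carrier N}"
  have M_iff: "u \<in> M \<longleftrightarrow> (\<exists>v\<in>carrier W. snd v = \<one>\<^bsub>G\<^esub> \<and> u = \<phi> v)" for u
    unfolding M_def by (force simp: carrier_W)
  have MI: "\<phi> v \<in> M" if "v \<in> carrier W" "snd v = \<one>\<^bsub>G\<^esub>" for v using that M_iff by blast
  have M_closed [simp]: "u \<in> carrier W" if "u \<in> M" for u using that by (auto simp: M_iff)
  have M_mult: "u \<otimes>\<^bsub>W\<^esub> v \<in> M" if uv: "u \<in> M" "v \<in> M" for u v
  proof -
    obtain u' v' where "u' \<in> carrier W" "snd u' = \<one>\<^bsub>G\<^esub>" "u = \<phi> u'" "v' \<in> carrier W" "snd v' = \<one>\<^bsub>G\<^esub>" "v = \<phi> v'"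
      using uv unfolding M_iff by meson
    then show ?thesis using MI [of "u' \<otimes>\<^bsub>W\<^esub> v'"] by (simp add: snd_mult)
  qed
  have M_inv: "inv\<^bsub>W\<^esub> u \<in> M" if u: "u \<in> M" for u
  proof -
    obtain u' where "u' \<in> carrier W" "snd u' = \<one>\<^bsub>G\<^esub>" "u = \<phi> u'" using u unfolding M_iff by meson
    then show ?thesis using MI [of "inv\<^bsub>W\<^esub> u'"] by (simp add: snd_inv)
  qed
  have M_comm: "u \<otimes>\<^bsub>W\<^esub> v = v \<otimes>\<^bsub>W\<^esub> u" if "u \<in> M" "v \<in> M" for u v
  proof -
    obtain f h where fh: "f \<in> carrier N" "h \<in> carrier N" "u = \<phi> (f, \<one>\<^bsub>G\<^esub>)" "v = \<phi> (h, \<one>\<^bsub>G\<^esub>)"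
      using \<open>u \<in> M\<close> \<open>v \<in> M\<close> unfolding M_def by blast
    then have "(f, \<one>\<^bsub>G\<^esub>) \<otimes>\<^bsub>W\<^esub> (h, \<one>\<^bsub>G\<^esub>) = (h, \<one>\<^bsub>G\<^esub>) \<otimes>\<^bsub>W\<^esub> (f, \<one>\<^bsub>G\<^esub>)"
      by (simp add: N.m_comm)
    then show ?thesis using fh by (metis W_closed G.one_closed \<phi>.hom_mult)
  qed
  have M_normal: "w \<otimes>\<^bsub>W\<^esub> u \<otimes>\<^bsub>W\<^esub> inv\<^bsub>W\<^esub> w \<in> M" if "u \<in> M" "w \<in> carrier W" for u w
  proof -
    obtain u' where u': "u' \<in> carrier W" "snd u' = \<one>\<^bsub>G\<^esub>" "u = \<phi> u'" using \<open>u \<in> M\<close> unfolding M_iff by meson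
    obtain w' where w': "w' \<in> carrier W" "w = \<phi> w'" using surj \<open>w \<in> carrier W\<close> by blast
    show ?thesis using MI [of "w' \<otimes>\<^bsub>W\<^esub> u' \<otimes>\<^bsub>W\<^esub> inv\<^bsub>W\<^esub> w'"] u' w' by (simp add: snd_mult snd_inv)
  qed
  have M_comm_in: "commutator w u \<in> M" if "u \<in> M" "w \<in> carrier W" for u w
    using M_mult [OF M_normal [OF that] M_inv [OF that(1)]] by (simp add: commutator_def)
  have M_fixed: "act g h = h" if "(h, \<one>\<^bsub>G\<^esub>) \<in> M" "(f, g) \<in> M" for f g h
  proof -
    have c: "f \<in> carrier N" "g \<in> carrier G" "h \<in> carrier N" using M_closed that by force+
    have "h \<otimes>\<^bsub>N\<^esub> f = act g h \<otimes>\<^bsub>N\<^esub> f" using M_comm [OF that] c by (simp add: N.m_comm)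
    then show ?thesis using c by simp
  qed
  have "\<exists>a\<in>carrier A. a \<noteq> \<one>\<^bsub>A\<^esub>"
  proof (rule ccontr)
    assume "\<not> ?thesis"
    then have "f1 = \<one>\<^bsub>N\<^esub>" using f1 by (intro N_ext) auto
    then have "\<phi> (f1, \<one>\<^bsub>G\<^esub>) = \<one>\<^bsub>W\<^esub>" using \<phi>.hom_one by (simp add: one_W)
    then show False using f1 by (simp add: one_W)
  qed
  then obtain a where a: "a \<in> carrier A" "a \<noteq> \<one>\<^bsub>A\<^esub>" by blast
  have key: "inv\<^bsub>G\<^esub> g' = g \<and> inv\<^bsub>A\<^esub> b = b"
    if M: "(f, g) \<in> M" "(f', g') \<in> M" and ne: "g \<noteq> \<one>\<^bsub>G\<^esub>" "g' \<noteq> \<one>\<^bsub>G\<^esub>"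
      and b: "b \<in> carrier A" "b \<noteq> \<one>\<^bsub>A\<^esub>" for f g f' g' b
  proof -
    have c: "f \<in> carrier N" "g \<in> carrier G" "f' \<in> carrier N" "g' \<in> carrier G"
      using M_closed [OF M(1)] M_closed [OF M(2)] by auto
    define D where "D = single b \<otimes>\<^bsub>N\<^esub> inv\<^bsub>N\<^esub> (act g (single b))"
    have "(D, \<one>\<^bsub>G\<^esub>) \<in> M"
      using M_comm_in [OF M(1), of "(single b, \<one>\<^bsub>G\<^esub>)"] b c by (simp add: commutator_base D_def)
    then have actD: "act g' D = D" using M_fixed M(2) by blast
    have "D (inv\<^bsub>G\<^esub> g') = D \<one>\<^bsub>G\<^esub>" using fun_cong [OF actD, of "\<one>\<^bsub>G\<^esub>"] c by simp
    moreover have "inv\<^bsub>G\<^esub> g' \<noteq> \<one>\<^bsub>G\<^esub>" "inv\<^bsub>G\<^esub> g \<noteq> \<one>\<^bsub>G\<^esub>" using c ne by (auto simp: G.inv_eq_1_iff)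
    moreover have "inv\<^bsub>G\<^esub> g \<otimes>\<^bsub>G\<^esub> inv\<^bsub>G\<^esub> g' = \<one>\<^bsub>G\<^esub> \<longleftrightarrow> inv\<^bsub>G\<^esub> g' = g"
      using c by (metis G.inv_closed G.inv_equality G.inv_inv G.l_inv)
    ultimately show ?thesis
      using b c by (auto simp: D_def single_apply split: if_splits)
  qed
  obtain t where t: "t \<in> M" "snd t \<noteq> \<one>\<^bsub>G\<^esub>"
    using f1 MI [of "(f1, \<one>\<^bsub>G\<^esub>)"] by auto
  obtain f0 z where t_eq: "t = (f0, z)" by (cases t)
  have z1: "z \<noteq> \<one>\<^bsub>G\<^esub>" and tM: "(f0, z) \<in> M"
    using t t_eq by auto
  have tW [simp]: "t \<in> carrier W" by (rule M_closed [OF t(1)])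
  have f0 [simp]: "f0 \<in> carrier N" and z [simp]: "z \<in> carrier G"
    using M_closed [OF tM] by auto
  have invz [simp]: "inv\<^bsub>G\<^esub> z = z" using key [OF tM tM z1 z1 a] by simp
  have zz [simp]: "z \<otimes>\<^bsub>G\<^esub> z = \<one>\<^bsub>G\<^esub>" using G.l_inv [OF z] by simp
  have invA: "inv\<^bsub>A\<^esub> b = b" if "b \<in> carrier A" for b
    using key [OF tM tM z1 z1, of b] that by (cases "b = \<one>\<^bsub>A\<^esub>") auto
  have AA: "b \<otimes>\<^bsub>A\<^esub> b = \<one>\<^bsub>A\<^esub>" if "b \<in> carrier A" for b
    using A.l_inv [OF that] invA [OF that] by simp
  have invN: "inv\<^bsub>N\<^esub> f = f" if "f \<in> carrier N" for f
    by (rule N_ext) (use that invA in auto)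
  have NN: "f \<otimes>\<^bsub>N\<^esub> f = \<one>\<^bsub>N\<^esub>" if "f \<in> carrier N" for f
    using N.l_inv [OF that] invN [OF that] by simp
  have finA: "finite (carrier A)" by (rule finite_of_exponent_two [OF AA fg])
  show ?thesis
  proof (cases "finite (carrier G)")
    case True
    have "carrier N \<subseteq> carrier G \<rightarrow>\<^sub>E carrier A" using carrier_N by blast
    then have "finite (carrier N)" using finite_PiE [OF True] finA finite_subset by metis
    then have "finite (carrier W)" using True by (simp add: carrier_W)
    then show ?thesis using surj by (simp add: eq_card_imp_inj_on)
  next
    case infG: False
    have snd_M: "snd q = \<one>\<^bsub>G\<^esub> \<or> snd q = z" if "q \<in> M" for q
      using key [OF tM, of "fst q" "snd q" a] that a z1 by (cases "snd q = \<one>\<^bsub>G\<^esub>")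
        (auto simp: G.inv_inv, metis G.inv_inv M_closed invz snd_closed)
    have central: "g \<otimes>\<^bsub>G\<^esub> z = z \<otimes>\<^bsub>G\<^esub> g" if g: "g \<in> carrier G" for g
    proof -
      have "(\<one>\<^bsub>N\<^esub>, g) \<otimes>\<^bsub>W\<^esub> t \<otimes>\<^bsub>W\<^esub> inv\<^bsub>W\<^esub> (\<one>\<^bsub>N\<^esub>, g) \<in> M" using g by (intro M_normal t) auto
      then have "g \<otimes>\<^bsub>G\<^esub> z \<otimes>\<^bsub>G\<^esub> inv\<^bsub>G\<^esub> g = \<one>\<^bsub>G\<^esub> \<or> g \<otimes>\<^bsub>G\<^esub> z \<otimes>\<^bsub>G\<^esub> inv\<^bsub>G\<^esub> g = z"
        using snd_M g by (fastforce simp: snd_mult snd_inv t_eq simp del: mult_W)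
      moreover have "g \<otimes>\<^bsub>G\<^esub> z = (g \<otimes>\<^bsub>G\<^esub> z \<otimes>\<^bsub>G\<^esub> inv\<^bsub>G\<^esub> g) \<otimes>\<^bsub>G\<^esub> g" using g by (simp add: G.m_assoc)
      moreover have "g \<otimes>\<^bsub>G\<^esub> z \<noteq> g" using g z1 by simp
      ultimately show ?thesis using g by (metis G.l_one)
    qed
    \<comment> \<open>Restrict \<open>m\<close> to a set that contains one point of each coset \<open>{x, z x}\<close>.\<close>
    have fixed_split: "\<exists>n\<in>carrier N. m = n \<otimes>\<^bsub>N\<^esub> act z n" if m: "m \<in> carrier N" "act z m = m" for m
    proof -
      define T where "T = {x \<in> carrier G. x = (SOME y. y \<in> {x, z \<otimes>\<^bsub>G\<^esub> x})}"
      have T: "x \<in> T \<longleftrightarrow> z \<otimes>\<^bsub>G\<^esub> x \<notin> T" if x: "x \<in> carrier G" for x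
      proof -
        have "z \<otimes>\<^bsub>G\<^esub> (z \<otimes>\<^bsub>G\<^esub> x) = x" using x by (simp add: G.m_assoc [symmetric])
        then have eq: "{z \<otimes>\<^bsub>G\<^esub> x, z \<otimes>\<^bsub>G\<^esub> (z \<otimes>\<^bsub>G\<^esub> x)} = {x, z \<otimes>\<^bsub>G\<^esub> x}" by auto
        have "(SOME y. y \<in> {x, z \<otimes>\<^bsub>G\<^esub> x}) \<in> {x, z \<otimes>\<^bsub>G\<^esub> x}" by (rule someI [of _ x]) simp
        moreover have "z \<otimes>\<^bsub>G\<^esub> x \<noteq> x" using x z1 by simp
        ultimately show ?thesis using x unfolding T_def mem_Collect_eq eq by auto
      qed
      define n where "n = (\<lambda>x\<in>carrier G. if x \<in> T then m x else \<one>\<^bsub>A\<^esub>)"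
      have n: "n \<in> carrier N"
        by (rule N_closedI [of "{x \<in> carrier G. m x \<noteq> \<one>\<^bsub>A\<^esub>}"])
          (use m carrier_N in \<open>auto simp: n_def\<close>)
      have "m = n \<otimes>\<^bsub>N\<^esub> act z n"
      proof (rule N_ext)
        fix x assume x: "x \<in> carrier G"
        have "m (z \<otimes>\<^bsub>G\<^esub> x) = m x" using fun_cong [OF m(2), of x] x by simp
        then show "m x = (n \<otimes>\<^bsub>N\<^esub> act z n) x" using x m T [OF x] by (simp add: n_def)
      qed (use m n in auto)
      then show ?thesis using n by blast
    qed
    have comm_t: "commutator (n, \<one>\<^bsub>G\<^esub>) t = (n \<otimes>\<^bsub>N\<^esub> act z n, \<one>\<^bsub>G\<^esub>)" if "n \<in> carrier N" for n
      using that by (simp add: t_eq commutator_base invN)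
    have fixed_M: "(m, \<one>\<^bsub>G\<^esub>) \<in> M" if m: "m \<in> carrier N" "act z m = m" for m
    proof -
      obtain n where n: "n \<in> carrier N" "m = n \<otimes>\<^bsub>N\<^esub> act z n" using fixed_split [OF m] by blast
      then show ?thesis using M_comm_in [OF t(1), of "(n, \<one>\<^bsub>G\<^esub>)"] comm_t by simp
    qed
    have invariant: "f = \<one>\<^bsub>N\<^esub>" if f: "f \<in> carrier N" "\<And>g. g \<in> carrier G \<Longrightarrow> act g f = f" for f
    proof (rule ccontr)
      assume "f \<noteq> \<one>\<^bsub>N\<^esub>"
      then obtain x where x: "x \<in> carrier G" "f x \<noteq> \<one>\<^bsub>A\<^esub>" using N_ext [OF f(1), of "\<one>\<^bsub>N\<^esub>"] by auto
      have "f y \<noteq> \<one>\<^bsub>A\<^esub>" if y: "y \<in> carrier G" for y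
      proof -
        have "f y = act (x \<otimes>\<^bsub>G\<^esub> inv\<^bsub>G\<^esub> y) f x"
          using x y by (simp add: G.inv_mult_group G.m_assoc)
        then show ?thesis using f(2) [of "x \<otimes>\<^bsub>G\<^esub> inv\<^bsub>G\<^esub> y"] x y by simp
      qed
      then have "{x \<in> carrier G. f x \<noteq> \<one>\<^bsub>A\<^esub>} = carrier G" by blast
      then show False using f(1) infG unfolding carrier_N by simp
    qed
    define s where "s = \<phi> t"
    have sW [simp]: "s \<in> carrier W" by (simp add: s_def)
    have snd_comm_t: "snd (commutator w t) = \<one>\<^bsub>G\<^esub>" if "w \<in> carrier W" for w
      using that central [of "snd w"] by (intro snd_commutator) (auto simp: t_eq)
    have s_comm: "commutator w s \<in> M" if w: "w \<in> carrier W" for w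
    proof -
      obtain w' where w': "w' \<in> carrier W" "w = \<phi> w'" using surj w by blast
      then have "commutator w s = \<phi> (commutator w' t)" unfolding s_def by (simp add: commutator_hom [OF \<phi>])
      then show ?thesis using MI snd_comm_t w' by simp
    qed
    obtain fs gs where s_eq: "s = (fs, gs)" by (cases s)
    have fs [simp]: "fs \<in> carrier N" "gs \<in> carrier G" using sW unfolding s_eq by auto
    have gs: "gs = \<one>\<^bsub>G\<^esub> \<or> gs = z"
    proof -
      let ?D = "single a \<otimes>\<^bsub>N\<^esub> act gs (single a)"
      have "(?D, \<one>\<^bsub>G\<^esub>) \<in> M"
        using s_comm [of "(single a, \<one>\<^bsub>G\<^esub>)"] a by (simp add: s_eq commutator_base invN)
      then have actD: "act z ?D = ?D" using M_fixed tM by blast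
      have "?D z = ?D \<one>\<^bsub>G\<^esub>" using fun_cong [OF actD, of "\<one>\<^bsub>G\<^esub>"] by (simp del: N_mult)
      then have val: "single a z \<otimes>\<^bsub>A\<^esub> single a (inv\<^bsub>G\<^esub> gs \<otimes>\<^bsub>G\<^esub> z) = a \<otimes>\<^bsub>A\<^esub> single a (inv\<^bsub>G\<^esub> gs)"
        by (simp add: single_apply)
      have gz: "inv\<^bsub>G\<^esub> gs \<otimes>\<^bsub>G\<^esub> z = \<one>\<^bsub>G\<^esub> \<longleftrightarrow> gs = z"
      proof
        assume "inv\<^bsub>G\<^esub> gs \<otimes>\<^bsub>G\<^esub> z = \<one>\<^bsub>G\<^esub>"
        then have "inv\<^bsub>G\<^esub> z = inv\<^bsub>G\<^esub> gs" by (intro G.inv_equality) auto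
        then have "z = inv\<^bsub>G\<^esub> gs" by (simp only: invz)
        then have "inv\<^bsub>G\<^esub> z = inv\<^bsub>G\<^esub> (inv\<^bsub>G\<^esub> gs)" by (rule arg_cong)
        then show "gs = z" by (simp only: invz G.inv_inv fs)
      qed simp
      have g1: "inv\<^bsub>G\<^esub> gs = \<one>\<^bsub>G\<^esub> \<longleftrightarrow> gs = \<one>\<^bsub>G\<^esub>" by (simp add: G.inv_eq_1_iff)
      show ?thesis
      proof (rule ccontr)
        assume "\<not> ?thesis"
        then have "a = \<one>\<^bsub>A\<^esub>" using val a(1) z1 gz g1 by (simp add: single_apply)
        then show False using a(2) by contradiction
      qed
    qed
    \<comment> \<open>Centrality of \<open>k\<close> modulo \<open>M\<close> makes \<open>k \<otimes> act z k\<close> invariant, hence trivial.\<close>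
    have k_M: "(k, \<one>\<^bsub>G\<^esub>) \<in> M" if k: "k \<in> carrier N" and
      k_comm: "\<And>w. w \<in> carrier W \<Longrightarrow> commutator w (k, \<one>\<^bsub>G\<^esub>) \<in> M" for k
    proof -
      define v where "v = k \<otimes>\<^bsub>N\<^esub> act z k"
      have v: "v \<in> carrier N" using k by (simp add: v_def)
      have "act g v = v" if g: "g \<in> carrier G" for g
      proof -
        let ?h = "act g k"
        have h: "?h \<in> carrier N" using k g by simp
        have "(?h \<otimes>\<^bsub>N\<^esub> k, \<one>\<^bsub>G\<^esub>) \<in> M"
          using k_comm [of "(\<one>\<^bsub>N\<^esub>, g)"] k g by (simp add: commutator_top invN)
        then have "act z (?h \<otimes>\<^bsub>N\<^esub> k) = ?h \<otimes>\<^bsub>N\<^esub> k" using M_fixed tM by blast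
        then have eq: "act z ?h \<otimes>\<^bsub>N\<^esub> act z k = ?h \<otimes>\<^bsub>N\<^esub> k" using h k by (simp add: act_mult)
        have "act g v = ?h \<otimes>\<^bsub>N\<^esub> act z ?h"
          using k g central [OF g] by (simp add: v_def act_mult act_act)
        also have "\<dots> = ?h \<otimes>\<^bsub>N\<^esub> ((act z ?h \<otimes>\<^bsub>N\<^esub> act z k) \<otimes>\<^bsub>N\<^esub> act z k)"
          using h k by (simp add: N.m_assoc NN)
        also have "\<dots> = (?h \<otimes>\<^bsub>N\<^esub> ?h) \<otimes>\<^bsub>N\<^esub> (k \<otimes>\<^bsub>N\<^esub> act z k)"
          unfolding eq using h k by (simp add: N.m_assoc)
        also have "\<dots> = v" using h k by (simp add: NN v_def)
        finally show ?thesis .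
      qed
      then have "v = \<one>\<^bsub>N\<^esub>" by (intro invariant v)
      then have "k \<otimes>\<^bsub>N\<^esub> act z k = k \<otimes>\<^bsub>N\<^esub> k" using k by (simp add: v_def NN)
      then have "act z k = k" using k by simp
      then show ?thesis by (rule fixed_M [OF k])
    qed
    have sM: "s \<in> M"
      using gs
    proof
      assume "gs = \<one>\<^bsub>G\<^esub>"
      then show ?thesis using k_M [of fs] s_comm s_eq by simp
    next
      assume gz: "gs = z"
      have st: "s \<otimes>\<^bsub>W\<^esub> t = (fs \<otimes>\<^bsub>N\<^esub> act z f0, \<one>\<^bsub>G\<^esub>)" by (simp add: s_eq t_eq gz)
      have "s \<otimes>\<^bsub>W\<^esub> t \<in> M"
        unfolding st
      proof (rule k_M)
        fix w assume w: "w \<in> carrier W"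
        have "commutator w (s \<otimes>\<^bsub>W\<^esub> t) \<in> M"
          unfolding commutator_mult_right [OF w sW tW]
          by (intro M_mult M_normal s_comm M_comm_in w t sW)
        then show "commutator w (fs \<otimes>\<^bsub>N\<^esub> act z f0, \<one>\<^bsub>G\<^esub>) \<in> M" by (simp only: st)
      qed simp
      then have "s \<otimes>\<^bsub>W\<^esub> t \<otimes>\<^bsub>W\<^esub> inv\<^bsub>W\<^esub> t \<in> M" by (rule M_mult) (rule M_inv [OF t(1)])
      then show ?thesis by (simp add: W.m_assoc)
    qed
    have kill_base: "\<phi> q = \<one>\<^bsub>W\<^esub>" if q: "q \<in> M" "snd q = \<one>\<^bsub>G\<^esub>" for q
    proof -
      obtain m where m: "q = (m, \<one>\<^bsub>G\<^esub>)" "m \<in> carrier N" using q M_closed [OF q(1)] by (cases q) auto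
      have "act z m = m" using M_fixed [of m f0 z] q m tM by simp
      then obtain n where n: "n \<in> carrier N" "m = n \<otimes>\<^bsub>N\<^esub> act z n" using fixed_split m by blast
      have "\<phi> q = commutator (\<phi> (n, \<one>\<^bsub>G\<^esub>)) s"
        using n comm_t [OF n(1)] by (simp add: m s_def commutator_hom [OF \<phi>, symmetric])
      also have "\<dots> = \<one>\<^bsub>W\<^esub>"
        using n MI [of "(n, \<one>\<^bsub>G\<^esub>)"] M_comm [OF _ sM] by (subst commutator_one_iff) auto
      finally show ?thesis .
    qed
    have s_central: "commutator w s = \<one>\<^bsub>W\<^esub>" if w: "w \<in> carrier W" for w
    proof -
      obtain w' where w': "w' \<in> carrier W" "w = \<phi> w'" using surj w by blast
      then have "commutator w s = \<phi> (commutator w' t)" unfolding s_def by (simp add: commutator_hom [OF \<phi>])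
      then show ?thesis using kill_base M_comm_in [OF t(1)] snd_comm_t w' by simp
    qed
    have "gs = \<one>\<^bsub>G\<^esub>"
    proof -
      have "single a \<otimes>\<^bsub>N\<^esub> act gs (single a) = \<one>\<^bsub>N\<^esub>"
        using s_central [of "(single a, \<one>\<^bsub>G\<^esub>)"] a by (simp add: s_eq commutator_base invN one_W)
      from fun_cong [OF this, of "\<one>\<^bsub>G\<^esub>"] show ?thesis
        using a by (auto simp: single_apply G.inv_eq_1_iff split: if_splits)
    qed
    moreover have "fs = \<one>\<^bsub>N\<^esub>"
    proof (rule invariant)
      fix g assume g: "g \<in> carrier G"
      have "act g fs \<otimes>\<^bsub>N\<^esub> inv\<^bsub>N\<^esub> fs = \<one>\<^bsub>N\<^esub>"
        using s_central [of "(\<one>\<^bsub>N\<^esub>, g)"] g \<open>gs = \<one>\<^bsub>G\<^esub>\<close> by (simp add: s_eq commutator_top one_W)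
      then show "act g fs = fs" using g by (metis N.inv_equality N.inv_inv N.inv_closed act_closed fs(1))
    qed simp
    ultimately have s1: "\<phi> t = \<one>\<^bsub>W\<^esub>" using s_eq by (simp add: s_def one_W)
    have kill_M: "\<phi> q = \<one>\<^bsub>W\<^esub>" if q: "q \<in> M" for q
    proof (cases "snd q = \<one>\<^bsub>G\<^esub>")
      case True then show ?thesis using kill_base q by blast
    next
      case False
      then have "snd (q \<otimes>\<^bsub>W\<^esub> inv\<^bsub>W\<^esub> t) = \<one>\<^bsub>G\<^esub>" using snd_M [OF q] q by (auto simp: snd_mult snd_inv t_eq)
      then have "\<phi> (q \<otimes>\<^bsub>W\<^esub> inv\<^bsub>W\<^esub> t) = \<one>\<^bsub>W\<^esub>" by (intro kill_base M_mult M_inv q t)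
      then show ?thesis using q by (simp add: s1)
    qed
    have twice: "\<phi> (\<phi> (f, g)) = \<phi> (\<phi> (\<one>\<^bsub>N\<^esub>, g))" if "f \<in> carrier N" "g \<in> carrier G" for f g
    proof -
      have "\<phi> (f, g) = \<phi> (f, \<one>\<^bsub>G\<^esub>) \<otimes>\<^bsub>W\<^esub> \<phi> (\<one>\<^bsub>N\<^esub>, g)"
        using that by (subst \<phi>.hom_mult [symmetric]) auto
      then show ?thesis using that kill_M MI [of "(f, \<one>\<^bsub>G\<^esub>)"] by simp
    qed
    have twice_surj: "\<exists>g\<in>carrier G. \<phi> (\<phi> (\<one>\<^bsub>N\<^esub>, g)) = w" if w: "w \<in> carrier W" for w
    proof -
      from w have "w \<in> \<phi> ` carrier W" by (simp only: surj)
      then obtain w1 where w1: "w = \<phi> w1" "w1 \<in> carrier W" by (rule imageE)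
      from w1(2) have "w1 \<in> \<phi> ` carrier W" by (simp only: surj)
      then obtain w2 where w2: "w1 = \<phi> w2" "w2 \<in> carrier W" by (rule imageE)
      have "\<phi> (\<phi> (\<one>\<^bsub>N\<^esub>, snd w2)) = \<phi> (\<phi> (fst w2, snd w2))"
        using w2(2) by (intro twice [symmetric]) auto
      then have "\<phi> (\<phi> (\<one>\<^bsub>N\<^esub>, snd w2)) = w" using w1(1) w2(1) by simp
      then show ?thesis using w2(2) by (intro bexI [of _ "snd w2"]) auto
    qed
    define \<sigma> where "\<sigma> = (\<lambda>g. snd (\<phi> (\<phi> (\<one>\<^bsub>N\<^esub>, g))))"
    have "\<sigma> \<in> hom G G"
    proof (rule homI)
      fix g h assume gh: "g \<in> carrier G" "h \<in> carrier G"
      have "(\<one>\<^bsub>N\<^esub>, g \<otimes>\<^bsub>G\<^esub> h) = (\<one>\<^bsub>N\<^esub>, g) \<otimes>\<^bsub>W\<^esub> (\<one>\<^bsub>N\<^esub>, h)" using gh by simp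
      then have "\<phi> (\<phi> (\<one>\<^bsub>N\<^esub>, g \<otimes>\<^bsub>G\<^esub> h)) = \<phi> (\<phi> (\<one>\<^bsub>N\<^esub>, g)) \<otimes>\<^bsub>W\<^esub> \<phi> (\<phi> (\<one>\<^bsub>N\<^esub>, h))"
        using gh by (simp del: mult_W)
      then show "\<sigma> (g \<otimes>\<^bsub>G\<^esub> h) = \<sigma> g \<otimes>\<^bsub>G\<^esub> \<sigma> h" by (simp only: \<sigma>_def snd_mult)
    qed (simp add: \<sigma>_def)
    moreover have "\<sigma> ` carrier G = carrier G"
    proof (intro equalityI subsetI)
      fix g assume "g \<in> carrier G"
      then obtain h where "h \<in> carrier G" "\<phi> (\<phi> (\<one>\<^bsub>N\<^esub>, h)) = (\<one>\<^bsub>N\<^esub>, g)"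
        using twice_surj [of "(\<one>\<^bsub>N\<^esub>, g)"] by auto
      then show "g \<in> \<sigma> ` carrier G" by (force simp: \<sigma>_def)
    qed (auto simp: \<sigma>_def)
    ultimately have "inj_on \<sigma> (carrier G)" using hopf unfolding hopfian_def iso_def bij_betw_def by blast
    moreover obtain g where g: "g \<in> carrier G" "\<phi> (\<phi> (\<one>\<^bsub>N\<^esub>, g)) = (single a, \<one>\<^bsub>G\<^esub>)"
      using twice_surj [of "(single a, \<one>\<^bsub>G\<^esub>)"] a by auto
    moreover have one: "\<phi> (\<phi> (\<one>\<^bsub>N\<^esub>, \<one>\<^bsub>G\<^esub>)) = (\<one>\<^bsub>N\<^esub>, \<one>\<^bsub>G\<^esub>)" using \<phi>.hom_one by (simp add: one_W)
    ultimately have "g = \<one>\<^bsub>G\<^esub>" by (intro inj_onD [of \<sigma> "carrier G" g]) (auto simp: \<sigma>_def)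
    then have "single a = \<one>\<^bsub>N\<^esub>" using g one by simp
    from fun_cong [OF this, of "\<one>\<^bsub>G\<^esub>"] have False using a by (simp add: single_apply)
    then show ?thesis ..
  qed
qed

theorem hopfian_wreath_iff:
  assumes "finitely_generated_group A"
  shows "hopfian W \<longleftrightarrow> hopfian G \<and> base_hopfian"
proof (intro iffI conjI)
  assume *: "hopfian G \<and> base_hopfian"
  show "hopfian W"
    unfolding hopfian_def
  proof (intro conjI ballI impI W.is_group)
    fix \<phi> assume \<phi>: "\<phi> \<in> hom W W" and surj: "\<phi> ` carrier W = carrier W"
    have "inj_on \<phi> (carrier W)"
      using inj_of_base_preserved inj_of_base_not_preserved assms * \<phi> surj by blast
    then show "\<phi> \<in> iso W W" using \<phi> surj by (simp add: iso_def bij_betw_def)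
  qed
qed (auto intro: hopfian_top hopfian_base)

end

section \<open>Presentations by generators of prescribed orders\<close>

definition coeffs :: "'i set \<Rightarrow> ('i \<Rightarrow> int) set" where
  "coeffs I = {u. finite {k. u k \<noteq> 0} \<and> {k. u k \<noteq> 0} \<subseteq> I}"

text \<open>
  \<open>\<kappa>\<close> evaluates a finitely supported vector of exponents in the abelian group \<open>A\<close>, and \<open>A\<close> is the direct
  sum of cyclic groups of orders \<open>n k\<close>, where \<open>0\<close> stands for an infinite cyclic group.
\<close>

definition presents ::
  "('a, 'm) monoid_scheme \<Rightarrow> 'i set \<Rightarrow> ('i \<Rightarrow> nat) \<Rightarrow> (('i \<Rightarrow> int) \<Rightarrow> 'a) \<Rightarrow> bool" where
  "presents A I n \<kappa> \<longleftrightarrow>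
     (\<forall>u\<in>coeffs I. \<forall>v\<in>coeffs I. \<kappa> (u + v) = \<kappa> u \<otimes>\<^bsub>A\<^esub> \<kappa> v) \<and>
     \<kappa> ` coeffs I = carrier A \<and>
     (\<forall>u\<in>coeffs I. \<kappa> u = \<one>\<^bsub>A\<^esub> \<longleftrightarrow> (\<forall>k\<in>I. int (n k) dvd u k))"

lemma coeffsI: "finite S \<Longrightarrow> S \<subseteq> I \<Longrightarrow> (\<And>k. k \<notin> S \<Longrightarrow> u k = 0) \<Longrightarrow> u \<in> coeffs I"
proof -
  assume "finite S" "S \<subseteq> I" and *: "\<And>k. k \<notin> S \<Longrightarrow> u k = 0"
  moreover have "{k. u k \<noteq> 0} \<subseteq> S" using * by blast
  ultimately show ?thesis by (auto simp: coeffs_def intro: finite_subset)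
qed

lemma coeffs_finite: "u \<in> coeffs I \<Longrightarrow> finite {k. u k \<noteq> 0}"
  and coeffs_outside: "u \<in> coeffs I \<Longrightarrow> k \<notin> I \<Longrightarrow> u k = 0"
  by (auto simp: coeffs_def)

lemma coeffs_zero [simp]: "0 \<in> coeffs I" "(\<lambda>_. 0) \<in> coeffs I"
  by (auto simp: coeffs_def)

lemma coeffs_add [simp]: "u \<in> coeffs I \<Longrightarrow> v \<in> coeffs I \<Longrightarrow> u + v \<in> coeffs I"
  by (rule coeffsI [of "{k. u k \<noteq> 0} \<union> {k. v k \<noteq> 0}"]) (auto simp: coeffs_def)

lemma coeffs_diff [simp]: "u \<in> coeffs I \<Longrightarrow> v \<in> coeffs I \<Longrightarrow> u - v \<in> coeffs I"
  by (rule coeffsI [of "{k. u k \<noteq> 0} \<union> {k. v k \<noteq> 0}"]) (auto simp: coeffs_def)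

lemma coeffs_delta [simp]: "k \<in> I \<Longrightarrow> delta k \<in> coeffs I"
  by (rule coeffsI [of "{k}"]) (auto simp: delta_def)

lemma coeffs_vimage:
  assumes "u \<in> coeffs J" "inj h" "\<And>i. h i \<in> J \<Longrightarrow> i \<in> I"
  shows "(\<lambda>i. u (h i)) \<in> coeffs I"
proof (rule coeffsI)
  show "finite (h -` {k. u k \<noteq> 0})"
    by (rule finite_vimageI [OF coeffs_finite [OF assms(1)] assms(2)])
qed (use assms coeffs_outside [OF assms(1)] in auto)

lemma presents_add: "presents A I n \<kappa> \<Longrightarrow> u \<in> coeffs I \<Longrightarrow> v \<in> coeffs I \<Longrightarrow> \<kappa> (u + v) = \<kappa> u \<otimes>\<^bsub>A\<^esub> \<kappa> v"
  and presents_closed: "presents A I n \<kappa> \<Longrightarrow> u \<in> coeffs I \<Longrightarrow> \<kappa> u \<in> carrier A"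
  by (auto simp: presents_def)

lemma presents_one:
  "presents A I n \<kappa> \<Longrightarrow> u \<in> coeffs I \<Longrightarrow> \<kappa> u = \<one>\<^bsub>A\<^esub> \<longleftrightarrow> (\<forall>k\<in>I. int (n k) dvd u k)"
proof -
  assume "presents A I n \<kappa>" and u: "u \<in> coeffs I"
  then have "\<forall>u\<in>coeffs I. \<kappa> u = \<one>\<^bsub>A\<^esub> \<longleftrightarrow> (\<forall>k\<in>I. int (n k) dvd u k)"
    unfolding presents_def by (elim conjE)
  from bspec [OF this u] show ?thesis .
qed

lemma presents_surj:
  assumes "presents A I n \<kappa>" "a \<in> carrier A" shows "\<exists>u\<in>coeffs I. \<kappa> u = a"
proof -
  have "a \<in> \<kappa> ` coeffs I" using assms by (simp add: presents_def)
  then show ?thesis by (rule imageE) auto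
qed

lemma presents_zero: "presents A I n \<kappa> \<Longrightarrow> \<kappa> 0 = \<one>\<^bsub>A\<^esub>"
  by (simp add: presents_one)

lemma presentsI:
  assumes "\<And>u v. u \<in> coeffs I \<Longrightarrow> v \<in> coeffs I \<Longrightarrow> \<kappa> (u + v) = \<kappa> u \<otimes>\<^bsub>A\<^esub> \<kappa> v"
    and "\<And>u. u \<in> coeffs I \<Longrightarrow> \<kappa> u \<in> carrier A"
    and "\<And>a. a \<in> carrier A \<Longrightarrow> \<exists>u\<in>coeffs I. \<kappa> u = a"
    and "\<And>u. u \<in> coeffs I \<Longrightarrow> \<kappa> u = \<one>\<^bsub>A\<^esub> \<longleftrightarrow> (\<forall>k\<in>I. int (n k) dvd u k)"
  shows "presents A I n \<kappa>"
  unfolding presents_def using assms by blast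

lemma presents_iso:
  assumes \<kappa>: "presents A I n \<kappa>" and h: "h \<in> iso A A'" and "group A" "group A'"
  shows "presents A' I n (h \<circ> \<kappa>)"
proof -
  interpret h: group_hom A A' h
    using assms by (simp add: group_hom_def group_hom_axioms_def iso_def)
  have bij: "bij_betw h (carrier A) (carrier A')" using h by (simp add: iso_def)
  show ?thesis
  proof (rule presentsI)
    fix u assume u: "u \<in> coeffs I"
    note \<kappa>u = presents_closed [OF \<kappa> u]
    show "(h \<circ> \<kappa>) u \<in> carrier A'" using \<kappa>u by simp
    have "h (\<kappa> u) = \<one>\<^bsub>A'\<^esub> \<longleftrightarrow> \<kappa> u = \<one>\<^bsub>A\<^esub>"
      using h.inj_on_one_iff [THEN iffD1, OF bij_betw_imp_inj_on [OF bij]] \<kappa>u by auto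
    then show "(h \<circ> \<kappa>) u = \<one>\<^bsub>A'\<^esub> \<longleftrightarrow> (\<forall>k\<in>I. int (n k) dvd u k)"
      by (simp add: presents_one [OF \<kappa> u])
    fix v assume v: "v \<in> coeffs I"
    show "(h \<circ> \<kappa>) (u + v) = (h \<circ> \<kappa>) u \<otimes>\<^bsub>A'\<^esub> (h \<circ> \<kappa>) v"
      using \<kappa>u presents_closed [OF \<kappa> v] by (simp add: presents_add [OF \<kappa> u v])
  next
    fix a assume "a \<in> carrier A'"
    then have "a \<in> h ` carrier A" using bij by (simp add: bij_betw_def)
    then obtain b where b: "a = h b" "b \<in> carrier A" by (rule imageE)
    obtain u where "u \<in> coeffs I" "\<kappa> u = b" using presents_surj [OF \<kappa> b(2)] by blast
    then show "\<exists>u\<in>coeffs I. (h \<circ> \<kappa>) u = a" using b by (intro bexI [of _ u]) auto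
  qed
qed

lemma presents_DirProd:
  assumes \<kappa>: "presents A I n \<kappa>" and \<kappa>': "presents A' I' n' \<kappa>'"
  shows "presents (A \<times>\<times> A') (Inl ` I \<union> Inr ` I') (case_sum n n')
    (\<lambda>u. (\<kappa> (\<lambda>i. u (Inl i)), \<kappa>' (\<lambda>i. u (Inr i))))"
    (is "presents _ ?I _ _")
proof (rule presentsI)
  have l: "(\<lambda>i. u (Inl i)) \<in> coeffs I" and r: "(\<lambda>i. u (Inr i)) \<in> coeffs I'" if "u \<in> coeffs ?I" for u
    using coeffs_vimage [OF that, of Inl I] coeffs_vimage [OF that, of Inr I'] by auto
  fix u assume u: "u \<in> coeffs ?I"
  show "(\<kappa> (\<lambda>i. u (Inl i)), \<kappa>' (\<lambda>i. u (Inr i))) \<in> carrier (A \<times>\<times> A')"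
    using presents_closed [OF \<kappa> l [OF u]] presents_closed [OF \<kappa>' r [OF u]] by simp
  show "(\<kappa> (\<lambda>i. u (Inl i)), \<kappa>' (\<lambda>i. u (Inr i))) = \<one>\<^bsub>A \<times>\<times> A'\<^esub>
      \<longleftrightarrow> (\<forall>k\<in>?I. int (case_sum n n' k) dvd u k)"
    by (simp add: presents_one [OF \<kappa> l [OF u]] presents_one [OF \<kappa>' r [OF u]] ball_Un)
  fix v assume v: "v \<in> coeffs ?I"
  show "(\<kappa> (\<lambda>i. (u + v) (Inl i)), \<kappa>' (\<lambda>i. (u + v) (Inr i)))
     = (\<kappa> (\<lambda>i. u (Inl i)), \<kappa>' (\<lambda>i. u (Inr i))) \<otimes>\<^bsub>A \<times>\<times> A'\<^esub> (\<kappa> (\<lambda>i. v (Inl i)), \<kappa>' (\<lambda>i. v (Inr i)))"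
    using presents_add [OF \<kappa> l [OF u] l [OF v]] presents_add [OF \<kappa>' r [OF u] r [OF v]]
    by (simp add: plus_fun_def)
next
  fix a assume "a \<in> carrier (A \<times>\<times> A')"
  then obtain b c where a: "a = (b, c)" "b \<in> carrier A" "c \<in> carrier A'" by auto
  obtain v w where v: "v \<in> coeffs I" "\<kappa> v = b" and w: "w \<in> coeffs I'" "\<kappa>' w = c"
    using presents_surj [OF \<kappa> a(2)] presents_surj [OF \<kappa>' a(3)] by blast
  have "case_sum v w \<in> coeffs ?I"
  proof (rule coeffsI)
    show "finite (Inl ` {i. v i \<noteq> 0} \<union> Inr ` {i. w i \<noteq> 0})"
      using coeffs_finite [OF v(1)] coeffs_finite [OF w(1)] by simp
    show "Inl ` {i. v i \<noteq> 0} \<union> Inr ` {i. w i \<noteq> 0} \<subseteq> ?I"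
      using coeffs_outside [OF v(1)] coeffs_outside [OF w(1)] by blast
  qed (auto simp: image_iff split: sum.splits)
  then show "\<exists>u\<in>coeffs ?I. (\<kappa> (\<lambda>i. u (Inl i)), \<kappa>' (\<lambda>i. u (Inr i))) = a"
    using v w a by (intro bexI [of _ "case_sum v w"]) auto
qed

lemma restrict_eq_iff: "restrict f K = restrict h K \<longleftrightarrow> (\<forall>k\<in>K. f k = h k)"
  by (auto simp: fun_eq_iff restrict_def)

lemma presents_sum_group:
  assumes gr: "\<And>k. k \<in> K \<Longrightarrow> group (H k)"
    and \<kappa>: "\<And>k. k \<in> K \<Longrightarrow> presents (H k) (I k) (n k) (\<kappa> k)"
  shows "presents (sum_group K H) (Sigma K I) (\<lambda>(k, i). n k i) (\<lambda>u. \<lambda>k\<in>K. \<kappa> k (\<lambda>i. u (k, i)))"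
proof (rule presentsI)
  have slice: "(\<lambda>i. u (k, i)) \<in> coeffs (I k)" if "u \<in> coeffs (Sigma K I)" for u k
    by (rule coeffs_vimage [OF that]) (auto simp: inj_def)
  fix u assume u: "u \<in> coeffs (Sigma K I)"
  have one: "\<kappa> k (\<lambda>i. u (k, i)) = \<one>\<^bsub>H k\<^esub> \<longleftrightarrow> (\<forall>i\<in>I k. int (n k i) dvd u (k, i))" if "k \<in> K" for k
    by (rule presents_one [OF \<kappa> [OF that] slice [OF u]])
  have "{k \<in> K. (\<lambda>k\<in>K. \<kappa> k (\<lambda>i. u (k, i))) k \<noteq> \<one>\<^bsub>H k\<^esub>} \<subseteq> fst ` {z. u z \<noteq> 0}"
  proof
    fix k assume k: "k \<in> {k \<in> K. (\<lambda>k\<in>K. \<kappa> k (\<lambda>i. u (k, i))) k \<noteq> \<one>\<^bsub>H k\<^esub>}"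
    then obtain i where "\<not> int (n k i) dvd u (k, i)" using one [of k] by auto
    then have "(k, i) \<in> {z. u z \<noteq> 0}" by auto
    then show "k \<in> fst ` {z. u z \<noteq> 0}" by (rule rev_image_eqI) simp
  qed
  then have "finite {k \<in> K. (\<lambda>k\<in>K. \<kappa> k (\<lambda>i. u (k, i))) k \<noteq> \<one>\<^bsub>H k\<^esub>}"
    by (rule finite_subset) (use coeffs_finite [OF u] in simp)
  then show "(\<lambda>k\<in>K. \<kappa> k (\<lambda>i. u (k, i))) \<in> carrier (sum_group K H)"
    using presents_closed [OF \<kappa> slice [OF u]] by (subst carrier_sum_group) (auto simp: gr)
  have "(\<lambda>k\<in>K. \<kappa> k (\<lambda>i. u (k, i))) = \<one>\<^bsub>sum_group K H\<^esub> \<longleftrightarrow> (\<forall>k\<in>K. \<kappa> k (\<lambda>i. u (k, i)) = \<one>\<^bsub>H k\<^esub>)"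
    unfolding one_sum_group by (rule restrict_eq_iff)
  then show "(\<lambda>k\<in>K. \<kappa> k (\<lambda>i. u (k, i))) = \<one>\<^bsub>sum_group K H\<^esub>
      \<longleftrightarrow> (\<forall>z\<in>Sigma K I. int ((\<lambda>(k, i). n k i) z) dvd u z)"
    using one by auto
  fix v assume v: "v \<in> coeffs (Sigma K I)"
  show "(\<lambda>k\<in>K. \<kappa> k (\<lambda>i. (u + v) (k, i)))
      = (\<lambda>k\<in>K. \<kappa> k (\<lambda>i. u (k, i))) \<otimes>\<^bsub>sum_group K H\<^esub> (\<lambda>k\<in>K. \<kappa> k (\<lambda>i. v (k, i)))"
    using presents_add [OF \<kappa> slice [OF u] slice [OF v]]
    by (auto simp: plus_fun_def intro!: restrict_ext)
next
  fix a assume "a \<in> carrier (sum_group K H)"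
  then have a: "a \<in> (\<Pi>\<^sub>E k\<in>K. carrier (H k))" "finite {k \<in> K. a k \<noteq> \<one>\<^bsub>H k\<^esub>}"
    by (auto simp: carrier_sum_group gr)
  have "\<forall>k\<in>K. \<exists>w. w \<in> coeffs (I k) \<and> \<kappa> k w = a k"
    using presents_surj [OF \<kappa>] a(1) by (meson PiE_mem)
  then obtain w where w: "\<And>k. k \<in> K \<Longrightarrow> w k \<in> coeffs (I k)" "\<And>k. k \<in> K \<Longrightarrow> \<kappa> k (w k) = a k"
    by metis
  let ?S = "{k \<in> K. a k \<noteq> \<one>\<^bsub>H k\<^esub>}"
  define u where "u = (\<lambda>(k, i). if k \<in> ?S then w k i else 0)"
  have "u \<in> coeffs (Sigma K I)"
  proof (rule coeffsI)
    show "finite (Sigma ?S (\<lambda>k. {i. w k i \<noteq> 0}))"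
      using a(2) coeffs_finite [OF w(1)] by auto
    show "Sigma ?S (\<lambda>k. {i. w k i \<noteq> 0}) \<subseteq> Sigma K I"
      using coeffs_outside [OF w(1)] by blast
    show "u z = 0" if "z \<notin> Sigma ?S (\<lambda>k. {i. w k i \<noteq> 0})" for z
      using that by (cases z) (auto simp: u_def)
  qed
  moreover have "(\<lambda>k\<in>K. \<kappa> k (\<lambda>i. u (k, i))) = a"
  proof (rule PiE_ext [OF _ a(1)])
    have "\<kappa> k (\<lambda>i. u (k, i)) = a k" if k: "k \<in> K" for k
      using k w presents_zero [OF \<kappa> [OF k]] by (cases "k \<in> ?S") (auto simp: u_def zero_fun_def)
    then show "\<And>k. k \<in> K \<Longrightarrow> (\<lambda>k\<in>K. \<kappa> k (\<lambda>i. u (k, i))) k = a k"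
      and "(\<lambda>k\<in>K. \<kappa> k (\<lambda>i. u (k, i))) \<in> (\<Pi>\<^sub>E k\<in>K. carrier (H k))" using a(1) by auto
  qed
  ultimately show "\<exists>u\<in>coeffs (Sigma K I). (\<lambda>k\<in>K. \<kappa> k (\<lambda>i. u (k, i))) = a" by blast
qed

lemma presents_integer_mod_group:
  assumes "0 < n" shows "presents (integer_mod_group n) {()} (\<lambda>_. n) (\<lambda>u. u () mod int n)"
proof (rule presentsI)
  fix a assume "a \<in> carrier (integer_mod_group n)"
  then have "(\<lambda>_. a) \<in> coeffs {()}" "a mod int n = a"
    using assms by (auto simp: carrier_integer_mod_group coeffs_def)
  then show "\<exists>u\<in>coeffs {()}. u () mod int n = a" by (intro bexI [of _ "\<lambda>_. a"])
qed (use assms in \<open>auto simp: carrier_integer_mod_group mod_simps dvd_eq_mod_eq_0\<close>)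

lemma presents_free_Abelian_group: "presents (free_Abelian_group B) B (\<lambda>_. 0) Abs_poly_mapping"
proof (rule presentsI)
  have lookup: "poly_mapping.lookup (Abs_poly_mapping u) = u" if "u \<in> coeffs B" for u
    using coeffs_finite [OF that] by simp
  fix u assume u: "u \<in> coeffs B"
  show "Abs_poly_mapping u \<in> carrier (free_Abelian_group B)"
    using u by (simp add: coeffs_def keys.rep_eq lookup [OF u])
  show "Abs_poly_mapping u = \<one>\<^bsub>free_Abelian_group B\<^esub> \<longleftrightarrow> (\<forall>k\<in>B. int 0 dvd u k)"
    using coeffs_outside [OF u] by (auto simp: poly_mapping_eq_iff lookup [OF u] fun_eq_iff)
  fix v assume v: "v \<in> coeffs B"
  show "Abs_poly_mapping (u + v) = Abs_poly_mapping u \<otimes>\<^bsub>free_Abelian_group B\<^esub> Abs_poly_mapping v"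
    unfolding mult_free_Abelian_group
  proof (rule poly_mapping_eqI)
    fix k
    show "poly_mapping.lookup (Abs_poly_mapping (u + v)) k
        = poly_mapping.lookup (Abs_poly_mapping u + Abs_poly_mapping v) k"
      unfolding lookup_add lookup [OF u] lookup [OF v] lookup [OF coeffs_add [OF u v]] by simp
  qed
next
  fix a assume "a \<in> carrier (free_Abelian_group B)"
  then have "poly_mapping.lookup a \<in> coeffs B" by (auto simp: coeffs_def in_keys_iff)
  then show "\<exists>u\<in>coeffs B. Abs_poly_mapping u = a"
    by (intro bexI [of _ "poly_mapping.lookup a"]) auto
qed

text \<open>
  Finitely many generators involve only finitely many coordinates. If a coordinate of infinite order
  were not among them, it would vanish on the generated subgroup.
\<close>

lemma presents_fg_finite_rank:
  fixes I :: "'b set"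
  assumes \<kappa>: "presents A I n \<kappa>" and A: "comm_group A" and fg: "finitely_generated_group A"
  shows "finite {k \<in> I. n k = 0}"
proof -
  interpret A: comm_group A by (rule A)
  obtain S where S: "finite S" "S \<subseteq> carrier A" "generate A S = carrier A"
    using fg unfolding finitely_generated_group_def by blast
  have "\<forall>s\<in>S. \<exists>u. u \<in> coeffs I \<and> \<kappa> u = s" using presents_surj [OF \<kappa>] S(2) by blast
  then obtain w where w: "\<And>s. s \<in> S \<Longrightarrow> w s \<in> coeffs I" "\<And>s. s \<in> S \<Longrightarrow> \<kappa> (w s) = s" by metis
  have "{k \<in> I. n k = 0} \<subseteq> (\<Union>s\<in>S. {k. w s k \<noteq> 0})"
  proof (rule subsetI, rule ccontr)
    fix k assume k: "k \<in> {k \<in> I. n k = 0}" and "k \<notin> (\<Union>s\<in>S. {k. w s k \<noteq> 0})"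
    then have wk: "w s k = 0" if "s \<in> S" for s using that by blast
    have "\<exists>u\<in>coeffs I. u k = 0 \<and> \<kappa> u = a" if "a \<in> generate A S" for a
      using that
    proof (induction a rule: generate.induct)
      case one
      have "0 \<in> coeffs I" "(0 :: 'b \<Rightarrow> int) k = 0" by simp_all
      then show ?case using presents_zero [OF \<kappa>] by blast
    next
      case (incl h) then show ?case using w wk by blast
    next
      case (inv h)
      have "0 - w h \<in> coeffs I" by (rule coeffs_diff [OF coeffs_zero(1) w(1) [OF inv]])
      moreover have "\<kappa> (0 - w h) = inv\<^bsub>A\<^esub> h"
      proof (rule A.inv_equality [symmetric])
        have "\<kappa> (0 - w h) \<otimes>\<^bsub>A\<^esub> \<kappa> (w h) = \<kappa> (0 - w h + w h)"
          by (rule presents_add [OF \<kappa> calculation w(1) [OF inv], symmetric])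
        then show "\<kappa> (0 - w h) \<otimes>\<^bsub>A\<^esub> h = \<one>\<^bsub>A\<^esub>"
          using w(2) [OF inv] by (simp only: diff_add_cancel presents_zero [OF \<kappa>])
      qed (use inv S w presents_closed [OF \<kappa>] calculation in auto)
      moreover have "(0 - w h) k = 0" using wk [OF inv] by simp
      ultimately show ?case by blast
    next
      case (eng h1 h2)
      then obtain u v where "u \<in> coeffs I" "u k = 0" "\<kappa> u = h1" "v \<in> coeffs I" "v k = 0" "\<kappa> v = h2" by blast
      then have "\<kappa> (u + v) = h1 \<otimes>\<^bsub>A\<^esub> h2" "u + v \<in> coeffs I" "(u + v) k = 0"
        using presents_add [OF \<kappa>, of u v] by simp_all
      then show ?case by blast
    qed
    then obtain u where u: "u \<in> coeffs I" "u k = 0" "\<kappa> u = \<kappa> (delta k)"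
      using presents_closed [OF \<kappa>, of "delta k"] k unfolding S(3) by auto
    have d: "delta k - u \<in> coeffs I" using u k by (intro coeffs_diff coeffs_delta) auto
    have "\<kappa> (delta k - u) \<otimes>\<^bsub>A\<^esub> \<kappa> u = \<kappa> (delta k)"
      using presents_add [OF \<kappa> d u(1)] by (simp only: diff_add_cancel)
    then have "\<kappa> (delta k - u) = \<one>\<^bsub>A\<^esub>"
      unfolding u(3) [symmetric] using presents_closed [OF \<kappa> u(1)] presents_closed [OF \<kappa> d] by simp
    then have "int (n k) dvd (delta k - u) k" using presents_one [OF \<kappa> d] k by blast
    then show False using k u by (simp add: delta_def)
  qed
  then show ?thesis by (rule finite_subset) (use S(1) w coeffs_finite in blast)
qed

section \<open>The base group as a quotient of a free module\<close>

lemma (in group) free_module_induct: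
  fixes I :: "'i set"
  assumes f: "f \<in> free_module I"
    and zero: "P 0"
    and add: "\<And>f h. f \<in> free_module I \<Longrightarrow> h \<in> free_module I \<Longrightarrow> P f \<Longrightarrow> P h \<Longrightarrow> P (f + h)"
    and diff: "\<And>f h. f \<in> free_module I \<Longrightarrow> h \<in> free_module I \<Longrightarrow> P f \<Longrightarrow> P h \<Longrightarrow> P (f - h)"
    and delta: "\<And>k y. k \<in> I \<Longrightarrow> y \<in> carrier G \<Longrightarrow> P (delta (k, y))"
  shows "P f"
proof -
  have scale: "P (\<lambda>w. c * delta z w)" if z: "z \<in> I \<times> carrier G" for z and c
  proof (induction c rule: int_induct_plus_minus)
    case 1 show ?case using zero by (simp add: zero_fun_def)
  next
    case (2 m)
    have "(\<lambda>w. (m + 1) * delta z w) = (\<lambda>w. m * delta z w) + delta z" by (auto simp: distrib_right)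
    then show ?case using z 2 delta by (auto intro!: add)
  next
    case (3 m)
    have "(\<lambda>w. (m - 1) * delta z w) = (\<lambda>w. m * delta z w) - delta z"
      by (auto simp: fun_eq_iff left_diff_distrib)
    moreover have "P ((\<lambda>w. m * delta z w) - delta z)"
      using z 3 delta by (intro diff) auto
    ultimately show ?case by simp
  qed
  have "P (\<lambda>w. \<Sum>z\<in>S. f z * delta z w)" if "finite S" "S \<subseteq> I \<times> carrier G" for S
    using that
  proof (induction S)
    case empty show ?case using zero by (simp add: zero_fun_def)
  next
    case (insert z S)
    have "(\<lambda>w. \<Sum>z\<in>insert z S. f z * delta z w) = (\<lambda>w. f z * delta z w) + (\<lambda>w. \<Sum>z\<in>S. f z * delta z w)"
      using insert by (auto simp: fun_eq_iff)
    moreover have "P ((\<lambda>w. f z * delta z w) + (\<lambda>w. \<Sum>z\<in>S. f z * delta z w))"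
      using insert by (intro add free_module_sum scale) auto
    ultimately show ?case by simp
  qed
  then have "P (\<lambda>w. \<Sum>z | f z \<noteq> 0. f z * delta z w)"
    using free_module_finite [OF f] free_module_subset [OF f] .
  moreover have "f = (\<lambda>w. \<Sum>z | f z \<noteq> 0. f z * delta z w)"
    by (rule module_expand) (use free_module_finite [OF f] in auto)
  ultimately show ?thesis by simp
qed

context abelian_wreath
begin

text \<open>
  Applying \<open>\<kappa>\<close> at each point of \<open>G\<close> is an equivariant homomorphism \<open>q\<close> from the free module onto the
  base group, with the relations as kernel. Endomorphisms of the base lift along \<open>q\<close> since the module is
  free, and endomorphisms preserving the relations descend.
\<close>

theorem base_hopfian_iff_hopfian_mod:
  fixes I :: "'i set"
  assumes \<kappa>: "presents A I n \<kappa>"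
  shows "base_hopfian \<longleftrightarrow> G.hopfian_mod I n"
proof -
  let ?V = "G.free_module I" and ?K = "G.relations I n"
  define q where "q = (\<lambda>f. \<lambda>x\<in>carrier G. \<kappa> (\<lambda>k. f (k, x)))"
  have slice: "(\<lambda>k. f (k, x)) \<in> coeffs I" if "f \<in> ?V" for f x
  proof (rule coeffsI)
    show "finite (fst ` {z. f z \<noteq> 0})" using G.free_module_finite [OF that] by simp
    show "fst ` {z. f z \<noteq> 0} \<subseteq> I" using G.free_module_subset [OF that] by auto
  qed (force simp: image_iff)
  have q_closed [simp]: "q f \<in> carrier N" if f: "f \<in> ?V" for f
  proof (rule N_closedI)
    show "finite (snd ` {z. f z \<noteq> 0})" using G.free_module_finite [OF f] by simp
    fix x assume x: "x \<in> carrier G"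
    show "q f x \<in> carrier A" using x presents_closed [OF \<kappa> slice [OF f]] by (simp add: q_def)
    assume "x \<notin> snd ` {z. f z \<noteq> 0}"
    then have "(\<lambda>k. f (k, x)) = 0" by (force simp: image_iff fun_eq_iff)
    then show "q f x = \<one>\<^bsub>A\<^esub>" using x presents_zero [OF \<kappa>] by (simp add: q_def)
  qed (simp add: q_def)
  have q_add: "q (f + h) = q f \<otimes>\<^bsub>N\<^esub> q h" if f: "f \<in> ?V" and h: "h \<in> ?V" for f h
  proof (rule N_ext)
    fix x assume x: "x \<in> carrier G"
    then show "q (f + h) x = (q f \<otimes>\<^bsub>N\<^esub> q h) x"
      using presents_add [OF \<kappa> slice [OF f] slice [OF h], of x x] by (simp add: q_def plus_fun_def)
  qed (use f h in auto)
  have q_shift: "q (G.shift g f) = act g (q f)" if "f \<in> ?V" "g \<in> carrier G" for f g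
  proof (rule N_ext)
    fix x assume x: "x \<in> carrier G"
    then show "q (G.shift g f) x = act g (q f) x" using that by (simp add: q_def G.shift_def)
  qed (use that in auto)
  have q_zero: "q 0 = \<one>\<^bsub>N\<^esub>"
  proof (rule N_ext)
    fix x assume "x \<in> carrier G"
    then show "q 0 x = \<one>\<^bsub>N\<^esub> x" using presents_zero [OF \<kappa>] by (simp add: q_def zero_fun_def)
  qed auto
  have q_one: "q f = \<one>\<^bsub>N\<^esub> \<longleftrightarrow> f \<in> ?K" if f: "f \<in> ?V" for f
  proof -
    have "q f = \<one>\<^bsub>N\<^esub> \<longleftrightarrow> (\<forall>x\<in>carrier G. q f x = \<one>\<^bsub>A\<^esub>)"
      using N_ext [OF q_closed [OF f] N.one_closed] by auto
    also have "\<dots> \<longleftrightarrow> (\<forall>x\<in>carrier G. \<forall>k\<in>I. int (n k) dvd f (k, x))"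
      using presents_one [OF \<kappa> slice [OF f]] by (simp add: q_def)
    also have "\<dots> \<longleftrightarrow> f \<in> ?K"
      unfolding G.relations_def
    proof (intro iffI CollectI conjI allI f)
      fix z assume *: "\<forall>x\<in>carrier G. \<forall>k\<in>I. int (n k) dvd f (k, x)"
      show "int (n (fst z)) dvd f z"
        using * G.free_module_outside [OF f, of z] by (cases z; cases "z \<in> I \<times> carrier G") auto
    qed auto
    finally show ?thesis .
  qed
  have q_diff: "q f = q h \<longleftrightarrow> f - h \<in> ?K" if f: "f \<in> ?V" and h: "h \<in> ?V" for f h
  proof -
    have d: "f - h \<in> ?V" using f h by (rule G.free_module_diff)
    have "q f = q (f - h) \<otimes>\<^bsub>N\<^esub> q h" using q_add [OF d h] by (simp only: diff_add_cancel)
    then have "q f = q h \<longleftrightarrow> q (f - h) = \<one>\<^bsub>N\<^esub>" using d h by simp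
    then show ?thesis by (simp only: q_one [OF d])
  qed
  have q_surj: "\<exists>f\<in>?V. q f = a" if a: "a \<in> carrier N" for a
  proof -
    have "\<forall>x\<in>carrier G. \<exists>w. w \<in> coeffs I \<and> \<kappa> w = a x" using presents_surj [OF \<kappa>] N_value [OF a] by blast
    then obtain w where w: "\<And>x. x \<in> carrier G \<Longrightarrow> w x \<in> coeffs I" "\<And>x. x \<in> carrier G \<Longrightarrow> \<kappa> (w x) = a x"
      by metis
    let ?S = "{x \<in> carrier G. a x \<noteq> \<one>\<^bsub>A\<^esub>}"
    define f where "f = (\<lambda>(k, x). if x \<in> ?S then w x k else 0)"
    have f: "f \<in> ?V"
    proof (rule G.free_moduleI)
      show "finite ((\<lambda>(x, k). (k, x)) ` Sigma ?S (\<lambda>x. {k. w x k \<noteq> 0}))"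
        using a coeffs_finite [OF w(1)] unfolding carrier_N by (intro finite_imageI finite_SigmaI) auto
      show "(\<lambda>(x, k). (k, x)) ` Sigma ?S (\<lambda>x. {k. w x k \<noteq> 0}) \<subseteq> I \<times> carrier G"
        using coeffs_outside [OF w(1)] by auto
    qed (force simp: f_def image_iff)
    have "q f = a"
    proof (rule N_ext [OF q_closed [OF f] a])
      fix x assume x: "x \<in> carrier G"
      then show "q f x = a x"
        using w presents_zero [OF \<kappa>] by (cases "x \<in> ?S") (auto simp: q_def f_def zero_fun_def)
    qed
    then show ?thesis using f by blast
  qed
  show ?thesis
  proof
    assume base: base_hopfian
    show "G.hopfian_mod I n"
      unfolding G.hopfian_mod_def
    proof (intro allI impI ballI)
      fix \<theta> f0
      assume \<theta>: "G.module_endo I \<theta>" and \<theta>K: "\<forall>f\<in>?K. \<theta> f \<in> ?K"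
        and surj: "\<forall>h\<in>?V. \<exists>f\<in>?V. h - \<theta> f \<in> ?K" and f0: "f0 \<in> ?V" "\<theta> f0 \<in> ?K"
      have \<theta>V [simp]: "\<theta> f \<in> ?V" if "f \<in> ?V" for f using G.endo_closed [OF \<theta> that] .
      have "\<forall>a\<in>carrier N. \<exists>f. f \<in> ?V \<and> q f = a" using q_surj by blast
      then obtain sec where sec [simp]: "\<And>a. a \<in> carrier N \<Longrightarrow> sec a \<in> ?V"
        "\<And>a. a \<in> carrier N \<Longrightarrow> q (sec a) = a" by metis
      define \<psi> where "\<psi> = (\<lambda>a. q (\<theta> (sec a)))"
      have \<psi>_q: "\<psi> (q f) = q (\<theta> f)" if f: "f \<in> ?V" for f
      proof -
        have "sec (q f) - f \<in> ?K" using f q_diff [of "sec (q f)" f] by simp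
        then have "\<theta> (sec (q f) - f) \<in> ?K" using \<theta>K by blast
        then have "\<theta> (sec (q f)) - \<theta> f \<in> ?K" using f G.endo_diff [OF \<theta>, of "sec (q f)" f] by simp
        then show ?thesis using f q_diff [of "\<theta> (sec (q f))" "\<theta> f"] by (simp add: \<psi>_def)
      qed
      have "inj_on \<psi> (carrier N)"
      proof (rule base [unfolded base_hopfian_def, rule_format])
        show "\<psi> \<in> hom N N"
        proof (rule homI)
          fix a b assume "a \<in> carrier N" "b \<in> carrier N"
          then obtain f h where fh: "f \<in> ?V" "q f = a" "h \<in> ?V" "q h = b" using q_surj by metis
          have "\<psi> (q (f + h)) = q (\<theta> (f + h))" by (rule \<psi>_q [OF G.free_module_add [OF fh(1,3)]])
          also have "\<dots> = \<psi> (q f) \<otimes>\<^bsub>N\<^esub> \<psi> (q h)"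
            using fh(1,3) by (simp only: \<psi>_q G.endo_add [OF \<theta>] q_add \<theta>V)
          finally have "\<psi> (q (f + h)) = \<psi> (q f) \<otimes>\<^bsub>N\<^esub> \<psi> (q h)" .
          then show "\<psi> (a \<otimes>\<^bsub>N\<^esub> b) = \<psi> a \<otimes>\<^bsub>N\<^esub> \<psi> b" using fh by (simp only: q_add)
        qed (simp add: \<psi>_def)
        show "\<psi> (act g a) = act g (\<psi> a)" if g: "g \<in> carrier G" and a: "a \<in> carrier N" for g a
        proof -
          obtain f where f: "f \<in> ?V" "q f = a" using q_surj [OF a] by blast
          have "\<psi> (q (G.shift g f)) = q (\<theta> (G.shift g f))"
            by (rule \<psi>_q [OF G.free_module_shift [OF f(1) g]])
          also have "\<dots> = act g (\<psi> (q f))"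
            using f(1) g by (simp only: \<psi>_q G.endo_shift [OF \<theta>] q_shift \<theta>V)
          finally have "\<psi> (q (G.shift g f)) = act g (\<psi> (q f))" .
          then show ?thesis using f g by (simp only: q_shift)
        qed
        show "\<psi> ` carrier N = carrier N"
        proof (intro equalityI subsetI)
          fix a assume "a \<in> carrier N"
          then obtain h where h: "h \<in> ?V" "q h = a" using q_surj by blast
          then obtain f where f: "f \<in> ?V" "h - \<theta> f \<in> ?K" using surj by blast
          then have "a = \<psi> (q f)" using h q_diff [of h "\<theta> f"] \<psi>_q by simp
          then show "a \<in> \<psi> ` carrier N" using q_closed [OF f(1)] by (rule image_eqI)
        qed (auto simp: \<psi>_def)
      qed
      moreover have "\<psi> (q f0) = \<psi> (q 0)"
      proof -
        have "\<psi> (q f0) = \<one>\<^bsub>N\<^esub>" using f0 q_one [of "\<theta> f0"] by (simp add: \<psi>_q)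
        moreover have "\<psi> (q 0) = \<one>\<^bsub>N\<^esub>"
          using \<psi>_q [OF G.free_module_zero] by (simp only: G.endo_zero [OF \<theta>] q_zero)
        ultimately show ?thesis by simp
      qed
      ultimately have "q f0 = q 0"
        by (rule inj_onD [OF _ _ q_closed [OF f0(1)] q_closed [OF G.free_module_zero]])
      then show "f0 \<in> ?K" using q_one [OF f0(1)] q_zero by simp
    qed
  next
    assume hopf: "G.hopfian_mod I n"
    show base_hopfian
      unfolding base_hopfian_def
    proof (intro ballI impI)
      fix \<psi> assume \<psi>: "\<psi> \<in> hom N N" and equi: "\<forall>g\<in>carrier G. \<forall>f\<in>carrier N. \<psi> (act g f) = act g (\<psi> f)"
        and surj: "\<psi> ` carrier N = carrier N"
      interpret \<psi>: group_hom N N \<psi> by unfold_locales (rule \<psi>)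
      have "\<forall>k\<in>I. \<exists>f. f \<in> ?V \<and> q f = \<psi> (q (delta (k, \<one>\<^bsub>G\<^esub>)))"
      proof
        fix k assume "k \<in> I"
        then have "\<psi> (q (delta (k, \<one>\<^bsub>G\<^esub>))) \<in> carrier N"
          by (intro \<psi>.hom_closed q_closed G.free_module_delta G.one_closed)
        from q_surj [OF this] show "\<exists>f. f \<in> ?V \<and> q f = \<psi> (q (delta (k, \<one>\<^bsub>G\<^esub>)))" by blast
      qed
      then obtain M where M: "\<And>k. k \<in> I \<Longrightarrow> M k \<in> ?V" "\<And>k. k \<in> I \<Longrightarrow> q (M k) = \<psi> (q (delta (k, \<one>\<^bsub>G\<^esub>)))"
        by metis
      define \<theta> where "\<theta> = G.linear_extension M"
      have \<theta>: "G.module_endo I \<theta>" unfolding \<theta>_def by (rule G.endo_linear_extension [OF M(1)])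
      have \<theta>V [simp]: "\<theta> f \<in> ?V" if "f \<in> ?V" for f using G.endo_closed [OF \<theta> that] .
      have q_\<theta>: "q (\<theta> f) = \<psi> (q f)" if "f \<in> ?V" for f
      proof (rule G.free_module_induct [OF that, where P = "\<lambda>f. q (\<theta> f) = \<psi> (q f)"])
        show "q (\<theta> 0) = \<psi> (q 0)" by (simp only: G.endo_zero [OF \<theta>] q_zero \<psi>.hom_one)
      next
        fix f h assume add: "f \<in> ?V" "h \<in> ?V" "q (\<theta> f) = \<psi> (q f)" "q (\<theta> h) = \<psi> (q h)"
        then show "q (\<theta> (f + h)) = \<psi> (q (f + h))" by (simp only: G.endo_add [OF \<theta>] q_add \<theta>V \<psi>.hom_mult q_closed)
      next
        fix f h assume diff: "f \<in> ?V" "h \<in> ?V" "q (\<theta> f) = \<psi> (q f)" "q (\<theta> h) = \<psi> (q h)"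
        have d: "f - h \<in> ?V" using diff by (intro G.free_module_diff)
        have "q (\<theta> (f - h)) \<otimes>\<^bsub>N\<^esub> q (\<theta> h) = q (\<theta> (f - h) + \<theta> h)" using d diff by (intro q_add [symmetric]) auto
        also have "\<theta> (f - h) + \<theta> h = \<theta> f" using diff by (simp only: G.endo_diff [OF \<theta>] diff_add_cancel)
        also have "q (\<theta> f) = \<psi> (q (f - h + h))" using diff by (simp only: diff_add_cancel)
        also have "\<dots> = \<psi> (q (f - h)) \<otimes>\<^bsub>N\<^esub> q (\<theta> h)"
          using d diff by (simp only: q_add \<psi>.hom_mult q_closed)
        finally show "q (\<theta> (f - h)) = \<psi> (q (f - h))"
          using N.right_cancel [OF q_closed [OF \<theta>V [OF diff(2)]] q_closed [OF \<theta>V [OF d]] \<psi>.hom_closed [OF q_closed [OF d]]]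
          by blast
      next
        fix k y assume delta: "k \<in> I" "y \<in> carrier G"
        have "q (\<theta> (delta (k, y))) = q (G.shift y (M k))"
          using delta G.endo_delta [OF \<theta> delta] G.linear_extension_delta [of M k I, OF M(1) [OF delta(1)]] by (simp only: \<theta>_def)
        also have "\<dots> = act y (\<psi> (q (delta (k, \<one>\<^bsub>G\<^esub>))))" using M delta by (simp only: q_shift)
        also have "\<dots> = \<psi> (act y (q (delta (k, \<one>\<^bsub>G\<^esub>))))" using equi delta by (simp del: act_apply)
        also have "act y (q (delta (k, \<one>\<^bsub>G\<^esub>))) = q (G.shift y (delta (k, \<one>\<^bsub>G\<^esub>)))"
          using delta by (intro q_shift [symmetric]) auto
        also have "\<dots> = q (delta (k, y))" using delta by (simp add: G.shift_delta)
        finally show "q (\<theta> (delta (k, y))) = \<psi> (q (delta (k, y)))" .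
      qed
      have \<theta>K: "\<theta> f \<in> ?K" if f: "f \<in> ?K" for f
      proof -
        have V: "f \<in> ?V" by (rule G.relationsD(1) [OF f])
        then have "q (\<theta> f) = \<one>\<^bsub>N\<^esub>" using f q_one [OF V] q_\<theta> [OF V] by simp
        then show ?thesis using q_one [OF \<theta>V [OF V]] by simp
      qed
      have \<theta>surj: "\<exists>f\<in>?V. h - \<theta> f \<in> ?K" if h: "h \<in> ?V" for h
      proof -
        from q_closed [OF h] have "q h \<in> \<psi> ` carrier N" by (simp only: surj)
        then obtain a where a: "q h = \<psi> a" "a \<in> carrier N" by (rule imageE)
        obtain f where f: "f \<in> ?V" "q f = a" using q_surj [OF a(2)] by blast
        then have "q h = q (\<theta> f)" using a q_\<theta> by simp
        then show ?thesis using f h q_diff [of h "\<theta> f"] by auto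
      qed
      show "inj_on \<psi> (carrier N)"
      proof (rule \<psi>.inj_on_one_iff [THEN iffD2], intro allI impI)
        fix a assume a: "a \<in> carrier N" "\<psi> a = \<one>\<^bsub>N\<^esub>"
        obtain f where f: "f \<in> ?V" "q f = a" using q_surj [OF a(1)] by blast
        then have "\<theta> f \<in> ?K" using a q_\<theta> [OF f(1)] q_one [OF \<theta>V [OF f(1)]] by simp
        then have "f \<in> ?K"
          using hopf \<theta> \<theta>K \<theta>surj f(1) unfolding G.hopfian_mod_def by blast
        then show "a = \<one>\<^bsub>N\<^esub>" using q_one [OF f(1)] f by simp
      qed
    qed
  qed
qed

end


section \<open>Hopfian wreath products\<close>

text \<open>
  The coordinates of \<open>A\<close> are indexed by \<open>B\<close> together with the triples \<open>(p, i, j)\<close> for \<open>j < d p i\<close>, the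
  latter with order \<open>p ^ i\<close>. Different pairs \<open>(p, i)\<close> give different orders since \<open>i \<ge> 1\<close>, so for
  each \<open>p\<close> and \<open>i\<close> there are \<open>d p i\<close> coordinates of order \<open>p ^ i\<close> if \<open>i \<le> m p\<close>, and otherwise there is none.
  The largest of these numbers is attained or zero, which matches the conditions for all \<open>i\<close> with the
  single condition in the maximal size.
\<close>

theorem theorem1p5:
  fixes \<Gamma> :: "'g monoid"
    and A :: "'a monoid"
    and A0 :: "'b monoid"
    and Ap :: "nat \<Rightarrow> 'c monoid"
    and B :: "'s set"
    and m :: "nat \<Rightarrow> nat"
    and d :: "nat \<Rightarrow> nat \<Rightarrow> nat"
  assumes "group \<Gamma>" and "finitely_generated_group \<Gamma>"
    and "comm_group A" and "finitely_generated_group A"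
    and "comm_group A0" and "A0 \<cong> free_Abelian_group B"
    and "\<And>p. prime p \<Longrightarrow> comm_group (Ap p)"
    and "\<And>p. prime p \<Longrightarrow> finite (carrier (Ap p))"
    and "\<And>p. prime p \<Longrightarrow> p_group p (Ap p)"
    and "A \<cong> A0 \<times>\<times> sum_group {p. prime p} Ap"
    and "\<And>p. prime p \<Longrightarrow>
           Ap p \<cong> sum_group {1..m p} (\<lambda>i. sum_group {..<d p i} (\<lambda>_. integer_mod_group (p ^ i)))"
  shows "hopfian (wreath_product A \<Gamma>) \<longleftrightarrow>
         hopfian \<Gamma> \<and>
         (\<forall>p. prime p \<longrightarrow>
            directly_finite
              (matrix_ring (Max (insert 0 (d p ` {1..m p})))
                 (group_ring (residue_ring (int p)) \<Gamma>)))"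
proof -
  interpret W: abelian_wreath A \<Gamma>
    using assms(1,3) by (simp add: abelian_wreath_def)
  interpret A0: comm_group A0 by (rule assms(5))
  let ?P = "{p::nat. prime p}"
  let ?It = "Sigma ?P (\<lambda>p. Sigma {1..m p} (\<lambda>i. Sigma {..<d p i} (\<lambda>_. {()})))"
  let ?I = "Inl ` B \<union> Inr ` ?It"
  define n :: "'s + nat \<times> nat \<times> nat \<times> unit \<Rightarrow> nat"
    where "n = case_sum (\<lambda>_. 0) (\<lambda>(p, i, j, _). p ^ i)"
  have "\<exists>\<kappa>. presents A ?I n \<kappa>"
  proof -
    have grp_p: "group (Ap p)" if "prime p" for p
      using assms(7) [OF that] by (simp add: comm_group.axioms)
    have "\<exists>\<kappa>. presents (Ap p) (Sigma {1..m p} (\<lambda>i. Sigma {..<d p i} (\<lambda>_. {()})))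
        (\<lambda>(i, j, _). p ^ i) \<kappa>" if p: "p \<in> ?P" for p
    proof -
      define \<kappa>i where "\<kappa>i = (\<lambda>i u. \<lambda>j\<in>{..<d p i}. u (j, ()) mod int (p ^ i))"
      have i: "presents (sum_group {..<d p i} (\<lambda>_. integer_mod_group (p ^ i)))
          (Sigma {..<d p i} (\<lambda>_. {()})) (\<lambda>(j, _). p ^ i) (\<kappa>i i)" for i
        unfolding \<kappa>i_def
        using p by (intro presents_sum_group presents_integer_mod_group) (auto simp: prime_gt_0_nat)
      have pres: "presents (sum_group {1..m p} (\<lambda>i. sum_group {..<d p i} (\<lambda>_. integer_mod_group (p ^ i))))
          (Sigma {1..m p} (\<lambda>i. Sigma {..<d p i} (\<lambda>_. {()}))) (\<lambda>(i, j, _). p ^ i)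
          (\<lambda>u. \<lambda>i\<in>{1..m p}. \<kappa>i i (\<lambda>z. u (i, z)))"
        by (rule presents_sum_group [OF _ i]) simp
      obtain h where h: "h \<in> iso (sum_group {1..m p} (\<lambda>i. sum_group {..<d p i} (\<lambda>_. integer_mod_group (p ^ i)))) (Ap p)"
        using group.iso_sym [OF grp_p assms(11)] p unfolding is_iso_def by blast
      have "group (sum_group {1..m p} (\<lambda>i. sum_group {..<d p i} (\<lambda>_. integer_mod_group (p ^ i))))"
        by simp
      moreover have "group (Ap p)" using grp_p p by simp
      ultimately show ?thesis by (intro exI) (rule presents_iso [OF pres h])
    qed
    then obtain \<kappa>p where \<kappa>p: "\<And>p. p \<in> ?P \<Longrightarrow>
        presents (Ap p) (Sigma {1..m p} (\<lambda>i. Sigma {..<d p i} (\<lambda>_. {()}))) (\<lambda>(i, j, _). p ^ i) (\<kappa>p p)"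
      by metis
    have torsion: "presents (sum_group ?P Ap) ?It (\<lambda>(p, z). case z of (i, j, _) \<Rightarrow> p ^ i)
        (\<lambda>u. \<lambda>p\<in>?P. \<kappa>p p (\<lambda>z. u (p, z)))"
      by (rule presents_sum_group [OF _ \<kappa>p]) (use grp_p in auto)
    obtain h0 where h0: "h0 \<in> iso (free_Abelian_group B) A0"
      using A0.iso_sym [OF assms(6)] unfolding is_iso_def by blast
    have free: "presents A0 B (\<lambda>_. 0) (h0 \<circ> Abs_poly_mapping)"
      by (rule presents_iso [OF presents_free_Abelian_group h0]) (auto simp: A0.is_group)
    obtain h where h: "h \<in> iso (A0 \<times>\<times> sum_group ?P Ap) A"
      using W.A.iso_sym [OF assms(10)] unfolding is_iso_def by blast
    have "group (A0 \<times>\<times> sum_group ?P Ap)"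
      using grp_p by (intro DirProd_group A0.is_group sum_group) auto
    from presents_iso [OF presents_DirProd [OF free torsion] h this W.A.is_group]
    show ?thesis unfolding n_def by (intro exI)
  qed
  then obtain \<kappa> where \<kappa>: "presents A ?I n \<kappa>" ..
  define J where "J = (\<lambda>p i. {k \<in> ?I. n k = p ^ i})"
  have J: "J p i = (if i \<le> m p then (\<lambda>j. Inr (p, i, j, ())) ` {..<d p i} else {})"
    if p: "prime p" and i: "1 \<le> i" for p i
  proof -
    let ?R = "if i \<le> m p then (\<lambda>j. Inr (p, i, j, ())) ` {..<d p i} else {}"
    have "k \<in> ?R" if k: "k \<in> ?I" "n k = p ^ i" for k
    proof (cases k)
      case (Inl b)
      then show ?thesis using k(2) p by (simp add: n_def)
    next
      case (Inr z)
      then obtain q i' j where z: "k = Inr (q, i', j, ())" "prime q" "1 \<le> i'" "i' \<le> m q" "j < d q i'"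
        using k(1) by auto
      then have "q ^ i' = p ^ i" using k(2) by (simp add: n_def)
      then have "q = p \<and> i' = i" using prime_power_inj'' [of q p i' i] z p i by simp
      then show ?thesis using z by simp
    qed
    moreover have "k \<in> ?I \<and> n k = p ^ i" if "k \<in> ?R" for k
      using that p i by (auto simp: n_def split: if_splits)
    ultimately show ?thesis unfolding J_def by blast
  qed
  have fin0: "finite {k \<in> ?I. n k = 0}"
    by (rule presents_fg_finite_rank [OF \<kappa> assms(3,4)])
  have finp: "finite {k \<in> ?I. \<exists>e\<ge>1. n k = p ^ e}" if p: "prime p" for p
  proof (rule finite_subset)
    show "{k \<in> ?I. \<exists>e\<ge>1. n k = p ^ e} \<subseteq> (\<Union>e\<in>{1..m p}. J p e)"
    proof
      fix k assume "k \<in> {k \<in> ?I. \<exists>e\<ge>1. n k = p ^ e}"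
      then obtain e where e: "1 \<le> e" "k \<in> J p e" by (auto simp: J_def)
      then have "e \<le> m p" using J [OF p e(1)] by (auto split: if_splits)
      then show "k \<in> (\<Union>e\<in>{1..m p}. J p e)" using e by auto
    qed
    show "finite (\<Union>e\<in>{1..m p}. J p e)" using J [OF p] by auto
  qed
  have "W.G.hopfian_mod ?I n \<longleftrightarrow> (\<forall>p i. prime p \<longrightarrow> 1 \<le> i \<longrightarrow> W.G.directly_finite_mod (int p) (J p i))"
  proof
    assume "W.G.hopfian_mod ?I n"
    then show "\<forall>p i. prime p \<longrightarrow> 1 \<le> i \<longrightarrow> W.G.directly_finite_mod (int p) (J p i)"
      unfolding J_def using W.G.directly_finite_mod_of_hopfian_mod by blast
  next
    assume *: "\<forall>p i. prime p \<longrightarrow> 1 \<le> i \<longrightarrow> W.G.directly_finite_mod (int p) (J p i)"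
    show "W.G.hopfian_mod ?I n"
    proof (rule W.G.hopfian_mod_of_directly_finite_mod [OF fin0 finp])
      fix k assume k: "k \<in> ?I"
      show "n k = 0 \<or> (\<exists>p e. prime p \<and> 1 \<le> e \<and> n k = p ^ e)"
      proof (cases k)
        case (Inr z)
        then obtain p i j where "k = Inr (p, i, j, ())" "prime p" "1 \<le> i" using k by auto
        then have "prime p \<and> 1 \<le> i \<and> n k = p ^ i" by (simp add: n_def)
        then show ?thesis by blast
      qed (simp add: n_def)
    qed (use * in \<open>auto simp: J_def\<close>)
  qed
  also have "\<dots> \<longleftrightarrow> (\<forall>p. prime p \<longrightarrow> W.G.directly_finite_mod (int p) {..<Max (insert 0 (d p ` {1..m p}))})"
  proof -
    have "(\<forall>i. 1 \<le> i \<longrightarrow> W.G.directly_finite_mod (int p) (J p i)) \<longleftrightarrow> W.G.directly_finite_mod (int p) {..<D}"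
      if p: "prime p" and D: "D = Max (insert 0 (d p ` {1..m p}))" for p D
    proof
      assume df: "W.G.directly_finite_mod (int p) {..<D}"
      show "\<forall>i. 1 \<le> i \<longrightarrow> W.G.directly_finite_mod (int p) (J p i)"
      proof (intro allI impI)
        fix i :: nat assume i: "1 \<le> i"
        let ?e = "\<lambda>k. fst (snd (snd (projr k)))"
        have "inj_on ?e (J p i)" using J [OF p i] by (auto simp: inj_on_def)
        moreover have "d p i \<le> D" if "i \<le> m p" unfolding D using that i by (intro Max_ge) auto
        then have "?e ` J p i \<subseteq> {..<D}" using J [OF p i] by auto
        ultimately show "W.G.directly_finite_mod (int p) (J p i)" by (rule W.G.directly_finite_mod_reindex [OF df])
      qed
    next
      assume df: "\<forall>i. 1 \<le> i \<longrightarrow> W.G.directly_finite_mod (int p) (J p i)"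
      have "D \<in> insert 0 (d p ` {1..m p})" unfolding D by (rule Max_in) auto
      then consider "D = 0" | i where "1 \<le> i" "i \<le> m p" "D = d p i" by auto
      then show "W.G.directly_finite_mod (int p) {..<D}"
      proof cases
        case 1
        have "W.G.directly_finite_mod (int p) (J p 1)" using df by simp
        then show ?thesis by (rule W.G.directly_finite_mod_reindex [of _ _ undefined]) (use 1 in auto)
      next
        case (2 i)
        have "W.G.directly_finite_mod (int p) (J p i)" using df 2 by simp
        then show ?thesis
          by (rule W.G.directly_finite_mod_reindex [of _ _ "\<lambda>j. Inr (p, i, j, ())"])
            (use J [OF p 2(1)] 2 in \<open>auto simp: inj_on_def\<close>)
      qed
    qed
    then show ?thesis by blast
  qed
  also have "\<dots> \<longleftrightarrow> (\<forall>p. prime p \<longrightarrow>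
      directly_finite (matrix_ring (Max (insert 0 (d p ` {1..m p}))) (group_ring (residue_ring (int p)) \<Gamma>)))"
    using W.G.matrix_ring_directly_finite_iff prime_gt_1_nat by (metis of_nat_1 of_nat_less_iff)
  finally show ?thesis
    unfolding W.hopfian_wreath_iff [OF assms(4)] W.base_hopfian_iff_hopfian_mod [OF \<kappa>] by simp
qed

end
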